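(* There are an entire function $q$ on $\mathbb C$ and a finite positive discrete measure $\mu$ on $\mathbb C$ such that the weight $$\phi(z)=\frac{|z|^2}{2}+\operatorname{Re}q(z)$$ satisfies $dd^c\phi=\frac12dd^c|z|^2$, the function $\mu(B(\cdot,r))$ belongs to $L^p(\mathbb C,dV)$ for all $0<p<\infty$ and $r>0$, and $T_{\mu,\phi}\in\mathcal S_p$ for every $0<p<\infty$ (in particular the form $q_{\mu,\phi}$ is bounded on $F_\phi^2$), while the form $q_{\mu,\phi}$ is unbounded (i.e. not bounded) on $\mathrm{PH}_{\phi,L^2}^2$.
   Context: $dV$ is Lebesgue measure on $\mathbb C$, $B(z,r)$ the Euclidean disk, $d^c=\frac i4(\overline\partial-\partial)$. $F_\phi^2$ is the Hilbert space of entire functions $g$ on $\mathbb C$ with $\|g\|_\phi^2=\int_{\mathbb C}|g|^2e^{-2\phi}dV<\infty$. $\mathrm{PH}_{\phi,L^2}^2=\{f\in L^2(\mathbb C,e^{-2\phi}dV): f\text{ is pluriharmonic}\}$ with the inherited $L^2(e^{-2\phi}dV)$ norm (in one complex dimension pluriharmonic means complex-valued harmonic, $\partial^2f/\partial z\partial\overline z=0$). For a positive Borel measure $\mu$, $q_{\mu,\phi}(f,u)=\int_{\mathbb C}f\,\overline u\,e^{-2\phi}\,d\mu$. The form is bounded on a Hilbert space $H$ of functions if the integral converges absolutely for all $f,u\in H$ and $|q_{\mu,\phi}(f,u)|\le C\|f\|_H\|u\|_H$ for some constant $C$. When it is bounded on $F_\phi^2$, $T_{\mu,\phi}$ denotes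 the bounded positive operator on $F_\phi^2$ with $\langle T_{\mu,\phi}f,u\rangle_\phi=q_{\mu,\phi}(f,u)$. $T\in\mathcal S_p$ means $T$ is compact and its singular values satisfy $\sum_ks_k(T)^p<\infty$. *)

theory Defs
  imports "HOL-Analysis.Analysis" "HOL-Library.Function_Algebras"
begin

section \<open>Wirtinger derivatives and the operator \<open>dd\<^sup>c\<close> on the complex plane\<close>

definition wirtinger_dz :: "(complex \<Rightarrow> complex) \<Rightarrow> complex \<Rightarrow> complex" where
  "wirtinger_dz f z =
     (frechet_derivative f (at z) 1 - \<i> * frechet_derivative f (at z) \<i>) / 2"

definition wirtinger_dzbar :: "(complex \<Rightarrow> complex) \<Rightarrow> complex \<Rightarrow> complex" where
  "wirtinger_dzbar f z =
     (frechet_derivative f (at z) 1 + \<i> * frechet_derivative f (at z) \<i>) / 2"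

text \<open>
  A complex-valued 1-form \<open>\<omega>\<close> is represented by \<open>\<omega> z u\<close>, its value at the point \<open>z\<close> on the
  tangent vector \<open>u\<close>; a 2-form likewise by \<open>\<eta> z u v\<close>.
\<close>

definition del_form :: "(complex \<Rightarrow> complex) \<Rightarrow> complex \<Rightarrow> complex \<Rightarrow> complex" where
  "del_form f z u = wirtinger_dz f z * u"

definition delbar_form :: "(complex \<Rightarrow> complex) \<Rightarrow> complex \<Rightarrow> complex \<Rightarrow> complex" where
  "delbar_form f z u = wirtinger_dzbar f z * cnj u"

definition dc_form :: "(complex \<Rightarrow> complex) \<Rightarrow> complex \<Rightarrow> complex \<Rightarrow> complex" where
  "dc_form f z u = \<i> / 4 * (delbar_form f z u - del_form f z u)"

definition ext_deriv ::
  "(complex \<Rightarrow> complex \<Rightarrow> complex) \<Rightarrow> complex \<Rightarrow> complex \<Rightarrow> complex \<Rightarrow> complex" where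
  "ext_deriv \<omega> z u v =
     frechet_derivative (\<lambda>w. \<omega> w v) (at z) u - frechet_derivative (\<lambda>w. \<omega> w u) (at z) v"

text \<open>With this normalisation \<open>dd\<^sup>c f = (i/2) f\<^sub>z\<^sub>z\<^sub>b\<^sub>a\<^sub>r dz \<and> dzbar = (\<Delta>f/4) dx \<and> dy\<close>.\<close>

definition ddc :: "(complex \<Rightarrow> complex) \<Rightarrow> complex \<Rightarrow> complex \<Rightarrow> complex \<Rightarrow> complex" where
  "ddc f = ext_deriv (dc_form f)"

definition C1_plane :: "(complex \<Rightarrow> complex) \<Rightarrow> bool" where
  "C1_plane f \<longleftrightarrow> (\<forall>z. f differentiable (at z)) \<and>
     continuous_on UNIV (wirtinger_dz f) \<and> continuous_on UNIV (wirtinger_dzbar f)"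

definition C2_plane :: "(complex \<Rightarrow> complex) \<Rightarrow> bool" where
  "C2_plane f \<longleftrightarrow> C1_plane f \<and> C1_plane (wirtinger_dz f) \<and> C1_plane (wirtinger_dzbar f)"

definition pluriharmonic :: "(complex \<Rightarrow> complex) \<Rightarrow> bool" where
  "pluriharmonic f \<longleftrightarrow> C2_plane f \<and> (\<forall>z. wirtinger_dz (wirtinger_dzbar f) z = 0)"


section \<open>The spaces, their norm, and the form \<open>q\<close>\<close>

definition weighted_L2 :: "(complex \<Rightarrow> real) \<Rightarrow> (complex \<Rightarrow> complex) set" where
  "weighted_L2 \<phi> = {f \<in> borel_measurable lborel.
     integrable lborel (\<lambda>z. (cmod (f z))\<^sup>2 * exp (- 2 * \<phi> z))}"

definition L2_inner ::
  "(complex \<Rightarrow> real) \<Rightarrow> (complex \<Rightarrow> complex) \<Rightarrow> (complex \<Rightarrow> complex) \<Rightarrow> complex" where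
  "L2_inner \<phi> f g = (LINT z|lborel. f z * cnj (g z) * of_real (exp (- 2 * \<phi> z)))"

definition L2_norm :: "(complex \<Rightarrow> real) \<Rightarrow> (complex \<Rightarrow> complex) \<Rightarrow> real" where
  "L2_norm \<phi> f = sqrt (LINT z|lborel. (cmod (f z))\<^sup>2 * exp (- 2 * \<phi> z))"

definition fock_space :: "(complex \<Rightarrow> real) \<Rightarrow> (complex \<Rightarrow> complex) set" where
  "fock_space \<phi> = {f \<in> weighted_L2 \<phi>. f holomorphic_on UNIV}"

definition PH_space :: "(complex \<Rightarrow> real) \<Rightarrow> (complex \<Rightarrow> complex) set" where
  "PH_space \<phi> = {f \<in> weighted_L2 \<phi>. pluriharmonic f}"

definition q_form :: "complex measure \<Rightarrow> (complex \<Rightarrow> real) \<Rightarrow>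
    (complex \<Rightarrow> complex) \<Rightarrow> (complex \<Rightarrow> complex) \<Rightarrow> complex" where
  "q_form \<mu> \<phi> f u = (LINT z|\<mu>. f z * cnj (u z) * of_real (exp (- 2 * \<phi> z)))"

definition q_form_bounded ::
  "complex measure \<Rightarrow> (complex \<Rightarrow> real) \<Rightarrow> (complex \<Rightarrow> complex) set \<Rightarrow> bool" where
  "q_form_bounded \<mu> \<phi> H \<longleftrightarrow>
     (\<forall>f\<in>H. \<forall>u\<in>H. integrable \<mu> (\<lambda>z. f z * cnj (u z) * of_real (exp (- 2 * \<phi> z)))) \<and>
     (\<exists>C. \<forall>f\<in>H. \<forall>u\<in>H. cmod (q_form \<mu> \<phi> f u) \<le> C * L2_norm \<phi> f * L2_norm \<phi> u)"

text \<open>Purely atomic: concentrated on a countable set.\<close>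

definition discrete_measure :: "complex measure \<Rightarrow> bool" where
  "discrete_measure \<mu> \<longleftrightarrow>
     sets \<mu> = sets borel \<and> (\<exists>A. countable A \<and> emeasure \<mu> (- A) = 0)"

definition in_Lp :: "real \<Rightarrow> (complex \<Rightarrow> real) \<Rightarrow> bool" where
  "in_Lp p f \<longleftrightarrow>
     f \<in> borel_measurable lborel \<and> integrable lborel (\<lambda>z. \<bar>f z\<bar> powr p)"


section \<open>Schatten classes on a space of functions\<close>

text \<open>
  Below, \<open>H\<close> is a set of functions on which \<open>L2_inner \<phi>\<close> is a Hilbert space inner product
  (in the application, \<open>H = fock_space \<phi>\<close>). An operator on \<open>H\<close> is a map on all functions of which
  only the values on \<open>H\<close> matter.
\<close>

definition bounded_operator_on ::
  "(complex \<Rightarrow> real) \<Rightarrow> (complex \<Rightarrow> complex) set \<Rightarrow>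
    ((complex \<Rightarrow> complex) \<Rightarrow> (complex \<Rightarrow> complex)) \<Rightarrow> bool" where
  "bounded_operator_on \<phi> H T \<longleftrightarrow>
     (\<forall>f\<in>H. T f \<in> H) \<and>
     (\<forall>f\<in>H. \<forall>g\<in>H. \<forall>a b. T (\<lambda>z. a * f z + b * g z) = (\<lambda>z. a * T f z + b * T g z)) \<and>
     (\<exists>C. \<forall>f\<in>H. L2_norm \<phi> (T f) \<le> C * L2_norm \<phi> f)"

definition compact_operator_on ::
  "(complex \<Rightarrow> real) \<Rightarrow> (complex \<Rightarrow> complex) set \<Rightarrow>
    ((complex \<Rightarrow> complex) \<Rightarrow> (complex \<Rightarrow> complex)) \<Rightarrow> bool" where
  "compact_operator_on \<phi> H T \<longleftrightarrow> bounded_operator_on \<phi> H T \<and>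
     (\<forall>x :: nat \<Rightarrow> complex \<Rightarrow> complex.
        (\<forall>n. x n \<in> H) \<and> (\<exists>C. \<forall>n. L2_norm \<phi> (x n) \<le> C) \<longrightarrow>
        (\<exists>r g. strict_mono r \<and> g \<in> H \<and>
           (\<lambda>n. L2_norm \<phi> (\<lambda>z. T (x (r n)) z - g z)) \<longlonglongrightarrow> 0))"

definition adjoint_on ::
  "(complex \<Rightarrow> real) \<Rightarrow> (complex \<Rightarrow> complex) set \<Rightarrow>
    ((complex \<Rightarrow> complex) \<Rightarrow> (complex \<Rightarrow> complex)) \<Rightarrow>
    (complex \<Rightarrow> complex) \<Rightarrow> (complex \<Rightarrow> complex)" where
  "adjoint_on \<phi> H T g = (THE h. h \<in> H \<and> (\<forall>f\<in>H. L2_inner \<phi> (T f) g = L2_inner \<phi> f h))"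

definition cfun_scale :: "complex \<Rightarrow> (complex \<Rightarrow> complex) \<Rightarrow> (complex \<Rightarrow> complex)" where
  "cfun_scale c f = (\<lambda>z. c * f z)"

interpretation cfun: vector_space cfun_scale
  by unfold_locales (auto simp: cfun_scale_def fun_eq_iff algebra_simps)

text \<open>The eigenspace of \<open>T\<^sup>* T\<close> for \<open>s\<^sup>2\<close>, that is, the eigenspace of \<open>(T\<^sup>* T)\<^bsup>1/2\<^esup>\<close> for \<open>s\<close>.\<close>

definition singular_space ::
  "(complex \<Rightarrow> real) \<Rightarrow> (complex \<Rightarrow> complex) set \<Rightarrow>
    ((complex \<Rightarrow> complex) \<Rightarrow> (complex \<Rightarrow> complex)) \<Rightarrow> real \<Rightarrow> (complex \<Rightarrow> complex) set" where
  "singular_space \<phi> H T s =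
     {f \<in> H. adjoint_on \<phi> H T (T f) = cfun_scale (complex_of_real (s\<^sup>2)) f}"

text \<open>
  The decreasing sequence of singular values, in which every positive singular value occurs as
  often as the dimension of its eigenspace; it is continued by zeros if \<open>T\<close> has finite rank.
  For compact \<open>T\<close> these conditions determine the sequence uniquely.
\<close>

definition singular_values ::
  "(complex \<Rightarrow> real) \<Rightarrow> (complex \<Rightarrow> complex) set \<Rightarrow>
    ((complex \<Rightarrow> complex) \<Rightarrow> (complex \<Rightarrow> complex)) \<Rightarrow> (nat \<Rightarrow> real) \<Rightarrow> bool" where
  "singular_values \<phi> H T s \<longleftrightarrow> antimono s \<and> (\<forall>k. 0 \<le> s k) \<and>
     (\<forall>\<sigma>>0. finite {k. s k = \<sigma>} \<and>
        (\<exists>B. finite B \<and> cfun.independent B \<and> cfun.span B = singular_space \<phi> H T \<sigma> \<and>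
             card B = card {k. s k = \<sigma>}))"

definition schatten_class ::
  "real \<Rightarrow> (complex \<Rightarrow> real) \<Rightarrow> (complex \<Rightarrow> complex) set \<Rightarrow>
    ((complex \<Rightarrow> complex) \<Rightarrow> (complex \<Rightarrow> complex)) set" where
  "schatten_class p \<phi> H = {T. compact_operator_on \<phi> H T \<and>
     (\<exists>s. singular_values \<phi> H T s \<and> summable (\<lambda>k. s k powr p))}"

text \<open>
  If the form is bounded on \<open>fock_space \<phi>\<close>, the function described exists and is unique for every
  \<open>f\<close> in that space, by Riesz representation.
\<close>

definition toeplitz :: "complex measure \<Rightarrow> (complex \<Rightarrow> real) \<Rightarrow>
    (complex \<Rightarrow> complex) \<Rightarrow> (complex \<Rightarrow> complex)" where
  "toeplitz \<mu> \<phi> f = (THE g. g \<in> fock_space \<phi> \<and>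
     (\<forall>u\<in>fock_space \<phi>. L2_inner \<phi> g u = q_form \<mu> \<phi> f u))"

end

theory Submission
  imports Defs "HOL-Complex_Analysis.Complex_Analysis" "HOL-Probability.Distributions"
    "HOL-Real_Asymp.Real_Asymp"
begin

text \<open>
  Take \<open>q z = - exp z - z\<^sup>2 / 2\<close>, so that \<open>\<phi> = (Im z)\<^sup>2 - Re (exp z)\<close>. For large \<open>N\<close> consider the
  primitive \<open>A\<close> of \<open>exp (c z - exp z)\<close>, where \<open>c = 1/2 + \<i>N\<close>, which vanishes as \<open>Re z \<rightarrow> - \<infinity>\<close>. It
  is multiplied by a real number under \<open>z \<mapsto> z + 2\<pi>\<i>\<close>; hence its limits in all the half strips where
  \<open>exp (- exp z)\<close> decays lie on one real line through \<open>0\<close>, and after a rotation \<open>Im A\<close> tends to \<open>0\<close> in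
  each of them. Integrating along paths of descent, \<open>Im A\<close> is seen to be of size
  \<open>1/N\<close> relative to the weight, except near the saddle points \<open>exp z = \<i>N\<close>, where it has size \<open>1/\<surd>N\<close> on
  discs of radius \<open>1/\<surd>N\<close>. So point evaluations on the space of harmonic functions have unbounded norm
  relative to the weight, and a measure \<open>\<Sum> 2\<^sup>-\<^sup>n \<delta>\<^bsub>a n\<^esub>\<close> with suitably chosen \<open>a n\<close> defeats boundedness.

  On the Fock space, point evaluations are uniformly bounded relative to the weight. Functions
  vanishing at the first \<open>k\<close> atoms see only the mass \<open>2\<^bsup>1 - k\<^esup>\<close>, so the \<open>k\<close>-th singular
  value of \<open>T\<close> is \<open>O(2\<^sup>-\<^sup>k)\<close>.
\<close>

section \<open>Compact positive operators\<close>

text \<open>The obstacle is that \<open>A\<close> has no reason to be square integrable: its limits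
  in the half strips where \<open>exp (- exp z)\<close> decays meet a weight
  \<open>exp (- 2 * \<phi>)\<close> that explodes there. Passing to an imaginary part removes all
  these limits, and harmonic functions, unlike entire ones, allow it. The real part of
  \<open>c\<close> is forced: positive for decay on the left, below 1 for decay on the right, and
  half an integer so that the multiplier \<open>exp (2 * pi * \<i> * c)\<close> is real. Hence 1/2,
  with the symmetric decay \<open>exp (- \<bar>x\<bar> / 2)\<close>. Translated to a saddle point,
  the weight is, up to a constant, the square of \<open>exp height\<close> times a Gaussian in
  \<open>Im w\<close>, while the integrand has modulus \<open>exp (x / 2 - height)\<close>. So all
  estimates concern one periodic quantity, \<open>profile\<close>. At the scale
  \<open>width = 1 / sqrt N\<close> it has a uniform majorant of order \<open>width\<close> and
  attains a multiple of \<open>width\<close>, but it is \<open>o(width)\<close> off the lines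
  \<open>sin y = 0\<close>; dominated convergence then takes the place of measuring the discs around
  the saddle points.\<close>

lemma squeeze_0:
  fixes f g :: "nat \<Rightarrow> real"
  assumes "\<And>n. 0 \<le> f n" "\<And>n. f n \<le> g n" "g \<longlonglongrightarrow> 0"
  shows "f \<longlonglongrightarrow> 0"
  by (rule tendsto_sandwich[OF _ _ tendsto_const assms(3)]) (use assms in auto)

text \<open>Definiteness is postponed because the locale is instantiated twice: for the inner
  product and for \<open>ip (T f) g\<close>, which may have a kernel. Cauchy--Schwarz for the second
  form drives the spectral argument.\<close>

locale positive_form = vector_space scale
  for scale :: "complex \<Rightarrow> 'v::ab_group_add \<Rightarrow> 'v" (infixr \<open>*s\<close> 75) +
  fixes H :: "'v set" and ip :: "'v \<Rightarrow> 'v \<Rightarrow> complex"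
  assumes subspace_H: "subspace H"
    and ip_add_left: "f \<in> H \<Longrightarrow> g \<in> H \<Longrightarrow> h \<in> H \<Longrightarrow> ip (f + g) h = ip f h + ip g h"
    and ip_scale_left: "f \<in> H \<Longrightarrow> h \<in> H \<Longrightarrow> ip (a *s f) h = a * ip f h"
    and ip_cnj: "f \<in> H \<Longrightarrow> g \<in> H \<Longrightarrow> ip g f = cnj (ip f g)"
    and ip_nonneg: "f \<in> H \<Longrightarrow> 0 \<le> Re (ip f f)"
begin

definition nm :: "'v \<Rightarrow> real" where "nm f = sqrt (Re (ip f f))"

lemma H_closed [simp, intro]:
  "0 \<in> H" "f \<in> H \<Longrightarrow> g \<in> H \<Longrightarrow> f + g \<in> H" "f \<in> H \<Longrightarrow> g \<in> H \<Longrightarrow> f - g \<in> H"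
  "f \<in> H \<Longrightarrow> a *s f \<in> H" "f \<in> H \<Longrightarrow> - f \<in> H"
  using subspace_H by (auto simp: subspace_0 subspace_add subspace_diff subspace_scale subspace_neg)

lemma H_sum [intro]: "(\<And>i. i \<in> A \<Longrightarrow> x i \<in> H) \<Longrightarrow> (\<Sum>i\<in>A. x i) \<in> H"
  by (rule subspace_sum[OF subspace_H])

lemma ip_add_right: "f \<in> H \<Longrightarrow> g \<in> H \<Longrightarrow> h \<in> H \<Longrightarrow> ip h (f + g) = ip h f + ip h g"
  using ip_cnj[of "f + g" h] ip_cnj[of f h] ip_cnj[of g h] ip_add_left[of f g h] by simp

lemma ip_scale_right: "f \<in> H \<Longrightarrow> h \<in> H \<Longrightarrow> ip h (a *s f) = cnj a * ip h f"
  using ip_cnj[of "a *s f" h] ip_cnj[of f h] ip_scale_left[of f h a] by simp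

lemma ip_zero_left [simp]: "h \<in> H \<Longrightarrow> ip 0 h = 0"
  using ip_scale_left[of h h 0] by simp

lemma ip_zero_right [simp]: "h \<in> H \<Longrightarrow> ip h 0 = 0"
  using ip_scale_right[of h h 0] by simp

lemma ip_diff_left: "f \<in> H \<Longrightarrow> g \<in> H \<Longrightarrow> h \<in> H \<Longrightarrow> ip (f - g) h = ip f h - ip g h"
  using ip_add_left[of "f - g" g h] by (simp add: algebra_simps)

lemma ip_diff_right: "f \<in> H \<Longrightarrow> g \<in> H \<Longrightarrow> h \<in> H \<Longrightarrow> ip h (f - g) = ip h f - ip h g"
  using ip_add_right[of "f - g" g h] by (simp add: algebra_simps)

lemma ip_sum_left:
  "finite A \<Longrightarrow> (\<And>i. i \<in> A \<Longrightarrow> x i \<in> H) \<Longrightarrow> h \<in> H \<Longrightarrow> ip (\<Sum>i\<in>A. x i) h = (\<Sum>i\<in>A. ip (x i) h)"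
  by (induction A rule: finite_induct) (auto simp: ip_add_left H_sum)

lemma ip_sum_right:
  "finite A \<Longrightarrow> (\<And>i. i \<in> A \<Longrightarrow> x i \<in> H) \<Longrightarrow> h \<in> H \<Longrightarrow> ip h (\<Sum>i\<in>A. x i) = (\<Sum>i\<in>A. ip h (x i))"
  by (induction A rule: finite_induct) (auto simp: ip_add_right H_sum)

lemma ip_self: "f \<in> H \<Longrightarrow> ip f f = complex_of_real ((nm f)\<^sup>2)"
  using ip_cnj[of f f] ip_nonneg[of f] by (simp add: complex_eq_iff nm_def)

lemma nm_nonneg [simp]: "f \<in> H \<Longrightarrow> 0 \<le> nm f"
  using ip_nonneg by (simp add: nm_def)

lemma nm_sq: "f \<in> H \<Longrightarrow> (nm f)\<^sup>2 = Re (ip f f)"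
  using ip_self by simp

lemma nm_zero [simp]: "nm 0 = 0"
  by (simp add: nm_def)

lemma nm_scale: "f \<in> H \<Longrightarrow> nm (a *s f) = cmod a * nm f"
proof -
  assume f: "f \<in> H"
  have "Re (ip (a *s f) (a *s f)) = Re ((a * cnj a) * ip f f)"
    using f by (simp add: ip_scale_left ip_scale_right mult_ac)
  also have "a * cnj a = of_real ((cmod a)\<^sup>2)"
    using complex_norm_square[of a] by simp
  finally show ?thesis
    by (simp add: nm_def real_sqrt_mult)
qed

lemma nm_minus_commute: "f \<in> H \<Longrightarrow> g \<in> H \<Longrightarrow> nm (f - g) = nm (g - f)"
  using nm_scale[of "f - g" "-1"] by (simp add: scale_minus_left)

lemma nm_diff_sq:
  assumes "f \<in> H" "g \<in> H"
  shows "(nm (f - g))\<^sup>2 = (nm f)\<^sup>2 - 2 * Re (ip f g) + (nm g)\<^sup>2"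
  using assms ip_cnj[of f g] by (simp add: nm_sq ip_diff_left ip_diff_right)

lemma Cauchy_Schwarz_sq:
  assumes f: "f \<in> H" and g: "g \<in> H"
  shows "(cmod (ip f g))\<^sup>2 \<le> (nm f)\<^sup>2 * (nm g)\<^sup>2"
proof -
  define c where "c = ip f g"
  \<comment> \<open>The multiplier \<open>t * c\<close> with real \<open>t\<close> makes the cross
    term real, so a single real parameter suffices.\<close>
  have key: "0 \<le> (nm f)\<^sup>2 - 2 * t * (cmod c)\<^sup>2 + t\<^sup>2 * (cmod c)\<^sup>2 * (nm g)\<^sup>2" for t :: real
  proof -
    let ?z = "of_real t * c"
    have "(nm (f - ?z *s g))\<^sup>2 = (nm f)\<^sup>2 - 2 * Re (cnj ?z * c) + (cmod ?z)\<^sup>2 * (nm g)\<^sup>2"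
      using f g by (simp add: nm_diff_sq ip_scale_right nm_scale c_def power_mult_distrib)
    also have "cnj ?z * c = of_real (t * (cmod c)\<^sup>2)"
      using complex_norm_square[of c] by (simp add: mult.commute mult.left_commute)
    finally show ?thesis
      using zero_le_power2[of "nm (f - ?z *s g)"]
      by (simp add: norm_mult power_mult_distrib mult.assoc)
  qed
  show ?thesis
  proof (cases "nm g = 0")
    case True
    have "c = 0"
    proof (rule ccontr)
      assume "c \<noteq> 0"
      then have pos: "(cmod c)\<^sup>2 > 0" by simp
      \<comment> \<open>With \<open>nm g = 0\<close> the inequality \<open>key\<close> is affine in
        \<open>t\<close>; this value of \<open>t\<close> would turn its right side into -1.\<close>
      from key[of "((nm f)\<^sup>2 + 1) / (2 * (cmod c)\<^sup>2)"] pos True show False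
        by (simp add: field_simps)
    qed
    then show ?thesis by (simp add: c_def)
  next
    case False
    then have pos: "(nm g)\<^sup>2 > 0" by simp
    then have "(1 / (nm g)\<^sup>2)\<^sup>2 * (cmod c)\<^sup>2 * (nm g)\<^sup>2 = (cmod c)\<^sup>2 / (nm g)\<^sup>2"
      by (simp add: power2_eq_square)
    with key[of "1 / (nm g)\<^sup>2"] have "0 \<le> (nm f)\<^sup>2 - (cmod c)\<^sup>2 / (nm g)\<^sup>2"
      by simp
    with pos show ?thesis by (simp add: c_def field_simps)
  qed
qed

lemma Cauchy_Schwarz:
  assumes "f \<in> H" "g \<in> H"
  shows "cmod (ip f g) \<le> nm f * nm g"
  using Cauchy_Schwarz_sq[OF assms] assms
  by (simp add: power_mult_distrib[symmetric] power2_le_iff_abs_le)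

lemma nm_triangle:
  assumes "f \<in> H" "g \<in> H"
  shows "nm (f + g) \<le> nm f + nm g"
proof -
  have "(nm (f + g))\<^sup>2 = (nm f)\<^sup>2 + 2 * Re (ip f g) + (nm g)\<^sup>2"
    using assms ip_cnj[of f g] by (simp add: nm_sq ip_add_left ip_add_right)
  also have "\<dots> \<le> (nm f)\<^sup>2 + 2 * (nm f * nm g) + (nm g)\<^sup>2"
    using complex_Re_le_cmod[of "ip f g"] Cauchy_Schwarz[OF assms] by simp
  also have "\<dots> = (nm f + nm g)\<^sup>2" by (simp add: power2_sum)
  finally show ?thesis using assms by (simp add: power2_le_iff_abs_le)
qed

lemma nm_triangle_diff:
  assumes "f \<in> H" "g \<in> H"
  shows "nm f \<le> nm g + nm (f - g)"
  using nm_triangle[of g "f - g"] assms by simp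

lemma nm_triangle3:
  assumes "f \<in> H" "g \<in> H" "h \<in> H"
  shows "nm (f - h) \<le> nm (f - g) + nm (g - h)"
  using nm_triangle[of "f - g" "g - h"] assms by simp

end

locale inner_product = positive_form +
  assumes ip_definite: "f \<in> H \<Longrightarrow> ip f f = 0 \<Longrightarrow> f = 0"
begin

lemma nm_eq_0: "f \<in> H \<Longrightarrow> nm f = 0 \<longleftrightarrow> f = 0"
  using ip_self[of f] ip_definite[of f] by auto

lemma ip_ext:
  assumes "f \<in> H" "g \<in> H" "\<And>u. u \<in> H \<Longrightarrow> ip u f = ip u g"
  shows "f = g"
proof -
  have "ip (f - g) (f - g) = 0" using assms by (simp add: ip_diff_right)
  with ip_definite[of "f - g"] assms show ?thesis by simp
qed

end

section \<open>Spectral theory of a compact positive operator\<close>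

locale compact_positive_operator = inner_product scale H ip
  for scale :: "complex \<Rightarrow> 'v::ab_group_add \<Rightarrow> 'v" (infixr \<open>*s\<close> 75) and H ip +
  fixes T :: "'v \<Rightarrow> 'v"
  assumes T_in [simp, intro]: "f \<in> H \<Longrightarrow> T f \<in> H"
    and T_add: "f \<in> H \<Longrightarrow> g \<in> H \<Longrightarrow> T (f + g) = T f + T g"
    and T_scale: "f \<in> H \<Longrightarrow> T (a *s f) = a *s T f"
    and T_sym: "f \<in> H \<Longrightarrow> g \<in> H \<Longrightarrow> ip (T f) g = ip f (T g)"
    and T_pos: "f \<in> H \<Longrightarrow> 0 \<le> Re (ip (T f) f)"
    and T_bounded: "\<exists>C. \<forall>f\<in>H. nm (T f) \<le> C * nm f"
    and T_compact: "(\<And>n. x n \<in> H) \<Longrightarrow> (\<And>n. nm (x n) \<le> C) \<Longrightarrow>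
      \<exists>r g. strict_mono (r :: nat \<Rightarrow> nat) \<and> g \<in> H \<and> (\<lambda>n. nm (T (x (r n)) - g)) \<longlonglongrightarrow> 0"
begin

lemma T_zero [simp]: "T 0 = 0"
  using T_scale[of 0 0] by simp

lemma T_diff: "f \<in> H \<Longrightarrow> g \<in> H \<Longrightarrow> T (f - g) = T f - T g"
  using T_add[of "f - g" g] by (simp add: algebra_simps)

lemma T_sum: "finite A \<Longrightarrow> (\<And>i. i \<in> A \<Longrightarrow> x i \<in> H) \<Longrightarrow> T (\<Sum>i\<in>A. x i) = (\<Sum>i\<in>A. T (x i))"
  by (induction A rule: finite_induct) (auto simp: T_add H_sum)

sublocale form: positive_form scale H "\<lambda>f g. ip (T f) g"
proof
  fix f g assume "f \<in> H" "g \<in> H"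
  then show "ip (T g) f = cnj (ip (T f) g)"
    using ip_cnj[of "T f" g] ip_cnj[of "T g" f] T_sym[of f g] T_sym[of g f] by simp
qed (auto simp: subspace_H T_add T_scale ip_add_left ip_scale_left T_pos)

definition quad :: "'v \<Rightarrow> real" where "quad f = Re (ip (T f) f)"

lemma quad_nonneg: "f \<in> H \<Longrightarrow> 0 \<le> quad f"
  by (simp add: quad_def T_pos)

lemma form_nm_sq: "f \<in> H \<Longrightarrow> (form.nm f)\<^sup>2 = quad f"
  by (simp add: form.nm_sq quad_def)

lemma quad_scale: "f \<in> H \<Longrightarrow> quad (a *s f) = (cmod a)\<^sup>2 * quad f"
  using form.nm_scale[of f a] form_nm_sq[of f] form_nm_sq[of "a *s f"]
  by (simp add: power_mult_distrib)

text \<open>Cauchy--Schwarz for the positive form \<open>ip (T f) g\<close>, applied to \<open>f\<close> and \<open>T f\<close>.\<close>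

lemma nm_T_le_quad:
  assumes K: "K \<subseteq> H" "T ` K \<subseteq> K" and s: "\<And>f. f \<in> K \<Longrightarrow> quad f \<le> s * (nm f)\<^sup>2" and f: "f \<in> K"
  shows "(nm (T f))\<^sup>2 \<le> s * quad f"
proof -
  have fH: "f \<in> H" "T f \<in> H" and TK: "T f \<in> K" using K f by auto
  have "((nm (T f))\<^sup>2)\<^sup>2 = (cmod (ip (T f) (T f)))\<^sup>2"
    using ip_self[OF fH(2)] by (simp add: norm_power)
  also have "\<dots> \<le> quad f * quad (T f)"
    using form.Cauchy_Schwarz_sq[OF fH] by (simp add: form_nm_sq fH)
  also have "\<dots> \<le> quad f * (s * (nm (T f))\<^sup>2)"
    by (intro mult_left_mono s TK quad_nonneg fH)
  finally have *: "(nm (T f))\<^sup>2 * (nm (T f))\<^sup>2 \<le> (s * quad f) * (nm (T f))\<^sup>2"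
    by (simp add: power2_eq_square mult_ac)
  show ?thesis
  proof (cases "nm (T f) = 0")
    case True
    have "0 \<le> s * quad f"
    proof (cases "quad f = 0")
      case False
      then have "0 < quad f" using quad_nonneg fH by force
      with s[OF f] have "0 < s * (nm f)\<^sup>2" by simp
      then have "0 \<le> s" by (simp add: zero_less_mult_iff)
      then show ?thesis using quad_nonneg[OF fH(1)] by simp
    qed simp
    then show ?thesis using True by simp
  next
    case False
    then have "0 < (nm (T f))\<^sup>2" by simp
    with * show ?thesis using mult_right_le_imp_le by blast
  qed
qed

text \<open>The Rayleigh quotient is maximised over the invariant subspace \<open>K\<close>. Along a
  maximising sequence \<open>T x - s x\<close> tends to 0, so the convergent subsequence of
  \<open>T x\<close> supplied by compactness makes \<open>x\<close> converge as well. If the form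
  vanishes on \<open>K\<close>, the pair \<open>e = 0\<close>, \<open>s = 0\<close> is
  returned.\<close>

lemma exists_top_eigenvector:
  assumes sub: "subspace K" and K: "K \<subseteq> H" "T ` K \<subseteq> K"
    and closed: "\<And>x g. (\<And>n::nat. x n \<in> K) \<Longrightarrow> g \<in> H \<Longrightarrow> (\<lambda>n. nm (x n - g)) \<longlonglongrightarrow> 0 \<Longrightarrow> g \<in> K"
  shows "\<exists>e\<in>K. \<exists>s\<ge>0. T e = of_real s *s e \<and> (nm e = 1 \<or> e = 0 \<and> s = 0) \<and>
    (\<forall>f\<in>K. quad f \<le> s * (nm f)\<^sup>2)"
proof (cases "\<forall>f\<in>K. quad f \<le> 0")
  case True
  then show ?thesis using subspace_0[OF sub] by (intro bexI[of _ 0] exI[of _ 0]) auto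
next
  case False
  then obtain f0 where f0: "f0 \<in> K" "quad f0 > 0" by force
  have KH: "f \<in> K \<Longrightarrow> f \<in> H" for f using K by auto
  obtain C where C: "\<And>f. f \<in> H \<Longrightarrow> nm (T f) \<le> C * nm f" using T_bounded by blast
  have quadC: "quad f \<le> C * (nm f)\<^sup>2" if "f \<in> H" for f
  proof -
    have "quad f \<le> nm (T f) * nm f"
      unfolding quad_def using complex_Re_le_cmod Cauchy_Schwarz[of "T f" f] that order_trans by auto
    also have "\<dots> \<le> C * nm f * nm f"
      using C[OF that] that by (intro mult_right_mono) auto
    finally show ?thesis by (simp add: power2_eq_square mult.assoc)
  qed
  have unit: "\<exists>u\<in>K. nm u = 1 \<and> quad f = quad u * (nm f)\<^sup>2" if f: "f \<in> K" "nm f \<noteq> 0" for f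
  proof -
    let ?u = "of_real (1 / nm f) *s f"
    have "?u \<in> K" using sub f subspace_scale by blast
    moreover have "nm ?u = 1" using f KH[OF f(1)] by (simp add: nm_scale norm_divide)
    moreover have "quad ?u = quad f / (nm f)\<^sup>2"
      using KH[OF f(1)] by (simp add: quad_scale norm_divide power_divide)
    ultimately show ?thesis using f by (intro bexI[of _ ?u]) auto
  qed
  define A where "A = quad ` {f \<in> K. nm f = 1}"
  define s where "s = Sup A"
  have nm0: "nm f0 \<noteq> 0" using quadC[OF KH[OF f0(1)]] f0 by auto
  obtain u0 where u0: "u0 \<in> K" "nm u0 = 1" "quad f0 = quad u0 * (nm f0)\<^sup>2" using unit[OF f0(1) nm0] by blast
  have u0pos: "quad u0 > 0" using u0 f0 by (metis zero_less_mult_pos2 nm0 zero_less_power2)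
  have bdd: "bdd_above A"
    unfolding A_def by (rule bdd_aboveI[of _ C]) (use quadC KH in force)
  have A_ne: "A \<noteq> {}" using u0 by (auto simp: A_def)
  have upper: "quad u \<le> s" if "u \<in> K" "nm u = 1" for u
    unfolding s_def by (rule cSup_upper[OF _ bdd]) (use that in \<open>auto simp: A_def\<close>)
  have spos: "s > 0" using upper[OF u0(1,2)] u0pos by simp
  have les: "quad f \<le> s * (nm f)\<^sup>2" if f: "f \<in> K" for f
  proof (cases "nm f = 0")
    case True
    then show ?thesis using quadC[OF KH[OF f]] by simp
  next
    case False
    then show ?thesis using unit[OF f] upper by (metis mult_right_mono zero_le_power2)
  qed
  have "\<exists>u\<in>K. nm u = 1 \<and> s - 1 / real (Suc n) < quad u" for n
  proof -
    have "\<exists>a\<in>A. s - 1 / real (Suc n) < a"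
      using less_cSup_iff[OF A_ne bdd, of "s - 1 / real (Suc n)"] by (simp add: s_def)
    then show ?thesis by (auto simp: A_def)
  qed
  then obtain x where x: "\<And>n. x n \<in> K" "\<And>n. nm (x n) = 1" "\<And>n::nat. s - 1 / real (Suc n) < quad (x n)"
    by metis
  have xH: "\<And>n. x n \<in> H" using x KH by auto
  \<comment> \<open>In the expansion of the square, \<open>nm_T_le_quad\<close> bounds
    \<open>(nm (T (x n)))\<^sup>2\<close> by \<open>s * quad (x n)\<close>; what remains is
    \<open>s\<close> times the defect of the maximising sequence.\<close>
  have approx: "(nm (T (x n) - of_real s *s x n))\<^sup>2 \<le> s * (1 / real (Suc n))" for n
  proof -
    have "(nm (T (x n) - of_real s *s x n))\<^sup>2 = (nm (T (x n)))\<^sup>2 - 2 * (s * quad (x n)) + s\<^sup>2"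
      using xH[of n] x(2)[of n] by (simp add: nm_diff_sq ip_scale_right nm_scale quad_def)
    also have "\<dots> \<le> s * quad (x n) - 2 * (s * quad (x n)) + s\<^sup>2"
      using nm_T_le_quad[OF K les x(1)] by simp
    also have "\<dots> = s * (s - quad (x n))" by (simp add: power2_eq_square algebra_simps)
    also have "\<dots> \<le> s * (1 / real (Suc n))"
      using x(3)[of n] spos by (intro mult_left_mono) auto
    finally show ?thesis .
  qed
  have diff0: "(\<lambda>n. nm (T (x n) - of_real s *s x n)) \<longlonglongrightarrow> 0"
  proof -
    have lim: "(\<lambda>n. s * (1 / real (Suc n))) \<longlonglongrightarrow> 0"
      using tendsto_mult[OF tendsto_const[of s] LIMSEQ_inverse_real_of_nat]
      by (simp add: inverse_eq_divide)
    have "(\<lambda>n. (nm (T (x n) - of_real s *s x n))\<^sup>2) \<longlonglongrightarrow> 0"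
      by (rule squeeze_0[OF _ approx lim]) simp
    from tendsto_real_sqrt[OF this] show ?thesis using xH by simp
  qed
  obtain r g where r: "strict_mono (r :: nat \<Rightarrow> nat)" and g: "g \<in> H"
    and lim: "(\<lambda>n. nm (T (x (r n)) - g)) \<longlonglongrightarrow> 0"
    using T_compact[of x 1] xH x(2) by (metis order_refl)
  define e where "e = of_real (1 / s) *s g"
  have eH: "e \<in> H" using g by (simp add: e_def)
  have g_eq: "g = of_real s *s e" using spos by (simp add: e_def)
  have lim_e: "(\<lambda>n. nm (x (r n) - e)) \<longlonglongrightarrow> 0"
  proof -
    have le: "nm (x (r n) - e) \<le> 1 / s * (nm (T (x (r n)) - of_real s *s x (r n)) + nm (T (x (r n)) - g))" for n
    proof -
      have "x (r n) - e = of_real (1 / s) *s (of_real s *s x (r n) - g)"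
        using spos by (simp add: e_def scale_right_diff_distrib)
      then have "nm (x (r n) - e) = 1 / s * nm (of_real s *s x (r n) - g)"
        using xH g spos by (simp add: nm_scale norm_divide)
      also have "nm (of_real s *s x (r n) - g)
          \<le> nm (of_real s *s x (r n) - T (x (r n))) + nm (T (x (r n)) - g)"
        using xH g by (intro nm_triangle3) auto
      finally show ?thesis
        using spos xH nm_minus_commute[of "T (x (r n))" "of_real s *s x (r n)"]
        by (simp add: divide_right_mono)
    qed
    have "(\<lambda>n. 1 / s * (nm (T (x (r n)) - of_real s *s x (r n)) + nm (T (x (r n)) - g))) \<longlonglongrightarrow> 1 / s * (0 + 0)"
      using LIMSEQ_subseq_LIMSEQ[OF diff0 r] lim by (intro tendsto_intros) (auto simp: o_def)
    then show ?thesis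
      by (intro squeeze_0[OF _ le]) (use xH eH in auto)
  qed
  have eK: "e \<in> K" by (rule closed[OF _ eH lim_e]) (use x in auto)
  have "(\<lambda>n. nm (T e - T (x (r n))) + nm (T (x (r n)) - g)) \<longlonglongrightarrow> 0 + 0"
  proof (intro tendsto_add lim)
    have le: "nm (T e - T (x (r n))) \<le> C * nm (x (r n) - e)" for n
      using C[of "x (r n) - e"] xH eH by (simp add: T_diff nm_minus_commute[of "T e"])
    have "(\<lambda>n. C * nm (x (r n) - e)) \<longlonglongrightarrow> C * 0" by (intro tendsto_intros lim_e)
    then show "(\<lambda>n. nm (T e - T (x (r n)))) \<longlonglongrightarrow> 0"
      by (intro squeeze_0[OF _ le]) (use xH eH in auto)
  qed
  moreover have "nm (T e - g) \<le> nm (T e - T (x (r n))) + nm (T (x (r n)) - g)" for n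
    using xH eH g by (intro nm_triangle3) auto
  ultimately have "nm (T e - g) \<le> 0 + 0" by (intro LIMSEQ_le_const) auto
  moreover have "T e - g \<in> H" "0 \<le> nm (T e - g)" using eH g by auto
  ultimately have "T e = g" using nm_eq_0[of "T e - g"] by simp
  moreover have "nm e = 1"
  proof -
    have "\<bar>nm e - 1\<bar> \<le> nm (x (r n) - e)" for n
      using nm_triangle_diff[of e "x (r n)"] nm_triangle_diff[of "x (r n)" e] xH eH x(2)[of "r n"]
        nm_minus_commute[of e "x (r n)"] by auto
    then have "\<bar>nm e - 1\<bar> \<le> 0" using LIMSEQ_le_const[OF lim_e] by blast
    then show ?thesis by simp
  qed
  ultimately show ?thesis using eK les g_eq spos by (intro bexI[of _ e] exI[of _ s]) auto
qed

definition perp :: "'v set \<Rightarrow> 'v set" where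
  "perp B = {f \<in> H. \<forall>e\<in>B. ip f e = 0}"

definition top_eigenpair :: "'v set \<Rightarrow> 'v \<Rightarrow> real \<Rightarrow> bool" where
  "top_eigenpair B e s \<longleftrightarrow> e \<in> perp B \<and> 0 \<le> s \<and> T e = of_real s *s e \<and>
     (nm e = 1 \<or> e = 0 \<and> s = 0) \<and> (\<forall>f\<in>perp B. quad f \<le> s * (nm f)\<^sup>2)"

lemma exists_top_eigenpair:
  assumes B: "\<And>e. e \<in> B \<Longrightarrow> e \<in> H \<and> (\<exists>s. T e = of_real s *s e)"
  shows "\<exists>e s. top_eigenpair B e s"
proof -
  have "\<exists>e\<in>perp B. \<exists>s\<ge>0. T e = of_real s *s e \<and> (nm e = 1 \<or> e = 0 \<and> s = 0) \<and>
    (\<forall>f\<in>perp B. quad f \<le> s * (nm f)\<^sup>2)"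
  proof (rule exists_top_eigenvector)
    show "subspace (perp B)"
      unfolding perp_def using B by (auto intro!: subspaceI simp: ip_add_left ip_scale_left)
    show "perp B \<subseteq> H" by (auto simp: perp_def)
    show "T ` perp B \<subseteq> perp B"
    proof (clarsimp simp: perp_def)
      fix f e assume f: "f \<in> H" "\<forall>e\<in>B. ip f e = 0" and e: "e \<in> B"
      obtain s where "T e = of_real s *s e" "e \<in> H" using B[OF e] by blast
      then show "ip (T f) e = 0" using f e by (simp add: T_sym ip_scale_right)
    qed
  next
    fix x g assume x: "\<And>n::nat. x n \<in> perp B" and g: "g \<in> H" and lim: "(\<lambda>n. nm (x n - g)) \<longlonglongrightarrow> 0"
    show "g \<in> perp B"
      unfolding perp_def
    proof (safe intro!: g)
      fix e assume e: "e \<in> B"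
      have eH: "e \<in> H" using B e by blast
      have "cmod (ip g e) \<le> nm (x n - g) * nm e" for n
      proof -
        have xn: "x n \<in> H" "ip (x n) e = 0" using x[of n] e by (auto simp: perp_def)
        then show ?thesis using Cauchy_Schwarz[of "x n - g" e] g eH by (simp add: ip_diff_left)
      qed
      moreover have "(\<lambda>n. nm (x n - g) * nm e) \<longlonglongrightarrow> 0 * nm e" by (intro tendsto_intros lim)
      ultimately have "cmod (ip g e) \<le> 0" using LIMSEQ_le_const by fastforce
      then show "ip g e = 0" by simp
    qed
  qed
  then show ?thesis unfolding top_eigenpair_def by blast
qed

text \<open>Each eigenvector depends on all earlier ones; carrying the list of them turns this into
  primitive recursion.\<close>

primrec eig_list :: "nat \<Rightarrow> 'v list" where
  "eig_list 0 = []"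
| "eig_list (Suc n) = eig_list n @ [SOME e. \<exists>s. top_eigenpair (set (eig_list n)) e s]"

definition eig :: "nat \<Rightarrow> 'v" where
  "eig n = (SOME e. \<exists>s. top_eigenpair (set (eig_list n)) e s)"

definition eigval :: "nat \<Rightarrow> real" where
  "eigval n = quad (eig n)"

lemma set_eig_list: "set (eig_list n) = eig ` {..<n}"
  by (induction n) (auto simp: eig_def lessThan_Suc)

lemma top_eigenpair_value: "top_eigenpair B e s \<Longrightarrow> s = quad e"
  by (auto simp: top_eigenpair_def quad_def ip_scale_left perp_def ip_self)

lemma eig_spec: "top_eigenpair (eig ` {..<n}) (eig n) (eigval n)"
proof (induction n rule: less_induct)
  case (less n)
  have "\<exists>e s. top_eigenpair (eig ` {..<n}) e s"
  proof (rule exists_top_eigenpair)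
    fix e assume "e \<in> eig ` {..<n}"
    then show "e \<in> H \<and> (\<exists>s. T e = of_real s *s e)"
      using less by (auto simp: top_eigenpair_def perp_def)
  qed
  then have "\<exists>s. top_eigenpair (eig ` {..<n}) (eig n) s"
    unfolding eig_def[of n] set_eig_list by (rule someI_ex)
  then show ?case using top_eigenpair_value unfolding eigval_def by blast
qed

lemma eig_in [simp, intro]: "eig n \<in> H"
  and eigval_nonneg [simp]: "0 \<le> eigval n"
  and T_eig: "T (eig n) = of_real (eigval n) *s eig n"
  and eig_cases: "nm (eig n) = 1 \<or> eig n = 0 \<and> eigval n = 0"
  using eig_spec[of n] by (auto simp: top_eigenpair_def perp_def)

lemma quad_le_eigval:
  "f \<in> H \<Longrightarrow> (\<And>i. i < n \<Longrightarrow> ip f (eig i) = 0) \<Longrightarrow> quad f \<le> eigval n * (nm f)\<^sup>2"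
  using eig_spec[of n] by (auto simp: top_eigenpair_def perp_def)

lemma nm_eig: "0 < eigval n \<Longrightarrow> nm (eig n) = 1"
  using eig_cases[of n] by auto

lemma eig_orthogonal: "i \<noteq> j \<Longrightarrow> ip (eig i) (eig j) = 0"
proof (induction i j rule: linorder_wlog)
  case (le i j)
  have "eig j \<in> perp (eig ` {..<j})" using eig_spec[of j] by (simp add: top_eigenpair_def)
  then have "ip (eig j) (eig i) = 0" using le by (auto simp: perp_def)
  then show ?case using ip_cnj[of "eig j" "eig i"] by simp
next
  case (sym i j)
  then show ?case using ip_cnj[of "eig i" "eig j"] by simp
qed

text \<open>\<open>eig (Suc n)\<close> is also orthogonal to the first \<open>n\<close>
  eigenvectors, hence a competitor in the maximisation that defines \<open>eigval n\<close>.\<close>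

lemma eigval_antimono: "antimono eigval"
proof (rule decseq_SucI)
  fix n
  have "eig (Suc n) \<in> perp (eig ` {..<Suc n})" using eig_spec[of "Suc n"] by (simp add: top_eigenpair_def)
  then have "eigval (Suc n) \<le> eigval n * (nm (eig (Suc n)))\<^sup>2"
    unfolding eigval_def[of "Suc n"] by (intro quad_le_eigval) (auto simp: perp_def)
  also have "\<dots> \<le> eigval n" using eig_cases[of "Suc n"] by auto
  finally show "eigval (Suc n) \<le> eigval n" .
qed

text \<open>If the eigenvalues stayed above \<open>l > 0\<close>, the images of two distinct
  eigenvectors would be orthogonal of norm at least \<open>l\<close>, hence at distance at least
  \<open>l\<close>, and no subsequence of the images could converge.\<close>

lemma eigval_tendsto_0: "eigval \<longlonglongrightarrow> 0"
proof -
  obtain l where l: "eigval \<longlonglongrightarrow> l" and ge: "\<And>n. l \<le> eigval n"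
    using decseq_convergent[OF eigval_antimono, of 0] eigval_nonneg by blast
  have "0 \<le> l" using LIMSEQ_le_const[OF l] by auto
  moreover have "\<not> 0 < l"
  proof
    assume lpos: "0 < l"
    then have pos: "0 < eigval n" for n using ge[of n] by simp
    obtain r g where r: "strict_mono (r :: nat \<Rightarrow> nat)" and g: "g \<in> H"
      and lim: "(\<lambda>n. nm (T (eig (r n)) - g)) \<longlonglongrightarrow> 0"
      using T_compact[of eig 1] nm_eig[OF pos] by (metis eig_in order_refl)
    from lim lpos obtain n where n: "\<And>k. k \<ge> n \<Longrightarrow> nm (T (eig (r k)) - g) < l / 2"
      using order_tendstoD(2)[OF lim, of "l / 2"] by (auto simp: eventually_sequentially)
    let ?i = "r n" and ?j = "r (Suc n)"
    have neq: "?i \<noteq> ?j" using r by (simp add: strict_mono_eq)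
    have "nm (T (eig ?i) - T (eig ?j)) \<le> nm (T (eig ?i) - g) + nm (g - T (eig ?j))"
      using g by (intro nm_triangle3) auto
    also have "\<dots> < l / 2 + l / 2"
      using n[of n] n[of "Suc n"] g nm_minus_commute[of g "T (eig ?j)"] by (intro add_strict_mono) auto
    finally have "nm (T (eig ?i) - T (eig ?j)) < l" by simp
    then have "(nm (T (eig ?i) - T (eig ?j)))\<^sup>2 < l\<^sup>2"
      by (intro power_strict_mono) auto
    also have "(nm (T (eig ?i) - T (eig ?j)))\<^sup>2 = (eigval ?i)\<^sup>2 + (eigval ?j)\<^sup>2"
      using neq by (simp add: T_eig nm_diff_sq ip_scale_left ip_scale_right eig_orthogonal nm_scale nm_eig pos)
    finally have "(eigval ?i)\<^sup>2 + (eigval ?j)\<^sup>2 < l\<^sup>2" .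
    moreover have "l\<^sup>2 \<le> (eigval ?i)\<^sup>2" using ge lpos by (intro power_mono) auto
    ultimately show False using zero_le_power2[of "eigval ?j"] by linarith
  qed
  ultimately show ?thesis using l by simp
qed

lemma finite_eigval_ge: "0 < s \<Longrightarrow> finite {k. s \<le> eigval k}"
proof -
  assume "0 < s"
  then obtain n where "\<And>k. n \<le> k \<Longrightarrow> eigval k < s"
    using order_tendstoD(2)[OF eigval_tendsto_0] by (auto simp: eventually_sequentially)
  then have "{k. s \<le> eigval k} \<subseteq> {..<n}" by (auto simp: not_less[symmetric])
  then show ?thesis using finite_subset by blast
qed

text \<open>Factor \<open>T\<^sup>2 - s\<^sup>2 = (T + s) (T - s)\<close>: the vector
  \<open>T f - s f\<close> would be an eigenvector of \<open>T\<close> for \<open>- s < 0\<close>,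
  which positivity excludes unless it is 0. This links singular spaces, defined through the square,
  to eigenvectors of \<open>T\<close>.\<close>

lemma T_sq_eigenvector:
  assumes f: "f \<in> H" and s: "0 < s" and TT: "T (T f) = of_real (s\<^sup>2) *s f"
  shows "T f = of_real s *s f"
proof -
  let ?g = "T f - of_real s *s f"
  have gH: "?g \<in> H" using f by auto
  have "T ?g = of_real (s\<^sup>2) *s f - of_real s *s T f"
    using f TT by (simp add: T_diff T_scale)
  also have "\<dots> = of_real (- s) *s ?g"
    by (simp add: scale_right_diff_distrib power2_eq_square)
  finally have Tg: "T ?g = of_real (- s) *s ?g" .
  have "quad ?g = - s * (nm ?g)\<^sup>2"
    unfolding quad_def Tg ip_scale_left[OF gH gH] ip_self[OF gH] by simp
  then have "s * (nm ?g)\<^sup>2 \<le> 0" using quad_nonneg[OF gH] by linarith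
  then have "(nm ?g)\<^sup>2 \<le> 0" using s by (simp only: mult_le_0_iff) linarith
  then have "?g = 0" using nm_eq_0[OF gH] by simp
  then show ?thesis by simp
qed

lemma eigenvector_orthogonal:
  assumes f: "f \<in> H" and Tf: "T f = of_real s *s f" and neq: "eigval k \<noteq> s"
  shows "ip f (eig k) = 0"
proof -
  have "of_real s * ip f (eig k) = of_real (eigval k) * ip f (eig k)"
    using T_sym[OF f eig_in[of k]] f by (simp add: Tf T_eig ip_scale_left ip_scale_right)
  then show ?thesis using neq by simp
qed

lemma sing_eigenspace:
  assumes s: "0 < s"
  shows "finite {k. eigval k = s} \<and> (\<exists>B. finite B \<and> independent B \<and>
    span B = {f \<in> H. T (T f) = of_real (s\<^sup>2) *s f} \<and> card B = card {k. eigval k = s})"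
proof -
  define I where "I = {k. eigval k = s}"
  have finI: "finite I"
    by (rule finite_subset[OF _ finite_eigval_ge[OF s]]) (auto simp: I_def)
  have nmI: "k \<in> I \<Longrightarrow> nm (eig k) = 1" for k using nm_eig[of k] s by (auto simp: I_def)
  have ipI: "ip (eig i) (eig j) = (if i = j then 1 else 0)" if "i \<in> I" for i j
    using that nmI eig_orthogonal[of i j] by (auto simp: ip_self)
  have inj: "inj_on eig I"
  proof (rule inj_onI)
    fix i j assume "i \<in> I" "j \<in> I" "eig i = eig j"
    then show "i = j" using ipI[of i i] ipI[of i j] by (auto split: if_splits)
  qed
  have ip_comb: "ip (\<Sum>i\<in>I. c i *s eig i) (eig j) = c j" if "j \<in> I" for c j
  proof -
    have "ip (\<Sum>i\<in>I. c i *s eig i) (eig j) = (\<Sum>i\<in>I. c i * ip (eig i) (eig j))"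
      using finI by (subst ip_sum_left) (auto simp: ip_scale_left)
    also have "\<dots> = (\<Sum>i\<in>I. if i = j then c i else 0)"
      by (intro sum.cong) (auto simp: ipI)
    finally show ?thesis using finI that by simp
  qed
  have indep: "independent (eig ` I)"
  proof (rule independent_if_scalars_zero)
    show "finite (eig ` I)" using finI by simp
    fix u x assume zero: "(\<Sum>x\<in>eig ` I. u x *s x) = 0" and "x \<in> eig ` I"
    then obtain j where j: "j \<in> I" "x = eig j" by blast
    have "(\<Sum>i\<in>I. u (eig i) *s eig i) = 0" using zero inj by (simp add: sum.reindex)
    then show "u x = 0" using ip_comb[OF j(1), of "\<lambda>i. u (eig i)"] j by simp
  qed
  have "span (eig ` I) = {f \<in> H. T (T f) = of_real (s\<^sup>2) *s f}"
  proof (intro equalityI subsetI)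
    fix f assume "f \<in> span (eig ` I)"
    moreover have "subspace {f \<in> H. T (T f) = of_real (s\<^sup>2) *s f}"
      by (rule subspaceI) (auto simp: T_add T_scale scale_right_distrib mult.commute)
    moreover have "eig ` I \<subseteq> {f \<in> H. T (T f) = of_real (s\<^sup>2) *s f}"
      by (auto simp: I_def T_eig T_scale power2_eq_square)
    ultimately show "f \<in> {f \<in> H. T (T f) = of_real (s\<^sup>2) *s f}" using span_minimal by blast
  next
    fix f assume "f \<in> {f \<in> H. T (T f) = of_real (s\<^sup>2) *s f}"
    then have f: "f \<in> H" and Tf: "T f = of_real s *s f" using T_sq_eigenvector s by auto
    define p where "p = (\<Sum>i\<in>I. ip f (eig i) *s eig i)"
    have pH: "p \<in> H" unfolding p_def by (intro H_sum) auto
    have "T p = of_real s *s p"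
      unfolding p_def using finI
      by (subst T_sum) (auto simp: T_scale T_eig scale_sum_right I_def mult.commute intro!: sum.cong)
    then have Tfp: "T (f - p) = of_real s *s (f - p)"
      using f pH by (simp add: T_diff Tf scale_right_diff_distrib)
    have orth: "ip (f - p) (eig k) = 0" for k
    proof (cases "k \<in> I")
      case True
      then show ?thesis using f pH ip_comb[OF True] by (simp add: ip_diff_left p_def)
    next
      case False
      then show ?thesis using eigenvector_orthogonal[OF _ Tfp] f pH by (auto simp: I_def)
    qed
    \<comment> \<open>The remainder \<open>f - p\<close> is orthogonal to every
      \<open>eig k\<close>, so if nonzero its Rayleigh quotient \<open>s\<close> would be at most
      \<open>eigval n\<close> for every \<open>n\<close>; one \<open>n\<close> with
      \<open>eigval n < s\<close> refutes this.\<close>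
    obtain n where n: "eigval n < s"
      using order_tendstoD(2)[OF eigval_tendsto_0 s] by (auto simp: eventually_sequentially)
    have "s * (nm (f - p))\<^sup>2 = quad (f - p)"
      using f pH by (simp add: quad_def Tfp ip_scale_left ip_self)
    also have "\<dots> \<le> eigval n * (nm (f - p))\<^sup>2"
      using f pH by (intro quad_le_eigval orth) auto
    finally have "(s - eigval n) * (nm (f - p))\<^sup>2 \<le> 0" by (simp add: algebra_simps)
    then have "(nm (f - p))\<^sup>2 \<le> 0" using n by (simp add: mult_le_0_iff)
    then have "f = p" using nm_eq_0[of "f - p"] f pH by simp
    then show "f \<in> span (eig ` I)"
      unfolding p_def by (metis (no_types, lifting) imageI span_base span_scale span_sum)
  qed
  then show ?thesis using finI indep card_image[OF inj] unfolding I_def by blast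
qed

end

section \<open>Upper bounds for eigenvalues from finitely many linear constraints\<close>

lemma underdetermined_nontrivial_solution:
  fixes a :: "'i \<Rightarrow> 'j \<Rightarrow> 'a::field"
  assumes "finite I" "finite J" "card I < card J"
  shows "\<exists>x. (\<exists>j\<in>J. x j \<noteq> 0) \<and> (\<forall>i\<in>I. (\<Sum>j\<in>J. a i j * x j) = 0)"
  using assms
proof (induction I arbitrary: J a rule: finite_induct)
  case empty
  then have "J \<noteq> {}" by auto
  then show ?case by (intro exI[of _ "\<lambda>_. 1"]) auto
next
  case (insert i I)
  show ?case
  proof (cases "\<forall>j\<in>J. a i j = 0")
    case True
    from insert have "card I < card J" by simp
    from insert.IH[OF insert.prems(1) this, of a] show ?thesis using True by auto
  next
    case False
    then obtain k where k: "k \<in> J" "a i k \<noteq> 0" by auto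
    \<comment> \<open>Gaussian elimination: row \<open>i\<close> removes the unknown
      \<open>k\<close> from the other rows, and \<open>y\<close> restores it at the end by solving
      row \<open>i\<close>.\<close>
    let ?J = "J - {k}" and ?b = "\<lambda>i' j. a i' j - a i' k * a i j / a i k"
    have "finite ?J" "card I < card ?J" using insert k by auto
    from insert.IH[OF this, of ?b] obtain x where
      x: "\<exists>j\<in>?J. x j \<noteq> 0" "\<And>i'. i' \<in> I \<Longrightarrow> (\<Sum>j\<in>?J. ?b i' j * x j) = 0" by blast
    define y where "y = x(k := - (\<Sum>j\<in>?J. a i j * x j) / a i k)"
    have yk: "y k = - (\<Sum>j\<in>?J. a i j * x j) / a i k" by (simp add: y_def)
    have y: "(\<Sum>j\<in>J. a i' j * y j) = a i' k * y k + (\<Sum>j\<in>?J. a i' j * x j)" for i'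
      using insert.prems(1) k by (subst sum.remove[of J k]) (auto simp: y_def intro!: sum.cong)
    have "(\<Sum>j\<in>J. a i' j * y j) = (\<Sum>j\<in>?J. ?b i' j * x j)" for i'
    proof -
      have "(\<Sum>j\<in>?J. ?b i' j * x j) = (\<Sum>j\<in>?J. a i' j * x j) - a i' k / a i k * (\<Sum>j\<in>?J. a i j * x j)"
        by (simp add: algebra_simps sum_subtractf sum_distrib_left)
      then show ?thesis by (simp only: y yk) simp
    qed
    moreover have "(\<Sum>j\<in>?J. ?b i j * x j) = 0" using k by (simp add: field_simps)
    moreover have "\<exists>j\<in>J. y j \<noteq> 0" using x(1) by (auto simp: y_def)
    ultimately show ?thesis using x(2) by (intro exI[of _ y]) auto
  qed
qed

context compact_positive_operator
begin

text \<open>One half of the min-max principle. The \<open>k\<close> functionals have a common zero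
  among the nontrivial combinations of the \<open>k + 1\<close> vectors
  \<open>eig 0, ..., eig k\<close>, and on the span of these vectors the Rayleigh quotient is at
  least \<open>eigval k\<close>. If \<open>eigval k\<close> is positive, all these vectors are
  orthonormal.\<close>

lemma eigval_le:
  assumes add: "\<And>i f g. f \<in> H \<Longrightarrow> g \<in> H \<Longrightarrow> l i (f + g) = l i f + (l i g :: complex)"
    and scale: "\<And>i c f. f \<in> H \<Longrightarrow> l i (c *s f) = c * l i f"
    and \<tau>: "\<And>f. f \<in> H \<Longrightarrow> (\<And>i. i < k \<Longrightarrow> l i f = 0) \<Longrightarrow> quad f \<le> \<tau> * (nm f)\<^sup>2" "0 \<le> \<tau>"
  shows "eigval k \<le> \<tau>"
proof (cases "eigval k = 0")
  case True
  then show ?thesis using \<tau>(2) by simp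
next
  case False
  then have pos: "0 < eigval i" if "i \<le> k" for i
    using decseqD[OF eigval_antimono that] eigval_nonneg[of k] by linarith
  have l_sum: "l i (\<Sum>j\<in>J. x j) = (\<Sum>j\<in>J. l i (x j))" if "finite J" "\<And>j. x j \<in> H" for i and J :: "nat set" and x
    using that(1)
  proof (induction J rule: finite_induct)
    case empty
    show ?case using scale[of 0 i 0] by simp
  next
    case (insert j J)
    then show ?case using that(2) by (simp add: add H_sum)
  qed
  obtain x where x: "\<exists>j\<in>{..k}. x j \<noteq> 0" "\<And>i. i < k \<Longrightarrow> (\<Sum>j\<le>k. l i (eig j) * x j) = 0"
    using underdetermined_nontrivial_solution[of "{..<k}" "{..k}" "\<lambda>i j. l i (eig j)"] by auto
  define v where "v = (\<Sum>j\<le>k. x j *s eig j)"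
  have vH: "v \<in> H" unfolding v_def by (intro H_sum) auto
  have lv: "l i v = 0" if "i < k" for i
    unfolding v_def using x(2)[OF that] by (subst l_sum) (auto simp: scale mult.commute)
  have ipv: "ip (eig i) v = cnj (x i)" if "i \<le> k" for i
  proof -
    have "ip (eig i) v = (\<Sum>j\<le>k. cnj (x j) * ip (eig i) (eig j))"
      unfolding v_def by (subst ip_sum_right) (auto simp: ip_scale_right)
    also have "\<dots> = (\<Sum>j\<le>k. if j = i then cnj (x j) else 0)"
      using pos by (intro sum.cong) (auto simp: eig_orthogonal ip_self nm_eig)
    finally show ?thesis using that by simp
  qed
  have comb: "Re (ip (\<Sum>j\<le>k. (of_real (d j) * x j) *s eig j) v) = (\<Sum>j\<le>k. d j * (cmod (x j))\<^sup>2)"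
    for d :: "nat \<Rightarrow> real"
  proof -
    have "ip (\<Sum>j\<le>k. (of_real (d j) * x j) *s eig j) v = (\<Sum>j\<le>k. of_real (d j) * (x j * cnj (x j)))"
      using vH by (subst ip_sum_left) (auto simp: ip_scale_left ipv mult.assoc)
    also have "\<dots> = of_real (\<Sum>j\<le>k. d j * (cmod (x j))\<^sup>2)"
      by (simp only: complex_norm_square[symmetric] of_real_sum of_real_mult of_real_power)
    finally show ?thesis by (simp only: Re_complex_of_real)
  qed
  have nmv: "(nm v)\<^sup>2 = (\<Sum>j\<le>k. (cmod (x j))\<^sup>2)"
    using comb[of "\<lambda>_. 1"] nm_sq[OF vH] by (simp add: v_def)
  have Tv: "T v = (\<Sum>j\<le>k. (of_real (eigval j) * x j) *s eig j)"
    unfolding v_def by (subst T_sum) (auto simp: T_scale T_eig mult.commute)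
  have "eigval k * (nm v)\<^sup>2 \<le> (\<Sum>j\<le>k. eigval j * (cmod (x j))\<^sup>2)"
    unfolding nmv sum_distrib_left
    by (intro sum_mono mult_right_mono) (auto intro: decseqD[OF eigval_antimono])
  also have "\<dots> = quad v" unfolding quad_def Tv comb ..
  also have "\<dots> \<le> \<tau> * (nm v)\<^sup>2" using lv by (intro \<tau> vH) auto
  finally have "eigval k * (nm v)\<^sup>2 \<le> \<tau> * (nm v)\<^sup>2" .
  moreover have "0 < (nm v)\<^sup>2"
  proof -
    obtain j where "j \<in> {..k}" "x j \<noteq> 0" using x(1) by blast
    then show ?thesis unfolding nmv by (intro sum_pos2[of "{..k}" j]) auto
  qed
  ultimately show ?thesis by simp
qed

end

section \<open>Rotation invariance and the mean value property\<close>

text \<open>The preimage of a box need not be a box, but it is the image of the box under the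
  inverse orthogonal map, and such images keep their Lebesgue measure.\<close>

lemma lborel_distr_orthogonal:
  fixes f :: "real^'n::{finite,wellorder} \<Rightarrow> real^'n::_"
  assumes f: "orthogonal_transformation f"
  shows "distr lborel borel f = lborel"
proof (rule lborel_eqI[symmetric])
  have lin: "linear f" using f by (rule orthogonal_transformation_linear)
  then have [measurable]: "f \<in> borel_measurable borel"
    by (intro borel_measurable_continuous_onI linear_continuous_on) (simp add: linear_conv_bounded_linear)
  have inv: "orthogonal_transformation (inv f)" using f by (rule orthogonal_transformation_inv)
  fix l u :: "real^'n::{finite,wellorder}" assume lu: "\<And>b. b \<in> Basis \<Longrightarrow> l \<bullet> b \<le> u \<bullet> b"
  have eq: "f -` box l u = inv f ` box l u"
    using bij_vimage_eq_inv_image[OF orthogonal_transformation_bij[OF f]] by simp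
  have "emeasure (distr lborel borel f) (box l u) = emeasure lborel (f -` box l u)"
    by (simp add: emeasure_distr)
  also have "\<dots> = emeasure lebesgue (f -` box l u)"
    using measurable_sets_borel[OF \<open>f \<in> borel_measurable borel\<close>, of "box l u"] by simp
  also have "\<dots> = emeasure lebesgue (box l u)"
    unfolding eq using measurable_orthogonal_image[OF inv lmeasurable_box, of l u]
      measure_orthogonal_image[OF inv lmeasurable_box, of l u]
    by (simp add: emeasure_eq_measure2 fmeasurableD2 lmeasurable_box)
  also have "\<dots> = ennreal (\<Prod>b\<in>Basis. (u - l) \<bullet> b)"
    using lu by simp
  finally show "emeasure (distr lborel borel f) (box l u) = ennreal (\<Prod>b\<in>Basis. (u - l) \<bullet> b)" .
qed simp

text \<open>Rotation invariance of the measure on the complex plane is transported from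
  \<open>real^2\<close>, where orthogonal transformations are treated.\<close>

definition plane_of :: "complex \<Rightarrow> real^2" where
  "plane_of z = vector [Re z, Im z]"

definition complex_of :: "real^2 \<Rightarrow> complex" where
  "complex_of v = Complex (v $ 1) (v $ 2)"

lemma complex_of_plane_of [simp]: "complex_of (plane_of z) = z"
  and plane_of_complex_of [simp]: "plane_of (complex_of v) = v"
  by (simp_all add: complex_of_def plane_of_def vec_eq_iff forall_2)

lemma linear_plane_of: "linear plane_of"
  by (rule linearI) (simp_all add: plane_of_def vec_eq_iff forall_2)

lemma linear_complex_of: "linear complex_of"
  by (rule linearI) (simp_all add: complex_of_def complex_eq_iff)

lemma norm_plane_of [simp]: "norm (plane_of z) = cmod z"
  by (simp add: plane_of_def norm_vec_def L2_set_def sum_2 cmod_def)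

lemma norm_complex_of [simp]: "cmod (complex_of v) = norm v"
  by (metis norm_plane_of plane_of_complex_of)

lemma measurable_plane_of [measurable]: "plane_of \<in> borel_measurable borel"
  and measurable_complex_of [measurable]: "complex_of \<in> borel_measurable borel"
  using linear_plane_of linear_complex_of
  by (auto intro!: borel_measurable_continuous_onI linear_continuous_on simp: linear_conv_bounded_linear)

lemma distr_lborel_complex_of: "distr lborel borel complex_of = lborel"
proof (rule lborel_eqI[symmetric])
  fix l u :: complex assume lu: "\<And>b. b \<in> Basis \<Longrightarrow> l \<bullet> b \<le> u \<bullet> b"
  from lu[of 1] lu[of \<i>] have le: "Re l \<le> Re u" "Im l \<le> Im u" by (auto simp: Basis_complex_def)
  have eq: "complex_of -` box l u = box (plane_of l) (plane_of u)"
    by (auto simp: box_def Basis_complex_def Basis_vec_def inner_axis complex_of_def plane_of_def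
        forall_2 vector_2 UNIV_2)
  have "emeasure (distr lborel borel complex_of) (box l u) = emeasure lborel (box (plane_of l) (plane_of u))"
    by (simp add: emeasure_distr eq)
  also have "\<dots> = ennreal (\<Prod>b\<in>Basis. (plane_of u - plane_of l) \<bullet> b)"
    using le by (intro emeasure_lborel_box) (auto simp: Basis_vec_def UNIV_2 inner_axis plane_of_def)
  also have "(\<Prod>b\<in>Basis. (plane_of u - plane_of l) \<bullet> b) = (Re u - Re l) * (Im u - Im l)"
    by (simp add: Basis_vec_def UNIV_2 inner_axis plane_of_def axis_eq_axis)
  also have "\<dots> = (\<Prod>b\<in>Basis. (u - l) \<bullet> b)"
    by (simp add: Basis_complex_def)
  finally show "emeasure (distr lborel borel complex_of) (box l u) = ennreal (\<Prod>b\<in>Basis. (u - l) \<bullet> b)" .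
qed simp

lemma lborel_distr_rotation:
  assumes u: "cmod u = 1"
  shows "distr lborel borel (\<lambda>z. u * z) = (lborel :: complex measure)"
proof -
  define f where "f = (\<lambda>v. plane_of (u * complex_of v))"
  have "linear f"
    using linear_compose[OF linear_complex_of linear_compose[OF _ linear_plane_of, of "\<lambda>z. u * z"]]
      bounded_linear.linear[OF bounded_linear_mult_right[of u]]
    by (simp add: f_def o_def)
  then have "orthogonal_transformation f"
    unfolding orthogonal_transformation by (simp add: f_def norm_mult u)
  then have f: "distr lborel borel f = lborel" by (rule lborel_distr_orthogonal)
  have [measurable]: "f \<in> borel_measurable borel" unfolding f_def by measurable
  have "distr lborel borel (\<lambda>z. u * z) = distr (distr lborel borel complex_of) borel (\<lambda>z. u * z)"
    by (simp add: distr_lborel_complex_of)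
  also have "\<dots> = distr lborel borel (complex_of \<circ> f)"
    by (subst distr_distr) (auto simp: o_def f_def)
  also have "\<dots> = distr (distr lborel borel f) borel complex_of"
    by (subst distr_distr) auto
  finally show ?thesis by (simp add: f distr_lborel_complex_of)
qed

lemma
  fixes f :: "complex \<Rightarrow> 'a::{banach, second_countable_topology}"
  assumes u: "cmod u = 1" and [measurable]: "f \<in> borel_measurable borel"
  shows integral_rotation: "(LINT z|lborel. f (u * z)) = (LINT z|lborel. f z)"
    and integrable_rotation: "integrable lborel f \<Longrightarrow> integrable lborel (\<lambda>z. f (u * z))"
proof -
  show "(LINT z|lborel. f (u * z)) = (LINT z|lborel. f z)"
    by (subst (2) lborel_distr_rotation[OF u, symmetric]) (simp add: integral_distr)
  assume "integrable lborel f"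
  then have "integrable (distr lborel borel (\<lambda>z. u * z)) f" by (simp add: lborel_distr_rotation[OF u])
  then show "integrable lborel (\<lambda>z. f (u * z))" by (simp add: integrable_distr_eq)
qed

section \<open>Mean values of entire functions against radial weights\<close>

lemma mean_value_circle:
  assumes "F holomorphic_on UNIV"
  shows "((\<lambda>t. F (exp (2 * of_real pi * \<i> * of_real t))) has_integral F 0) {0..1}"
proof -
  have "((\<lambda>u. F u / (u - 0)) has_contour_integral (2 * of_real pi * \<i> * F 0)) (circlepath 0 1)"
    using assms by (intro Cauchy_integral_circlepath_simple) (auto intro: holomorphic_on_subset)
  then have int: "((\<lambda>t. F (circlepath 0 1 t) / (circlepath 0 1 t - 0) *
      vector_derivative (circlepath 0 1) (at t within {0..1})) has_integral
      2 * of_real pi * \<i> * F 0) {0..1}"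
    by (simp only: has_contour_integral_def)
  have circ: "circlepath 0 1 t = exp (2 * of_real pi * \<i> * of_real t)" for t
    by (simp add: circlepath mult_ac)
  have "((\<lambda>t. F (exp (2 * of_real pi * \<i> * of_real t)) * (2 * of_real pi * \<i>))
      has_integral (2 * of_real pi * \<i> * F 0)) {0..1}"
    by (rule has_integral_eq[OF _ int]) (simp add: vector_derivative_circlepath01 circ mult_ac)
  from has_integral_mult_left[OF this, of "inverse (2 * of_real pi * \<i>)"]
  show ?thesis by (simp add: field_simps)
qed

text \<open>The integral is averaged over all rotations, which leaves it unchanged. After Fubini the
  inner integral is the mean of \<open>G\<close> over the circle through \<open>z\<close>, that is,
  \<open>G 0\<close>.\<close>

lemma integral_radial_mean_value:
  assumes G: "G holomorphic_on UNIV" and w: "integrable lborel w"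
    and Gw: "integrable lborel (\<lambda>z. G z * of_real (w z))"
    and radial: "\<And>u z. cmod u = 1 \<Longrightarrow> w (u * z) = w z"
  shows "(LINT z|lborel. G z * of_real (w z)) = G 0 * of_real (LINT z|lborel. w z)"
proof -
  let ?e = "\<lambda>t. exp (2 * of_real pi * \<i> * of_real t) :: complex"
  define k where "k = (\<lambda>t z. indicator {0..1::real} t *\<^sub>R (G (?e t * z) * of_real (w z)))"
  have e1: "cmod (?e t) = 1" for t by simp
  have [measurable]: "G \<in> borel_measurable borel"
    using G by (intro borel_measurable_continuous_onI holomorphic_on_imp_continuous_on)
  have [measurable]: "w \<in> borel_measurable borel" using w by auto
  \<comment> \<open>\<open>k\<close> rotates only \<open>G\<close>. Since \<open>w\<close> is radial
    it may be rotated as well, which makes the integral over \<open>z\<close> independent of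
    \<open>t\<close>; the integral over \<open>t\<close> uses the original form.\<close>
  have kt: "k t = (\<lambda>z. indicator {0..1} t *\<^sub>R (G (?e t * z) * of_real (w (?e t * z))))" for t
    by (auto simp: k_def radial[OF e1])
  have int_kt: "integrable lborel (k t)" for t
    unfolding kt using integrable_rotation[OF e1 _ Gw] by auto
  have k_int: "(LINT z|lborel. k t z) = indicator {0..1} t *\<^sub>R (LINT z|lborel. G z * of_real (w z))" for t
    unfolding kt using integral_rotation[OF e1, of "\<lambda>z. G z * of_real (w z)"] by simp
  have k_norm: "(LINT z|lborel. norm (k t z)) = indicator {0..1} t *\<^sub>R (LINT z|lborel. norm (G z * of_real (w z)))" for t
  proof -
    have "(LINT z|lborel. norm (k t z)) = (LINT z|lborel. indicator {0..1} t *\<^sub>R norm (G (?e t * z) * of_real (w (?e t * z))))"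
      by (simp add: kt)
    then show ?thesis
      using integral_rotation[OF e1, of "\<lambda>z. norm (G z * of_real (w z))"] by simp
  qed
  have meas: "(\<lambda>(t, z). k t z) \<in> borel_measurable (lborel \<Otimes>\<^sub>M lborel)"
    unfolding k_def by measurable
  have prod: "integrable (lborel \<Otimes>\<^sub>M lborel) (\<lambda>(t, z). k t z)"
  proof (rule lborel_pair.Fubini_integrable[OF meas])
    show "integrable lborel (\<lambda>t. LINT z|lborel. norm (case (t, z) of (t, z) \<Rightarrow> k t z))"
      by (simp add: k_norm)
    show "AE t in lborel. integrable lborel (\<lambda>z. case (t, z) of (t, z) \<Rightarrow> k t z)"
      by (simp add: int_kt)
  qed
  have kz: "(LINT t|lborel. k t z) = G 0 * of_real (w z)" for z
  proof -
    have hol: "(\<lambda>u. G (u * z)) holomorphic_on UNIV"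
      using G by (intro holomorphic_on_compose_gen[of "\<lambda>u. u * z" UNIV G UNIV, unfolded o_def] holomorphic_intros) auto
    have cont: "continuous_on {0..1} (\<lambda>t. G (?e t * z) * of_real (w z))"
      using G by (intro continuous_intros continuous_on_compose2[OF holomorphic_on_imp_continuous_on[OF G]]) auto
    have "((\<lambda>t. G (?e t * z) * of_real (w z)) has_integral G (0 * z) * of_real (w z)) {0..1}"
      by (rule has_integral_mult_left[OF mean_value_circle[OF hol]])
    note eq = integral_unique[OF this]
    have "(LINT t|lborel. k t z) = (LINT t:{0..1}|lborel. G (?e t * z) * of_real (w z))"
      by (simp only: k_def set_lebesgue_integral_def)
    also have "\<dots> = integral {0..1} (\<lambda>t. G (?e t * z) * of_real (w z))"
      by (rule set_borel_integral_eq_integral(2)[OF borel_integrable_atLeastAtMost'[OF cont]])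
    finally show ?thesis using eq by (simp only: mult_zero_left)
  qed
  have "(LINT z|lborel. G z * of_real (w z)) = (LINT t|lborel. LINT z|lborel. k t z)"
    by (simp add: k_int)
  also have "\<dots> = (LINT z|lborel. LINT t|lborel. k t z)"
    using lborel_pair.Fubini_integral[OF prod] by simp
  also have "\<dots> = G 0 * of_real (LINT z|lborel. w z)"
    by (simp add: kz)
  finally show ?thesis .
qed

section \<open>The weighted Fock space\<close>

lemma mult_cnj_self: "z * cnj z = (complex_of_real (cmod z))\<^sup>2"
  using complex_norm_square[of z] by simp

lemma integrable_Re_Im:
  fixes f g :: "real \<Rightarrow> real"
  assumes f: "integrable lborel f" "\<And>x. 0 \<le> f x" and g: "integrable lborel g" "\<And>x. 0 \<le> g x"
  shows "integrable lborel (\<lambda>z. f (Re z) * g (Im z))"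
proof -
  have [measurable]: "f \<in> borel_measurable borel" "g \<in> borel_measurable borel" using f g by auto
  have "(\<integral>\<^sup>+z. ennreal (f (Re z) * g (Im z)) \<partial>lborel)
      = (\<integral>\<^sup>+(z::complex). (\<Prod>b\<in>Basis. (if b = 1 then (\<lambda>x. ennreal (f x)) else (\<lambda>x. ennreal (g x))) (z \<bullet> b)) \<partial>lborel)"
    by (rule nn_integral_cong) (use assms(2,4) in \<open>simp add: Basis_complex_def ennreal_mult'\<close>)
  also have "\<dots> = (\<integral>\<^sup>+x. ennreal (f x) \<partial>lborel) * (\<integral>\<^sup>+x. ennreal (g x) \<partial>lborel)"
    by (subst nn_integral_lborel_prod) (auto simp: Basis_complex_def)
  also have "\<dots> < \<infinity>"
    using f g by (simp add: nn_integral_eq_integral ennreal_mult_less_top)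
  finally show ?thesis
    using f g by (intro integrableI_nonneg) auto
qed

lemma integrable_gaussian: "0 < a \<Longrightarrow> integrable lborel (\<lambda>x::real. exp (- a * x\<^sup>2))"
proof -
  assume a: "0 < a"
  have "integrable lborel (\<lambda>x. sqrt (2 * pi * (sqrt (1 / (2 * a)))\<^sup>2) * normal_density 0 (sqrt (1 / (2 * a))) x)"
    using a by (intro integrable_mult_right integrable_normal_density) auto
  then show ?thesis using a by (simp add: normal_density_def mult.commute)
qed

lemma integrable_gaussian_complex:
  assumes "0 < a" shows "integrable lborel (\<lambda>z. exp (- a * (cmod z)\<^sup>2))"
proof -
  have "exp (- a * (cmod z)\<^sup>2) = exp (- a * (Re z)\<^sup>2) * exp (- a * (Im z)\<^sup>2)" for z
    by (simp add: cmod_power2 algebra_simps flip: exp_add)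
  then show ?thesis
    using integrable_Re_Im[OF integrable_gaussian[OF assms] _ integrable_gaussian[OF assms]] by simp
qed

lemma
  fixes f :: "complex \<Rightarrow> 'a::{banach, second_countable_topology}"
  shows integral_translation: "f \<in> borel_measurable borel \<Longrightarrow> (LINT z|lborel. f (a + z)) = (LINT z|lborel. f z)"
    and integrable_translation: "integrable lborel f \<Longrightarrow> integrable lborel (\<lambda>z. f (a + z))"
proof -
  show "(LINT z|lborel. f (a + z)) = (LINT z|lborel. f z)" if "f \<in> borel_measurable borel"
    by (subst (2) lborel_distr_plus[of a, symmetric]) (use that in \<open>simp add: integral_distr\<close>)
  assume f: "integrable lborel f"
  then have "integrable (distr lborel borel ((+) a)) f" by (simp add: lborel_distr_plus)
  then show "integrable lborel (\<lambda>z. f (a + z))"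
    using f by (simp add: integrable_distr_eq)
qed

text \<open>The number pi, kept as an integral: the normalising constant of the reproducing
  kernel.\<close>

definition gmass :: "real" where
  "gmass = (LINT z|lborel. exp (- (cmod z)\<^sup>2))"

lemma lborel_pos_integral:
  fixes f :: "complex \<Rightarrow> real"
  assumes "integrable lborel f" "\<And>z. 0 < f z"
  shows "0 < (LINT z|lborel. f z)"
proof (rule ccontr)
  assume "\<not> ?thesis"
  then have "(LINT z|lborel. f z) = 0" using Bochner_Integration.integral_nonneg[of lborel f] assms(2)
    by (meson less_eq_real_def not_less order_antisym)
  then have "AE z in lborel. f z = 0"
    using integral_nonneg_eq_0_iff_AE[OF assms(1)] assms(2) by (simp add: less_imp_le)
  then have "AE z in (lborel :: complex measure). False"
    by (rule AE_mp) (use assms(2) in \<open>auto simp: less_le intro!: AE_I2\<close>)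
  then have "emeasure lborel (UNIV :: complex set) = 0"
    using AE_iff_measurable[of UNIV "lborel :: complex measure" "\<lambda>_. False"] by simp
  then show False by simp
qed

lemma gmass_pos: "0 < gmass"
  unfolding gmass_def using integrable_gaussian_complex[of 1] by (intro lborel_pos_integral) auto

lemma mult_le_sum_squares: "cmod a * cmod b \<le> (cmod a)\<^sup>2 + (cmod b)\<^sup>2"
proof -
  have "2 * (cmod a * cmod b) \<le> (cmod a)\<^sup>2 + (cmod b)\<^sup>2"
    using zero_le_power2[of "cmod a - cmod b"] by (simp add: power2_diff)
  moreover have "0 \<le> cmod a * cmod b" by simp
  ultimately show ?thesis by linarith
qed

lemma integrable_L2_inner:
  assumes [measurable]: "\<phi> \<in> borel_measurable borel" and f: "f \<in> weighted_L2 \<phi>" and g: "g \<in> weighted_L2 \<phi>"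
  shows "integrable lborel (\<lambda>z. f z * cnj (g z) * of_real (exp (- 2 * \<phi> z)))"
proof (rule Bochner_Integration.integrable_bound)
  have [measurable]: "f \<in> borel_measurable borel" "g \<in> borel_measurable borel"
    using f g by (auto simp: weighted_L2_def)
  have [measurable]: "cnj \<in> borel_measurable borel"
    by (intro borel_measurable_continuous_onI continuous_intros)
  show "(\<lambda>z. f z * cnj (g z) * of_real (exp (- 2 * \<phi> z))) \<in> borel_measurable lborel"
    by measurable
  show "integrable lborel (\<lambda>z. (cmod (f z))\<^sup>2 * exp (- 2 * \<phi> z) + (cmod (g z))\<^sup>2 * exp (- 2 * \<phi> z))"
    using f g by (auto simp: weighted_L2_def)
  show "AE z in lborel. norm (f z * cnj (g z) * of_real (exp (- 2 * \<phi> z)))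
      \<le> norm ((cmod (f z))\<^sup>2 * exp (- 2 * \<phi> z) + (cmod (g z))\<^sup>2 * exp (- 2 * \<phi> z))"
  proof (rule AE_I2)
    fix z
    have "cmod (f z) * cmod (g z) * exp (- 2 * \<phi> z) \<le> ((cmod (f z))\<^sup>2 + (cmod (g z))\<^sup>2) * exp (- 2 * \<phi> z)"
      by (intro mult_right_mono mult_le_sum_squares) auto
    then show "norm (f z * cnj (g z) * of_real (exp (- 2 * \<phi> z)))
      \<le> norm ((cmod (f z))\<^sup>2 * exp (- 2 * \<phi> z) + (cmod (g z))\<^sup>2 * exp (- 2 * \<phi> z))"
      by (simp add: norm_mult distrib_right)
  qed
qed

lemma L2_inner_self:
  "L2_inner \<phi> f f = of_real (LINT z|lborel. (cmod (f z))\<^sup>2 * exp (- 2 * \<phi> z))"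
proof -
  have "f z * cnj (f z) * of_real (exp (- 2 * \<phi> z)) = of_real ((cmod (f z))\<^sup>2 * exp (- 2 * \<phi> z))" for z
    by (simp add: mult_cnj_self)
  then show ?thesis unfolding L2_inner_def by (simp only: integral_complex_of_real)
qed

section \<open>The Fock space and its reproducing kernel\<close>

locale fock =
  fixes q :: "complex \<Rightarrow> complex" and \<phi> :: "complex \<Rightarrow> real"
  assumes q_holomorphic: "q holomorphic_on UNIV"
    and \<phi>_eq: "\<phi> = (\<lambda>z. (cmod z)\<^sup>2 / 2 + Re (q z))"
begin

abbreviation F2 :: "(complex \<Rightarrow> complex) set" where "F2 \<equiv> fock_space \<phi>"

abbreviation wt :: "complex \<Rightarrow> real" where "wt z \<equiv> exp (- 2 * \<phi> z)"

lemma q_continuous: "continuous_on S q"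
  using holomorphic_on_imp_continuous_on[OF q_holomorphic] continuous_on_subset by blast

lemma \<phi>_continuous: "continuous_on S \<phi>"
  unfolding \<phi>_eq by (intro continuous_intros q_continuous) auto

lemma \<phi>_measurable [measurable]: "\<phi> \<in> borel_measurable borel"
  by (rule borel_measurable_continuous_onI[OF \<phi>_continuous])

lemma fock_spaceD:
  assumes "f \<in> F2"
  shows "f \<in> weighted_L2 \<phi>" "f holomorphic_on UNIV" "continuous_on UNIV f" "f \<in> borel_measurable borel"
    "integrable lborel (\<lambda>z. (cmod (f z))\<^sup>2 * wt z)"
  using assms holomorphic_on_imp_continuous_on by (auto simp: fock_space_def weighted_L2_def)

lemma fock_spaceI:
  assumes "f holomorphic_on UNIV" "integrable lborel (\<lambda>z. (cmod (f z))\<^sup>2 * wt z)"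
  shows "f \<in> F2"
  using assms by (auto simp: fock_space_def weighted_L2_def
      intro!: borel_measurable_continuous_onI holomorphic_on_imp_continuous_on)

lemma integrable_fock_inner:
  "f \<in> F2 \<Longrightarrow> g \<in> F2 \<Longrightarrow>
    integrable lborel (\<lambda>z. f z * cnj (g z) * of_real (wt z))"
  by (intro integrable_L2_inner fock_spaceD) auto

lemma fock_space_add:
  assumes f: "f \<in> F2" and g: "g \<in> F2"
  shows "f + g \<in> F2"
proof (rule fock_spaceI)
  show "f + g holomorphic_on UNIV"
    using fock_spaceD[OF f] fock_spaceD[OF g] unfolding plus_fun_def by (intro holomorphic_intros)
  have eq: "(cmod ((f + g) z))\<^sup>2 * wt z = (cmod (f z))\<^sup>2 * wt z
      + (cmod (g z))\<^sup>2 * wt z + 2 * Re (f z * cnj (g z) * of_real (wt z))" for z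
  proof -
    have "(cmod (f z + g z))\<^sup>2 = (cmod (f z))\<^sup>2 + (cmod (g z))\<^sup>2 + 2 * Re (f z * cnj (g z))"
      unfolding cmod_power2 by (simp add: power2_eq_square algebra_simps)
    then show ?thesis by (simp add: algebra_simps del: of_real_exp)
  qed
  show "integrable lborel (\<lambda>z. (cmod ((f + g) z))\<^sup>2 * wt z)"
    unfolding eq using fock_spaceD(5)[OF f] fock_spaceD(5)[OF g] integrable_fock_inner[OF f g]
    by (intro Bochner_Integration.integrable_add integrable_mult_right integrable_Re)
qed

lemma fock_space_scale:
  assumes f: "f \<in> F2"
  shows "cfun_scale c f \<in> F2"
proof (rule fock_spaceI)
  show "cfun_scale c f holomorphic_on UNIV"
    using fock_spaceD[OF f] unfolding cfun_scale_def by (intro holomorphic_intros)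
  have "integrable lborel (\<lambda>z. (cmod c)\<^sup>2 * ((cmod (f z))\<^sup>2 * wt z))"
    using fock_spaceD(5)[OF f] by (intro integrable_mult_right)
  then show "integrable lborel (\<lambda>z. (cmod (cfun_scale c f z))\<^sup>2 * wt z)"
    by (simp add: cfun_scale_def norm_mult power_mult_distrib mult.assoc)
qed

lemma fock_definite:
  assumes f: "f \<in> F2" and 0: "L2_inner \<phi> f f = 0"
  shows "f = 0"
proof -
  have "(LINT z|lborel. (cmod (f z))\<^sup>2 * wt z) = 0"
    using 0 by (simp only: L2_inner_self of_real_eq_0_iff)
  then have "AE z in lborel. (cmod (f z))\<^sup>2 * wt z = 0"
    using integral_nonneg_eq_0_iff_AE[OF fock_spaceD(5)[OF f]] by simp
  then have "AE z in lborel. f z = 0" by simp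
  moreover have "closed {z. f z = 0}"
    using fock_spaceD(3)[OF f] by (intro closed_Collect_eq continuous_intros) auto
  ultimately show ?thesis
    using mem_closed_if_AE_lebesgue[of "{z. f z = 0}"] by (auto simp: fun_eq_iff AE_completion)
qed

sublocale F: inner_product cfun_scale "F2" "L2_inner \<phi>"
proof
  have 0: "0 \<in> F2"
    by (rule fock_spaceI) (auto simp: zero_fun_def)
  show "cfun.subspace (F2)"
    by (intro cfun.subspaceI fock_space_add fock_space_scale 0)
next
  fix f g h assume *: "f \<in> F2" "g \<in> F2" "h \<in> F2"
  show "L2_inner \<phi> (f + g) h = L2_inner \<phi> f h + L2_inner \<phi> g h"
    using integrable_fock_inner[OF *(1,3)] integrable_fock_inner[OF *(2,3)]
    unfolding L2_inner_def by (subst Bochner_Integration.integral_add[symmetric]) (simp_all add: algebra_simps)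
next
  fix f h :: "complex \<Rightarrow> complex" and a
  have "cfun_scale a f z * cnj (h z) * of_real (wt z)
      = a * (f z * cnj (h z) * of_real (wt z))" for z
    by (simp add: cfun_scale_def mult.assoc)
  then show "L2_inner \<phi> (cfun_scale a f) h = a * L2_inner \<phi> f h"
    unfolding L2_inner_def by (simp only: integral_mult_right_zero)
next
  fix f g :: "complex \<Rightarrow> complex"
  have "g z * cnj (f z) * of_real (wt z) = cnj (f z * cnj (g z) * of_real (wt z))" for z
    by simp
  then show "L2_inner \<phi> g f = cnj (L2_inner \<phi> f g)"
    unfolding L2_inner_def by (simp only: Bochner_Integration.integral_cnj)
next
  fix f :: "complex \<Rightarrow> complex"
  show "0 \<le> Re (L2_inner \<phi> f f)" unfolding L2_inner_self by simp
qed (rule fock_definite)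

lemma nm_eq_L2_norm: "F.nm f = L2_norm \<phi> f"
  by (simp only: F.nm_def L2_norm_def L2_inner_self Re_complex_of_real)

text \<open>Multiplication by \<open>exp (- q)\<close> maps the space isometrically onto the
  classical Fock space with weight \<open>(cmod z)\<^sup>2 / 2\<close>, whose kernel is
  \<open>exp (z * cnj a) / pi\<close>; this is that kernel carried back.\<close>

definition kernel :: "complex \<Rightarrow> complex \<Rightarrow> complex" where
  "kernel a z = exp (q z + cnj (q a) + z * cnj a) / of_real gmass"

text \<open>Completing the square in the real part of the exponent: relative to the weight,
  normalised kernels are Gaussians around their points, whatever \<open>q\<close> is.\<close>

lemma weighted_kernel:
  "cmod (kernel a z) * exp (- \<phi> a) = exp (\<phi> z) * exp (- (cmod (z - a))\<^sup>2 / 2) / gmass"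
proof -
  have "(cmod (z - a))\<^sup>2 = (cmod z)\<^sup>2 + (cmod a)\<^sup>2 - 2 * Re (z * cnj a)"
    unfolding cmod_power2 by (simp add: power2_eq_square algebra_simps)
  then have "Re (q z + cnj (q a) + z * cnj a) - \<phi> a = \<phi> z - (cmod (z - a))\<^sup>2 / 2"
    by (simp add: \<phi>_eq field_simps)
  then have "exp (Re (q z + cnj (q a) + z * cnj a)) * exp (- \<phi> a) = exp (\<phi> z) * exp (- (cmod (z - a))\<^sup>2 / 2)"
    by (simp flip: exp_add)
  then show ?thesis
    using gmass_pos by (simp add: kernel_def norm_divide divide_simps)
qed

lemma kernel_holomorphic: "kernel a holomorphic_on UNIV"
  unfolding kernel_def[abs_def] by (intro holomorphic_intros q_holomorphic) (use gmass_pos in auto)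

lemma kernel_in: "kernel a \<in> F2"
proof (rule fock_spaceI[OF kernel_holomorphic])
  have eq: "(cmod (kernel a z))\<^sup>2 * wt z
      = exp (2 * \<phi> a) / gmass\<^sup>2 * exp (- 1 * (cmod (- a + z))\<^sup>2)" for z
  proof -
    have "cmod (kernel a z) = exp (\<phi> z) * exp (- (cmod (z - a))\<^sup>2 / 2) / gmass * exp (\<phi> a)"
      unfolding weighted_kernel[symmetric] by (simp add: exp_minus)
    also have "\<dots> = exp (\<phi> z - (cmod (z - a))\<^sup>2 / 2 + \<phi> a) / gmass"
      by (simp add: mult_ac flip: exp_add)
    finally have "(cmod (kernel a z))\<^sup>2 = exp (2 * (\<phi> z - (cmod (z - a))\<^sup>2 / 2 + \<phi> a)) / gmass\<^sup>2"
      by (simp only: power_divide exp_double)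
    then show ?thesis
      by (simp add: field_simps flip: exp_add)
  qed
  show "integrable lborel (\<lambda>z. (cmod (kernel a z))\<^sup>2 * wt z)"
    unfolding eq using integrable_translation[OF integrable_gaussian_complex[of 1], of "- a"]
    by (intro integrable_mult_right) auto
qed

lemma kernel_reproducing:
  assumes f: "f \<in> F2"
  shows "L2_inner \<phi> f (kernel a) = f a"
proof -
  let ?G = "\<lambda>\<zeta>. f (a + \<zeta>) * exp (- q (a + \<zeta>) + q a - \<zeta> * cnj a)"
  let ?I = "\<lambda>z. f z * cnj (kernel a z) * of_real (wt z)"
  have f_hol: "f holomorphic_on UNIV" using fock_spaceD[OF f] by simp
  have shift: "(\<lambda>\<zeta>. h (a + \<zeta>)) holomorphic_on UNIV" if "h holomorphic_on UNIV" for h :: "complex \<Rightarrow> complex"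
    using that by (intro holomorphic_on_compose_gen[of "\<lambda>u. a + u" UNIV h UNIV, unfolded o_def] holomorphic_intros) auto
  have G: "?G holomorphic_on UNIV"
    by (intro holomorphic_intros shift f_hol q_holomorphic)
  \<comment> \<open>The factor \<open>exp (cnj (q z))\<close> of the conjugated kernel cancels the
    antiholomorphic part of the weight; around \<open>a\<close> an entire function times a radial
    Gaussian is left.\<close>
  have eq: "?I (a + \<zeta>) = inverse (of_real gmass) * (?G \<zeta> * of_real (exp (- (cmod \<zeta>)\<^sup>2)))" for \<zeta>
  proof -
    have "cnj (q z) + q a + cnj z * a + of_real (- 2 * \<phi> z)
        = - q z + q a - \<zeta> * cnj a + of_real (- (cmod \<zeta>)\<^sup>2)" if "z = a + \<zeta>" for z
    proof -
      have "of_real (- 2 * \<phi> z) = - (z * cnj z) - (q z + cnj (q z))"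
        by (simp add: \<phi>_eq complex_add_cnj mult_cnj_self algebra_simps)
      moreover have "of_real (- (cmod \<zeta>)\<^sup>2) = - (\<zeta> * cnj \<zeta>)"
        by (simp add: mult_cnj_self)
      ultimately show ?thesis using that by (simp add: algebra_simps)
    qed
    from this[OF refl] have "exp (cnj (q (a + \<zeta>)) + q a + cnj (a + \<zeta>) * a) * of_real (wt (a + \<zeta>))
        = exp (- q (a + \<zeta>) + q a - \<zeta> * cnj a) * of_real (exp (- (cmod \<zeta>)\<^sup>2))"
      by (simp only: exp_of_real[symmetric] exp_add[symmetric])
    moreover have "cnj (kernel a (a + \<zeta>)) = exp (cnj (q (a + \<zeta>)) + q a + cnj (a + \<zeta>) * a) / of_real gmass"
      by (simp add: kernel_def exp_cnj)
    ultimately show ?thesis by (simp add: field_simps)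
  qed
  have int: "integrable lborel ?I"
    by (rule integrable_fock_inner[OF f kernel_in])
  have int': "integrable lborel (\<lambda>\<zeta>. ?G \<zeta> * of_real (exp (- (cmod \<zeta>)\<^sup>2)))"
  proof -
    have "of_real gmass * ?I (a + \<zeta>) = ?G \<zeta> * of_real (exp (- (cmod \<zeta>)\<^sup>2))" for \<zeta>
      unfolding eq using gmass_pos by (simp del: of_real_exp)
    then show ?thesis
      using integrable_mult_right[OF integrable_translation[OF int, of a], of "of_real gmass"] by (simp only:)
  qed
  have "L2_inner \<phi> f (kernel a) = (LINT \<zeta>|lborel. ?I (a + \<zeta>))"
    unfolding L2_inner_def using int by (intro integral_translation[symmetric]) auto
  also have "\<dots> = inverse (of_real gmass) * (LINT \<zeta>|lborel. ?G \<zeta> * of_real (exp (- (cmod \<zeta>)\<^sup>2)))"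
    unfolding eq by (rule integral_mult_right_zero)
  also have "(LINT \<zeta>|lborel. ?G \<zeta> * of_real (exp (- (cmod \<zeta>)\<^sup>2))) = ?G 0 * of_real gmass"
    unfolding gmass_def using integrable_gaussian_complex[of 1]
    by (intro integral_radial_mean_value[OF G _ int']) (auto simp: norm_mult)
  finally show ?thesis using gmass_pos by simp
qed

lemma kernel_diag: "kernel a a = of_real (exp (2 * \<phi> a) / gmass)"
proof -
  have "q a + cnj (q a) + a * cnj a = of_real (2 * \<phi> a)"
    by (simp add: \<phi>_eq complex_add_cnj mult_cnj_self)
  then show ?thesis by (simp only: kernel_def exp_of_real of_real_divide)
qed

lemma nm_kernel: "F.nm (kernel a) = exp (\<phi> a) / sqrt gmass"
proof -
  have "(F.nm (kernel a))\<^sup>2 = exp (2 * \<phi> a) / gmass"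
    using F.nm_sq[OF kernel_in] kernel_reproducing[OF kernel_in] by (simp only: kernel_diag Re_complex_of_real)
  also have "\<dots> = (exp (\<phi> a) / sqrt gmass)\<^sup>2"
    using gmass_pos by (simp add: power_divide exp_double)
  finally show ?thesis
    using F.nm_nonneg[OF kernel_in] gmass_pos by (simp add: power2_eq_iff_nonneg)
qed

lemma point_evaluation_bound:
  assumes f: "f \<in> F2"
  shows "cmod (f a) * exp (- \<phi> a) \<le> F.nm f / sqrt gmass"
proof -
  have "cmod (f a) \<le> F.nm f * (exp (\<phi> a) / sqrt gmass)"
    using F.Cauchy_Schwarz[OF f kernel_in, of a] by (simp only: kernel_reproducing[OF f] nm_kernel)
  then have "cmod (f a) * exp (- \<phi> a) \<le> F.nm f * (exp (\<phi> a) / sqrt gmass) * exp (- \<phi> a)"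
    by (intro mult_right_mono) auto
  also have "\<dots> = F.nm f / sqrt gmass" by (simp add: exp_minus field_simps)
  finally show ?thesis .
qed

end

section \<open>Sampling along a sequence of points, and the adjoint synthesis map\<close>

locale fock_atoms = fock +
  fixes a :: "nat \<Rightarrow> complex"
begin

text \<open>The factor \<open>exp (- \<phi> (a n))\<close> gives all these kernels the same norm, so
  the bounds below do not depend on where the points lie.\<close>

definition nker :: "nat \<Rightarrow> complex \<Rightarrow> complex" where
  "nker n = cfun_scale (of_real (exp (- \<phi> (a n)))) (kernel (a n))"

definition sample :: "(complex \<Rightarrow> complex) \<Rightarrow> nat \<Rightarrow> complex" where
  "sample f n = f (a n) * of_real (exp (- \<phi> (a n)))"

text \<open>Formally the adjoint of \<open>sample\<close>. As a pointwise series it is accessible to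
  locally uniform convergence, for holomorphy, and to termwise integration, for the norm.\<close>

definition synth :: "(nat \<Rightarrow> complex) \<Rightarrow> complex \<Rightarrow> complex" where
  "synth d z = (\<Sum>n. d n * nker n z)"

lemma nker_in [simp]: "nker n \<in> F2"
  unfolding nker_def by (intro fock_space_scale kernel_in)

lemma inner_nker: "f \<in> F2 \<Longrightarrow> L2_inner \<phi> f (nker n) = sample f n"
  unfolding nker_def by (simp add: F.ip_scale_right kernel_in kernel_reproducing sample_def mult.commute)

lemma nm_nker: "F.nm (nker n) = 1 / sqrt gmass"
  unfolding nker_def by (simp add: F.nm_scale kernel_in nm_kernel exp_minus norm_divide field_simps del: of_real_exp)

lemma cmod_nker: "cmod (nker n z) = exp (\<phi> z) * exp (- (1 / 2) * (cmod (- a n + z))\<^sup>2) / gmass"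
  using weighted_kernel[of "a n" z] by (simp add: nker_def cfun_scale_def norm_mult mult.commute)

lemma cmod_nker_le: "cmod (nker n z) \<le> exp (\<phi> z) / gmass"
  unfolding cmod_nker using gmass_pos by (intro divide_right_mono) auto

lemma sample_bound: "f \<in> F2 \<Longrightarrow> cmod (sample f n) \<le> F.nm f / sqrt gmass"
  using point_evaluation_bound[of f "a n"] by (simp add: sample_def norm_mult)

context
  fixes d :: "nat \<Rightarrow> complex"
  assumes d: "summable (\<lambda>n. cmod (d n))"
begin

lemma summable_synth: "summable (\<lambda>n. cmod (d n * nker n z))"
proof (rule summable_comparison_test'[of "\<lambda>n. cmod (d n) * (exp (\<phi> z) / gmass)" 0])
  show "summable (\<lambda>n. cmod (d n) * (exp (\<phi> z) / gmass))" using d by (rule summable_mult2)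
  show "norm (cmod (d n * nker n z)) \<le> cmod (d n) * (exp (\<phi> z) / gmass)" for n
    using cmod_nker_le[of n z] by (simp add: norm_mult mult_left_mono del: times_divide_eq_right)
qed

lemma synth_sums: "(\<lambda>n. d n * nker n z) sums synth d z"
  unfolding synth_def using summable_norm_cancel[OF summable_synth] by (rule summable_sums)

lemma synth_holomorphic: "synth d holomorphic_on UNIV"
proof (rule holomorphic_uniform_sequence[of UNIV "\<lambda>N z. \<Sum>n<N. d n * nker n z"])
  show "(\<lambda>z. \<Sum>n<N. d n * nker n z) holomorphic_on UNIV" for N
    by (intro holomorphic_intros fock_spaceD(2)) simp
  fix x :: complex
  have "compact (\<phi> ` cball x 1)" by (intro compact_continuous_image \<phi>_continuous compact_cball)
  then obtain B where B: "\<And>z. z \<in> cball x 1 \<Longrightarrow> \<phi> z \<le> B"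
    using bounded_imp_bdd_above[OF compact_imp_bounded] by (fastforce simp: bdd_above_def)
  have "uniform_limit (cball x 1) (\<lambda>N z. \<Sum>n<N. d n * nker n z) (synth d) sequentially"
    unfolding synth_def[abs_def]
  proof (rule Weierstrass_m_test)
    fix n z assume z: "z \<in> cball x 1"
    have "cmod (nker n z) \<le> exp B / gmass"
      using cmod_nker_le[of n z] B[OF z] gmass_pos
      by (meson divide_right_mono exp_le_cancel_iff less_imp_le order_trans)
    then show "norm (d n * nker n z) \<le> cmod (d n) * (exp B / gmass)"
      by (simp add: norm_mult mult_left_mono del: times_divide_eq_right)
  next
    show "summable (\<lambda>n. cmod (d n) * (exp B / gmass))" using d by (rule summable_mult2)
  qed
  then show "\<exists>r>0. cball x r \<subseteq> UNIV \<and> uniform_limit (cball x r) (\<lambda>N z. \<Sum>n<N. d n * nker n z) (synth d) sequentially"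
    by (intro exI[of _ 1]) auto
qed simp

lemma synth_in [simp]: "synth d \<in> F2"
proof (rule fock_spaceI[OF synth_holomorphic])
  define g where "g = (\<lambda>n z. exp (- (1 / 2) * (cmod (- a n + z))\<^sup>2))"
  define D where "D = (\<Sum>n. cmod (d n))"
  have g_int: "integrable lborel (g n)" for n
    unfolding g_def by (rule integrable_translation[OF integrable_gaussian_complex]) simp
  have g_val: "(LINT z|lborel. g n z) = (LINT z|lborel. exp (- (1 / 2) * (cmod z)\<^sup>2))" for n
    unfolding g_def by (rule integral_translation[of "\<lambda>z. exp (- (1 / 2) * (cmod z)\<^sup>2)"]) measurable
  have g01: "0 \<le> g n z" "g n z \<le> 1" for n z by (auto simp: g_def)
  have dg: "summable (\<lambda>n. cmod (d n) * g n z)" for z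
    by (rule summable_comparison_test'[OF d, of 0]) (simp add: abs_mult g01 mult_left_le)
  have "0 \<le> D" unfolding D_def by (rule suminf_nonneg[OF d]) simp
  have G_int: "integrable lborel (\<lambda>z. \<Sum>n. cmod (d n) * g n z)"
  proof (rule integrable_suminf)
    show "integrable lborel (\<lambda>z. cmod (d n) * g n z)" for n using g_int by (intro integrable_mult_right)
    show "AE z in lborel. summable (\<lambda>n. norm (cmod (d n) * g n z))" using dg g01 by (simp add: abs_mult)
    have "(LINT z|lborel. norm (cmod (d n) * g n z)) = cmod (d n) * (LINT z|lborel. exp (- (1 / 2) * (cmod z)\<^sup>2))" for n
      using g01 g_val[of n] by (simp add: abs_mult)
    then show "summable (\<lambda>n. LINT z|lborel. norm (cmod (d n) * g n z))" using d by (simp add: summable_mult2)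
  qed
  have meas [measurable]: "synth d \<in> borel_measurable borel"
    using synth_holomorphic by (intro borel_measurable_continuous_onI holomorphic_on_imp_continuous_on)
  \<comment> \<open>Of the two factors in the square, one is bounded by the total mass
    \<open>D\<close> of the coefficients and the other keeps the Gaussians, so the majorant is
    integrable.\<close>
  have bound: "(cmod (synth d z))\<^sup>2 * wt z \<le> D / gmass\<^sup>2 * (\<Sum>n. cmod (d n) * g n z)" for z
  proof -
    let ?G = "\<Sum>n. cmod (d n) * g n z"
    have eq: "cmod (d n * nker n z) = (cmod (d n) * g n z) * (exp (\<phi> z) / gmass)" for n
      by (simp add: norm_mult cmod_nker g_def)
    have "cmod (synth d z) \<le> (\<Sum>n. cmod (d n * nker n z))"
      unfolding synth_def by (rule summable_norm[OF summable_synth])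
    also have "\<dots> = ?G * (exp (\<phi> z) / gmass)"
      unfolding eq by (rule suminf_mult2[OF dg, symmetric])
    finally have "(cmod (synth d z))\<^sup>2 \<le> (?G * (exp (\<phi> z) / gmass))\<^sup>2"
      by (intro power_mono) auto
    then have "(cmod (synth d z))\<^sup>2 * wt z \<le> (?G * (exp (\<phi> z) / gmass))\<^sup>2 * wt z"
      by (intro mult_right_mono) auto
    also have "\<dots> = ?G\<^sup>2 / gmass\<^sup>2 * ((exp (\<phi> z))\<^sup>2 * wt z)"
      by (simp add: power_mult_distrib power_divide)
    also have "(exp (\<phi> z))\<^sup>2 * wt z = 1"
      by (simp add: exp_double[symmetric] exp_minus)
    also have "?G\<^sup>2 / gmass\<^sup>2 * 1 = ?G * ?G / gmass\<^sup>2"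
      by (simp add: power2_eq_square)
    also have "\<dots> \<le> D * ?G / gmass\<^sup>2"
    proof (intro divide_right_mono mult_right_mono)
      show "?G \<le> D" unfolding D_def by (intro suminf_le dg d) (simp add: g01 mult_left_le)
      show "0 \<le> ?G" using g01 by (intro suminf_nonneg dg) auto
    qed auto
    finally show ?thesis by simp
  qed
  show "integrable lborel (\<lambda>z. (cmod (synth d z))\<^sup>2 * wt z)"
  proof (rule Bochner_Integration.integrable_bound)
    show "integrable lborel (\<lambda>z. D / gmass\<^sup>2 * (\<Sum>n. cmod (d n) * g n z))"
      by (rule integrable_mult_right[OF G_int])
    show "AE z in lborel. norm ((cmod (synth d z))\<^sup>2 * wt z)
        \<le> norm (D / gmass\<^sup>2 * (\<Sum>n. cmod (d n) * g n z))"
    proof (rule AE_I2)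
      fix z show "norm ((cmod (synth d z))\<^sup>2 * wt z)
        \<le> norm (D / gmass\<^sup>2 * (\<Sum>n. cmod (d n) * g n z))"
        using order_trans[OF bound[of z] abs_ge_self] by simp
    qed
  qed measurable
qed

lemma synth_inner:
  assumes u: "u \<in> F2"
  shows "(\<lambda>n. d n * cnj (sample u n)) sums L2_inner \<phi> (synth d) u"
proof -
  define w where "w = (\<lambda>z. wt z)"
  let ?f = "\<lambda>n z. (d n * nker n z) * cnj (u z) * of_real (w z)"
  \<comment> \<open>All \<open>nker n\<close> have the same norm, so index 0 stands for every
    index.\<close>
  define C where "C = (F.nm (nker 0))\<^sup>2 + (F.nm u)\<^sup>2"
  have eq: "?f n z = d n * (nker n z * cnj (u z) * of_real (w z))" for n z by (simp add: mult.assoc)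
  have base: "integrable lborel (\<lambda>z. nker n z * cnj (u z) * of_real (w z))" for n
    unfolding w_def by (intro integrable_fock_inner u nker_in)
  have int: "integrable lborel (?f n)" for n
    unfolding eq by (intro integrable_mult_right base)
  have sq: "(LINT z|lborel. (cmod (f z))\<^sup>2 * w z) = (F.nm f)\<^sup>2" if "f \<in> F2" for f
    using F.nm_sq[OF that] unfolding L2_inner_self w_def by (simp only: Re_complex_of_real)
  have norm_le: "(LINT z|lborel. norm (?f n z)) \<le> cmod (d n) * C" for n
  proof -
    have "(LINT z|lborel. norm (?f n z)) \<le> (LINT z|lborel. cmod (d n) * ((cmod (nker n z))\<^sup>2 * w z + (cmod (u z))\<^sup>2 * w z))"
    proof (rule integral_mono)
      show "integrable lborel (\<lambda>z. norm (?f n z))" using int by (rule integrable_norm)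
      show "integrable lborel (\<lambda>z. cmod (d n) * ((cmod (nker n z))\<^sup>2 * w z + (cmod (u z))\<^sup>2 * w z))"
        unfolding w_def using fock_spaceD(5)[OF nker_in] fock_spaceD(5)[OF u]
        by (intro integrable_mult_right Bochner_Integration.integrable_add)
      fix z
      have "cmod (d n) * (cmod (nker n z) * cmod (u z) * w z) \<le> cmod (d n) * (((cmod (nker n z))\<^sup>2 + (cmod (u z))\<^sup>2) * w z)"
        by (intro mult_left_mono mult_right_mono mult_le_sum_squares) (auto simp: w_def)
      then show "norm (?f n z) \<le> cmod (d n) * ((cmod (nker n z))\<^sup>2 * w z + (cmod (u z))\<^sup>2 * w z)"
        by (simp add: norm_mult w_def algebra_simps)
    qed
    also have "\<dots> = cmod (d n) * ((F.nm (nker n))\<^sup>2 + (F.nm u)\<^sup>2)"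
      using fock_spaceD(5)[OF nker_in] fock_spaceD(5)[OF u] sq[OF u] sq[OF nker_in]
      by (simp add: w_def)
    finally show ?thesis by (simp add: C_def nm_nker)
  qed
  have fsum: "(\<lambda>n. ?f n z) sums (synth d z * cnj (u z) * of_real (w z))" for z
    by (intro sums_mult2 synth_sums)
  have "(\<lambda>n. LINT z|lborel. ?f n z) sums (LINT z|lborel. (\<Sum>n. ?f n z))"
  proof (rule sums_integral[OF int])
    have "summable (\<lambda>n. cmod (d n * nker n z) * (cmod (u z) * w z))" for z
      by (rule summable_mult2[OF summable_synth])
    then show "AE z in lborel. summable (\<lambda>n. norm (?f n z))"
      by (simp add: norm_mult mult.assoc w_def)
    show "summable (\<lambda>n. LINT z|lborel. norm (?f n z))"
      by (rule summable_comparison_test'[OF summable_mult2[OF d, of C], of 0]) (use norm_le in simp)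
  qed
  moreover have "(LINT z|lborel. (\<Sum>n. ?f n z)) = L2_inner \<phi> (synth d) u"
    using sums_unique[OF fsum] unfolding L2_inner_def w_def by simp
  moreover have "(LINT z|lborel. ?f n z) = d n * cnj (sample u n)" for n
  proof -
    have "(LINT z|lborel. ?f n z) = d n * L2_inner \<phi> (nker n) u"
      unfolding eq L2_inner_def w_def[symmetric] by (subst integral_mult_right_zero) (simp add: w_def)
    then show ?thesis using F.ip_cnj[OF u nker_in] inner_nker[OF u] by simp
  qed
  ultimately show ?thesis by simp
qed

text \<open>Pairing \<open>synth d\<close> with itself gives a series in its own samples; these are
  bounded by its norm over \<open>sqrt gmass\<close>, and one factor of the norm cancels.\<close>

lemma synth_nm_le: "F.nm (synth d) \<le> (\<Sum>n. cmod (d n)) / sqrt gmass"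
proof -
  let ?s = "synth d"
  have bound: "cmod (d n * cnj (sample ?s n)) \<le> cmod (d n) * (F.nm ?s / sqrt gmass)" for n
    using sample_bound[OF synth_in] by (simp add: norm_mult mult_left_mono del: times_divide_eq_right)
  have summ: "summable (\<lambda>n. cmod (d n * cnj (sample ?s n)))"
    by (rule summable_comparison_test'[OF summable_mult2[OF d], of 0 _ "F.nm ?s / sqrt gmass"])
      (use bound in simp)
  have "(F.nm ?s)\<^sup>2 \<le> cmod (L2_inner \<phi> ?s ?s)"
    unfolding F.nm_sq[OF synth_in] by (rule complex_Re_le_cmod)
  also have "\<dots> \<le> (\<Sum>n. cmod (d n * cnj (sample ?s n)))"
    using synth_inner[OF synth_in] summable_norm[OF summ] by (simp add: sums_iff)
  also have "\<dots> \<le> (\<Sum>n. cmod (d n) * (F.nm ?s / sqrt gmass))"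
    by (intro suminf_le bound summ summable_mult2[OF d])
  also have "\<dots> = (\<Sum>n. cmod (d n)) / sqrt gmass * F.nm ?s"
    by (subst suminf_mult2[OF d, symmetric]) simp
  finally have "F.nm ?s * F.nm ?s \<le> (\<Sum>n. cmod (d n)) / sqrt gmass * F.nm ?s"
    by (simp add: power2_eq_square)
  moreover have "0 \<le> (\<Sum>n. cmod (d n)) / sqrt gmass"
    using suminf_nonneg[OF d] gmass_pos by simp
  moreover have "F.nm ?s = 0 \<or> 0 < F.nm ?s" using F.nm_nonneg[OF synth_in] by linarith
  ultimately show ?thesis
    using mult_right_le_imp_le[of "F.nm ?s" "F.nm ?s" "(\<Sum>n. cmod (d n)) / sqrt gmass"] by linarith
qed

end

lemma synth_add:
  assumes d: "summable (\<lambda>n. cmod (d n))" and e: "summable (\<lambda>n. cmod (e n))"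
  shows "synth (\<lambda>n. d n + e n) = synth d + synth e"
proof
  fix z
  show "synth (\<lambda>n. d n + e n) z = (synth d + synth e) z"
    using sums_unique[OF sums_add[OF synth_sums[OF d] synth_sums[OF e]]]
    by (simp add: synth_def[of "\<lambda>n. d n + e n"] distrib_right)
qed

lemma synth_scale:
  assumes d: "summable (\<lambda>n. cmod (d n))"
  shows "synth (\<lambda>n. b * d n) = cfun_scale b (synth d)"
proof
  fix z
  show "synth (\<lambda>n. b * d n) z = cfun_scale b (synth d) z"
    using sums_unique[OF sums_mult[OF synth_sums[OF d], of b]]
    by (simp add: synth_def[of "\<lambda>n. b * d n"] cfun_scale_def mult.assoc)
qed

lemma synth_diff:
  assumes d: "summable (\<lambda>n. cmod (d n))" and e: "summable (\<lambda>n. cmod (e n))"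
  shows "synth (\<lambda>n. d n - e n) = synth d - synth e"
proof
  fix z
  show "synth (\<lambda>n. d n - e n) z = (synth d - synth e) z"
    using sums_unique[OF sums_diff[OF synth_sums[OF d] synth_sums[OF e]]]
    by (simp add: synth_def[of "\<lambda>n. d n - e n"] left_diff_distrib)
qed

end

section \<open>Toeplitz operators of geometric atomic measures\<close>

text \<open>Pushed forward from the index set, so that \<open>a\<close> may repeat a point and the
  masses add up there.\<close>

definition atoms :: "(nat \<Rightarrow> complex) \<Rightarrow> complex measure" where
  "atoms a = distr (density (count_space UNIV) (\<lambda>n. ennreal ((1 / 2) ^ n))) borel a"

lemma sets_atoms [simp]: "sets (atoms a) = sets borel"
  by (simp add: atoms_def)

lemma integrable_atoms_iff:
  fixes g :: "complex \<Rightarrow> 'a::{banach, second_countable_topology}"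
  assumes "g \<in> borel_measurable borel"
  shows "integrable (atoms a) g \<longleftrightarrow> summable (\<lambda>n. norm ((1 / 2) ^ n *\<^sub>R g (a n)))"
  using assms by (simp add: atoms_def integrable_distr_eq integrable_density integrable_count_space_nat_iff)

lemma integral_atoms:
  fixes g :: "complex \<Rightarrow> 'a::{banach, second_countable_topology}"
  assumes "g \<in> borel_measurable borel" "integrable (atoms a) g"
  shows "(\<lambda>n. (1 / 2) ^ n *\<^sub>R g (a n)) sums (LINT z|atoms a. g z)"
proof -
  have eq: "(LINT z|atoms a. g z) = (LINT n|count_space UNIV. (1 / 2) ^ n *\<^sub>R g (a n))"
    using assms(1) by (simp add: atoms_def integral_distr integral_density)
  have "integrable (count_space UNIV) (\<lambda>n. (1 / 2) ^ n *\<^sub>R g (a n))"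
    using assms integrable_atoms_iff[OF assms(1)] by (simp add: integrable_count_space_nat_iff)
  from sums_integral_count_space_nat[OF this] show ?thesis unfolding eq .
qed

lemma emeasure_atoms:
  assumes "A \<in> sets borel"
  shows "emeasure (atoms a) A = (\<Sum>n. ennreal ((1 / 2) ^ n) * indicator A (a n))"
proof -
  have "emeasure (atoms a) A = emeasure (density (count_space UNIV) (\<lambda>n. ennreal ((1 / 2) ^ n))) (a -` A)"
    using assms by (simp add: atoms_def emeasure_distr)
  also have "\<dots> = (\<integral>\<^sup>+n. ennreal ((1 / 2) ^ n) * indicator (a -` A) n \<partial>count_space UNIV)"
    by (subst emeasure_density) auto
  also have "\<dots> = (\<Sum>n. ennreal ((1 / 2) ^ n) * indicator A (a n))"
    by (subst nn_integral_count_space_nat) (simp add: indicator_def)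
  finally show ?thesis .
qed

lemma summable_half: "summable (\<lambda>n. (1 / 2 :: real) ^ n)"
  by (rule summable_geometric) simp

lemma suminf_half: "(\<Sum>n. (1 / 2 :: real) ^ n) = 2"
  by (subst suminf_geometric) auto

lemma measure_atoms:
  assumes "A \<in> sets borel"
  shows "emeasure (atoms a) A = ennreal (\<Sum>n. (1 / 2) ^ n * indicator A (a n))"
    and "measure (atoms a) A = (\<Sum>n. (1 / 2) ^ n * indicator A (a n))"
    and "summable (\<lambda>n. (1 / 2 :: real) ^ n * indicator A (a n))"
proof -
  show s: "summable (\<lambda>n. (1 / 2 :: real) ^ n * indicator A (a n))"
    by (rule summable_comparison_test'[OF summable_half, of 0]) (simp add: indicator_def)
  have "emeasure (atoms a) A = (\<Sum>n. ennreal ((1 / 2) ^ n * indicator A (a n)))"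
    unfolding emeasure_atoms[OF assms] by (simp add: ennreal_mult' ennreal_indicator)
  also have "\<dots> = ennreal (\<Sum>n. (1 / 2) ^ n * indicator A (a n))"
    by (intro suminf_ennreal2 s) auto
  finally show e: "emeasure (atoms a) A = ennreal (\<Sum>n. (1 / 2) ^ n * indicator A (a n))" .
  then show "measure (atoms a) A = (\<Sum>n. (1 / 2) ^ n * indicator A (a n))"
    by (simp add: measure_def suminf_nonneg s)
qed

lemma finite_measure_atoms: "finite_measure (atoms a)"
proof (rule finite_measureI)
  have "space (atoms a) = UNIV" by (simp add: atoms_def)
  then show "emeasure (atoms a) (space (atoms a)) \<noteq> \<infinity>" by (simp add: measure_atoms(1))
qed

lemma discrete_measure_atoms: "discrete_measure (atoms a)"
proof -
  have c: "countable (range a)" by simp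
  have "range a \<in> sets borel" by (rule sets.countable[OF _ c]) (rule borel_singleton, rule sets.empty_sets)
  then have m: "- range a \<in> sets borel" by (rule borel_comp)
  have "emeasure (atoms a) (- range a) = 0"
    unfolding emeasure_atoms[OF m] by simp
  then show ?thesis
    unfolding discrete_measure_def using c by (intro conjI sets_atoms exI[of _ "range a"])
qed

text \<open>At a point \<open>z\<close> covered by some ball \<open>ball (a n) r\<close>, the least such \<open>n\<close> controls
  the whole geometric series.\<close>

lemma in_Lp_atoms:
  assumes p: "0 < p" and r: "0 < r"
  shows "in_Lp p (\<lambda>z. measure (atoms a) (ball z r))"
proof -
  define h where "h = (\<lambda>n z. (1 / 2 :: real) ^ n * indicator (ball z r) (a n))"
  have h_eq: "h n z = (1 / 2) ^ n * indicator (ball (a n) r) z" for n z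
    by (simp add: h_def indicator_def dist_commute)
  have meas_eq: "measure (atoms a) (ball z r) = (\<Sum>n. h n z)" for z
    unfolding h_def by (rule measure_atoms) simp
  have summ: "summable (\<lambda>n. h n z)" for z
    unfolding h_def by (rule measure_atoms) simp
  have h0: "0 \<le> h n z" "h n z \<le> (1 / 2) ^ n" for n z
    by (auto simp: h_def indicator_def)
  have [measurable]: "h n \<in> borel_measurable borel" for n
    unfolding h_eq[abs_def]
    by (intro borel_measurable_times borel_measurable_const borel_measurable_indicator) auto
  define G where "G = (\<lambda>n z. (2 powr p * (((1 / 2) powr p) ^ n)) * indicator (ball (a n) r) z)"
  have half_p: "(1 / 2 :: real) powr p < 1" using p powr_less_mono2[of p "1/2" 1] by simp
  have summ_p: "summable (\<lambda>n. 2 powr p * ((1 / 2 :: real) powr p) ^ n)"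
    using half_p by (intro summable_mult summable_geometric) simp
  have Gsumm: "summable (\<lambda>n. G n z)" for z
    by (rule summable_comparison_test'[OF summ_p, of 0]) (simp add: G_def indicator_def)
  have G0: "0 \<le> G n z" for n z by (simp add: G_def)
  have bound: "(\<Sum>n. h n z) powr p \<le> (\<Sum>n. G n z)" for z
  proof (cases "\<exists>n. a n \<in> ball z r")
    case False
    then have "(\<Sum>n. h n z) = 0" by (simp add: h_def)
    then show ?thesis using suminf_nonneg[OF Gsumm] by (simp add: G_def)
  next
    case True
    define m where "m = (LEAST n. a n \<in> ball z r)"
    have m: "a m \<in> ball z r" using True unfolding m_def by (rule LeastI_ex)
    have less: "h n z = 0" if "n < m" for n
      using not_less_Least[of n "\<lambda>n. a n \<in> ball z r"] that by (simp add: m_def h_def)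
    have "(\<Sum>n. h n z) = (\<Sum>n. h (n + m) z)"
      using suminf_split_initial_segment[OF summ, of z m] less by simp
    also have "\<dots> \<le> (\<Sum>n. (1 / 2) ^ m * (1 / 2) ^ n)"
    proof (rule suminf_le)
      show "h (n + m) z \<le> (1 / 2) ^ m * (1 / 2) ^ n" for n
        using h0(2)[of "n + m" z] by (simp add: power_add mult.commute)
      show "summable (\<lambda>n. h (n + m) z)" using summable_ignore_initial_segment[OF summ] .
    qed (intro summable_mult summable_half)
    also have "\<dots> = 2 * (1 / 2) ^ m"
      by (subst suminf_mult[OF summable_half]) (simp add: suminf_half)
    finally have "(\<Sum>n. h n z) powr p \<le> (2 * (1 / 2) ^ m) powr p"
      using p suminf_nonneg[OF summ h0(1)] by (intro powr_mono2) auto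
    also have "\<dots> = G m z"
      using m by (simp add: G_def powr_mult powr_realpow[symmetric] powr_powr powr_power mult.commute dist_commute)
    also have "\<dots> \<le> (\<Sum>n. G n z)"
      using sum_le_suminf[OF Gsumm[of z], of "{m}"] G0 by simp
    finally show ?thesis .
  qed
  have ball_val: "measure lborel (ball (a n) r) = measure lborel (ball 0 r :: complex set)" for n
  proof -
    have eq: "indicator (ball (a n) r) z = (indicator (ball 0 r) (- a n + z) :: real)" for z
      by (simp add: indicator_def dist_norm norm_minus_commute)
    have "measure lborel (ball (a n) r) = (LINT z|lborel. indicator (ball (a n) r) z)" by simp
    also have "\<dots> = (LINT z|lborel. indicator (ball 0 r) (- a n + z) :: real)" by (simp only: eq)
    also have "\<dots> = (LINT z|lborel. indicator (ball 0 r) (z :: complex))"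
      by (rule integral_translation) (rule borel_measurable_indicator, simp)
    also have "\<dots> = measure lborel (ball 0 r :: complex set)" by simp
    finally show ?thesis .
  qed
  have "integrable lborel (\<lambda>z. \<Sum>n. G n z)"
  proof (rule integrable_suminf)
    show "integrable lborel (G n)" for n
      unfolding G_def by (intro integrable_mult_right integrable_real_indicator)
        (auto simp: emeasure_lborel_ball_finite[unfolded infinity_ennreal_def])
    show "AE z in lborel. summable (\<lambda>n. norm (G n z))" using Gsumm by (simp add: G_def)
    have "(LINT z|lborel. norm (G n z)) = (2 powr p * ((1 / 2) powr p) ^ n) * measure lborel (ball 0 r :: complex set)" for n
      using ball_val[of n] by (simp add: G_def abs_mult)
    then show "summable (\<lambda>n. LINT z|lborel. norm (G n z))"
      using summable_mult2[OF summ_p] by simp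
  qed
  then have "integrable lborel (\<lambda>z. \<bar>\<Sum>n. h n z\<bar> powr p)"
  proof (rule Bochner_Integration.integrable_bound)
    show "AE z in lborel. norm (\<bar>\<Sum>n. h n z\<bar> powr p) \<le> norm (\<Sum>n. G n z)"
    proof (rule AE_I2)
      fix z
      have "0 \<le> (\<Sum>n. h n z)" using suminf_nonneg[OF summ h0(1)] .
      then show "norm (\<bar>\<Sum>n. h n z\<bar> powr p) \<le> norm (\<Sum>n. G n z)"
        using order_trans[OF bound[of z] abs_ge_self] by simp
    qed
  qed measurable
  moreover have "(\<lambda>z. \<Sum>n. h n z) \<in> borel_measurable lborel" by measurable
  ultimately show ?thesis
    unfolding in_Lp_def meas_eq by blast
qed

lemma summable_half_const:
  fixes x :: "nat \<Rightarrow> complex"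
  assumes "\<And>n. cmod (x n) \<le> C"
  shows "summable (\<lambda>n. cmod ((1 / 2) ^ n * x n))"
  by (rule summable_comparison_test'[OF summable_mult2[OF summable_half, of C], of 0])
    (use assms in \<open>simp add: norm_mult norm_power mult_left_mono del: times_divide_eq_right\<close>)

section \<open>The Toeplitz operator of the atomic measure\<close>

context fock_atoms
begin

abbreviation T where "T \<equiv> toeplitz (atoms a) \<phi>"

text \<open>An explicit witness for the description that defines \<open>toeplitz\<close>: the sum
  over \<open>n\<close> of \<open>2^(-n)\<close> times the rank one operators built from
  \<open>nker n\<close>.\<close>

definition diag_op :: "(complex \<Rightarrow> complex) \<Rightarrow> complex \<Rightarrow> complex" where
  "diag_op f = synth (\<lambda>n. (1 / 2) ^ n * sample f n)"

lemma summable_samples: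
  assumes "f \<in> F2"
  shows "summable (\<lambda>n. cmod ((1 / 2) ^ n * sample f n))"
  by (rule summable_comparison_test'[OF summable_mult2[OF summable_half, of "F.nm f / sqrt gmass"], of 0])
    (use sample_bound[OF assms] in \<open>simp add: norm_mult norm_power mult_left_mono del: times_divide_eq_right\<close>)

lemma sample_add: "sample (f + g) n = sample f n + sample g n"
  and sample_scale: "sample (cfun_scale b f) n = b * sample f n"
  by (simp_all add: sample_def cfun_scale_def algebra_simps)

lemma q_form_atoms:
  assumes f: "f \<in> F2" and u: "u \<in> F2"
  shows "integrable (atoms a) (\<lambda>z. f z * cnj (u z) * of_real (wt z))"
    and "(\<lambda>n. (1 / 2) ^ n * sample f n * cnj (sample u n)) sums q_form (atoms a) \<phi> f u"
proof -
  let ?g = "\<lambda>z. f z * cnj (u z) * of_real (wt z)"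
  have [measurable]: "cnj \<in> borel_measurable borel"
    by (intro borel_measurable_continuous_onI continuous_intros)
  note [measurable] = fock_spaceD(4)[OF f] fock_spaceD(4)[OF u]
  have meas: "?g \<in> borel_measurable borel" by measurable
  have "of_real (wt (a n)) = (of_real (exp (- \<phi> (a n))) * of_real (exp (- \<phi> (a n))) :: complex)" for n
    by (simp flip: of_real_mult exp_add del: of_real_exp)
  then have eq: "(1 / 2) ^ n *\<^sub>R ?g (a n) = (1 / 2) ^ n * sample f n * cnj (sample u n)" for n
    by (simp add: sample_def scaleR_conv_of_real mult_ac del: of_real_exp)
  have "summable (\<lambda>n. cmod ((1 / 2) ^ n * sample f n) * (F.nm u / sqrt gmass))"
    by (rule summable_mult2[OF summable_samples[OF f]])
  then have "summable (\<lambda>n. norm ((1 / 2) ^ n *\<^sub>R ?g (a n)))"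
  proof (rule summable_comparison_test'[of _ 0])
    fix n
    have "cmod ((1 / 2) ^ n * sample f n * cnj (sample u n))
        = cmod ((1 / 2) ^ n * sample f n) * cmod (sample u n)"
      by (simp only: norm_mult complex_mod_cnj)
    also have "\<dots> \<le> cmod ((1 / 2) ^ n * sample f n) * (F.nm u / sqrt gmass)"
      using sample_bound[OF u] by (intro mult_left_mono) auto
    finally show "norm (norm ((1 / 2) ^ n *\<^sub>R ?g (a n)))
        \<le> cmod ((1 / 2) ^ n * sample f n) * (F.nm u / sqrt gmass)"
      unfolding eq by simp
  qed
  then show int: "integrable (atoms a) ?g"
    using integrable_atoms_iff[OF meas] by blast
  show "(\<lambda>n. (1 / 2) ^ n * sample f n * cnj (sample u n)) sums q_form (atoms a) \<phi> f u"
    using integral_atoms[OF meas int] unfolding q_form_def eq .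
qed

lemma diag_op_in [simp]: "f \<in> F2 \<Longrightarrow> diag_op f \<in> F2"
  unfolding diag_op_def by (intro synth_in summable_samples)

lemma inner_diag_op:
  assumes "f \<in> F2" "u \<in> F2"
  shows "L2_inner \<phi> (diag_op f) u = q_form (atoms a) \<phi> f u"
  using synth_inner[OF summable_samples[OF assms(1)] assms(2)] q_form_atoms(2)[OF assms]
  unfolding diag_op_def by (rule sums_unique2)

lemma toeplitz_eq_diag_op:
  assumes f: "f \<in> F2"
  shows "T f = diag_op f"
  unfolding toeplitz_def
proof (rule the_equality)
  show "diag_op f \<in> F2 \<and> (\<forall>u\<in>F2. L2_inner \<phi> (diag_op f) u = q_form (atoms a) \<phi> f u)"
    using f inner_diag_op by simp
next
  fix g assume g: "g \<in> F2 \<and> (\<forall>u\<in>F2. L2_inner \<phi> g u = q_form (atoms a) \<phi> f u)"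
  show "g = diag_op f"
  proof (rule F.ip_ext)
    fix u assume u: "u \<in> F2"
    show "L2_inner \<phi> u g = L2_inner \<phi> u (diag_op f)"
      using g u F.ip_cnj[of g u] F.ip_cnj[of "diag_op f" u] inner_diag_op[OF f u] f by simp
  qed (use g f in auto)
qed

lemma diag_op_add: "f \<in> F2 \<Longrightarrow> g \<in> F2 \<Longrightarrow> diag_op (f + g) = diag_op f + diag_op g"
  unfolding diag_op_def by (subst synth_add[symmetric]) (auto intro: summable_samples simp: sample_add distrib_left)

lemma diag_op_scale: "f \<in> F2 \<Longrightarrow> diag_op (cfun_scale b f) = cfun_scale b (diag_op f)"
  unfolding diag_op_def by (subst synth_scale[symmetric]) (auto intro: summable_samples simp: sample_scale mult.left_commute)

lemma quad_sums:
  assumes f: "f \<in> F2"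
  shows "(\<lambda>n. (1 / 2) ^ n * (cmod (sample f n))\<^sup>2) sums Re (L2_inner \<phi> (diag_op f) f)"
proof -
  have "Re ((1 / 2) ^ n * sample f n * cnj (sample f n)) = (1 / 2) ^ n * (cmod (sample f n))\<^sup>2" for n
  proof -
    have "(1 / 2) ^ n * sample f n * cnj (sample f n) = of_real ((1 / 2) ^ n * (cmod (sample f n))\<^sup>2)"
      by (simp add: mult.assoc mult_cnj_self)
    then show ?thesis by (simp only: Re_complex_of_real)
  qed
  with sums_Re[OF q_form_atoms(2)[OF f f]] show ?thesis
    by (simp add: inner_diag_op f)
qed

text \<open>Samples of a norm bounded sequence are uniformly bounded, so a diagonal subsequence
  converges at every atom. The masses \<open>2^(-k)\<close> dominate, the damped samples converge in
  l^1, and \<open>synth_nm_le\<close> turns this into norm convergence; the limit is synthesised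
  from the limiting samples \<open>\<xi>\<close>.\<close>

lemma diag_op_compact:
  assumes x: "\<And>n. x n \<in> F2" and C: "\<And>n. F.nm (x n) \<le> C"
  shows "\<exists>r g. strict_mono (r :: nat \<Rightarrow> nat) \<and> g \<in> F2 \<and>
    (\<lambda>n. F.nm (diag_op (x (r n)) - g)) \<longlonglongrightarrow> 0"
proof -
  let ?M = "C / sqrt gmass"
  have M: "cmod (sample (x n) k) \<le> ?M" for n k
    using sample_bound[OF x, of n k] divide_right_mono[OF C[of n], of "sqrt gmass"] gmass_pos by simp
  obtain r where r: "strict_mono (r :: nat \<Rightarrow> nat)" "\<And>k. \<exists>l. (\<lambda>n. sample (x (r n)) k) \<longlonglongrightarrow> l"
    using function_convergent_subsequence[of UNIV "\<lambda>n. sample (x n)" ?M] M by auto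
  then obtain \<xi> where \<xi>: "\<And>k. (\<lambda>n. sample (x (r n)) k) \<longlonglongrightarrow> \<xi> k" by metis
  have \<xi>M: "cmod (\<xi> k) \<le> ?M" for k
    by (rule Lim_norm_ubound[OF _ \<xi>[of k]]) (auto simp: M)
  define g where "g = synth (\<lambda>k. (1 / 2) ^ k * \<xi> k)"
  note summ_\<xi> = summable_half_const[of \<xi>, OF \<xi>M]
  define \<delta> where "\<delta> = (\<lambda>n k. cmod ((1 / 2) ^ k * (sample (x (r n)) k - \<xi> k)))"
  have \<delta>_le: "\<delta> n k \<le> (1 / 2) ^ k * (2 * ?M)" for n k
  proof -
    have "cmod (sample (x (r n)) k - \<xi> k) \<le> 2 * ?M"
      using norm_triangle_ineq4[of "sample (x (r n)) k" "\<xi> k"] M[of "r n" k] \<xi>M[of k] by linarith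
    then show ?thesis
      by (simp add: \<delta>_def norm_mult norm_power mult_left_mono del: times_divide_eq_right)
  qed
  have \<delta>_summ: "summable (\<delta> n)" for n
    by (rule summable_comparison_test'[OF summable_mult2[OF summable_half, of "2 * ?M"], of 0])
      (use \<delta>_le[of n] in \<open>simp add: \<delta>_def\<close>)
  have bound: "F.nm (diag_op (x (r n)) - g) \<le> (\<Sum>k. \<delta> n k) / sqrt gmass" for n
  proof -
    have "diag_op (x (r n)) - g = synth (\<lambda>k. (1 / 2) ^ k * (sample (x (r n)) k - \<xi> k))"
      unfolding diag_op_def g_def right_diff_distrib
      by (rule synth_diff[symmetric, OF summable_samples[OF x] summ_\<xi>])
    then show ?thesis
      using synth_nm_le[of "\<lambda>k. (1 / 2) ^ k * (sample (x (r n)) k - \<xi> k)"] \<delta>_summ[of n]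
      by (simp add: \<delta>_def)
  qed
  have "(\<lambda>n. LINT k|count_space UNIV. \<delta> n k) \<longlonglongrightarrow> integral\<^sup>L (count_space (UNIV :: nat set)) (\<lambda>_. 0 :: real)"
  proof (rule integral_dominated_convergence[where s = \<delta> and f = "\<lambda>_. 0" and w = "\<lambda>k::nat. (1 / 2) ^ k * (2 * ?M)"])
    have "0 \<le> ?M" using M[of 0 0] norm_ge_zero order_trans by blast
    then have "norm ((1 / 2) ^ k * (2 * ?M)) = (1 / 2) ^ k * (2 * ?M)" for k :: nat
      unfolding real_norm_def by (intro abs_of_nonneg mult_nonneg_nonneg) auto
    then show "integrable (count_space UNIV) (\<lambda>k::nat. (1 / 2) ^ k * (2 * ?M))"
      unfolding integrable_count_space_nat_iff using summable_mult2[OF summable_half, of "2 * ?M"]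
      by (simp only:)
    show "AE k in count_space UNIV. (\<lambda>n. \<delta> n k) \<longlonglongrightarrow> 0"
    proof (rule AE_I2)
      fix k
      have "(\<lambda>n. cmod ((1 / 2) ^ k * (sample (x (r n)) k - \<xi> k))) \<longlonglongrightarrow> cmod ((1 / 2) ^ k * (\<xi> k - \<xi> k))"
        by (intro tendsto_intros \<xi>)
      then show "(\<lambda>n. \<delta> n k) \<longlonglongrightarrow> 0" by (simp add: \<delta>_def)
    qed
    show "AE k in count_space UNIV. norm (\<delta> n k) \<le> (1 / 2) ^ k * (2 * ?M)" for n
      using \<delta>_le by (auto simp: \<delta>_def)
  qed auto
  moreover have "(LINT k|count_space UNIV. \<delta> n k) = (\<Sum>k. \<delta> n k)" for n
    using \<delta>_summ[of n] by (intro integral_count_space_nat) (simp add: integrable_count_space_nat_iff \<delta>_def)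
  ultimately have "(\<lambda>n. \<Sum>k. \<delta> n k) \<longlonglongrightarrow> 0" by simp
  then have "(\<lambda>n. (\<Sum>k. \<delta> n k) / sqrt gmass) \<longlonglongrightarrow> 0 / sqrt gmass"
    using gmass_pos by (intro tendsto_intros) auto
  moreover have gF: "g \<in> F2" unfolding g_def using summ_\<xi> by (rule synth_in)
  ultimately have "(\<lambda>n. F.nm (diag_op (x (r n)) - g)) \<longlonglongrightarrow> 0"
    by (intro squeeze_0[OF _ bound]) (use x in auto)
  then show ?thesis using r(1) gF by blast
qed

lemma diag_op_bounded: "\<exists>C. \<forall>f\<in>F2. F.nm (diag_op f) \<le> C * F.nm f"
proof (intro exI ballI)
  fix f assume f: "f \<in> F2"
  have "F.nm (diag_op f) \<le> (\<Sum>n. cmod ((1 / 2) ^ n * sample f n)) / sqrt gmass"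
    unfolding diag_op_def by (rule synth_nm_le[OF summable_samples[OF f]])
  also have "\<dots> \<le> (\<Sum>n. (1 / 2) ^ n * (F.nm f / sqrt gmass)) / sqrt gmass"
    using gmass_pos sample_bound[OF f]
    by (intro divide_right_mono suminf_le summable_samples f summable_mult2 summable_half)
      (auto simp: norm_mult norm_power mult_left_mono simp del: times_divide_eq_right)
  also have "\<dots> = 2 / gmass * F.nm f"
    using gmass_pos by (subst suminf_mult2[OF summable_half, symmetric]) (simp add: suminf_half)
  finally show "F.nm (diag_op f) \<le> 2 / gmass * F.nm f" .
qed

sublocale P: compact_positive_operator cfun_scale "F2" "L2_inner \<phi>" "T"
proof
  fix f g assume f: "f \<in> F2" and g: "g \<in> F2"
  show "T (f + g) = T f + T g"
    using f g by (simp add: toeplitz_eq_diag_op fock_space_add diag_op_add)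
  have "(\<lambda>n. cnj ((1 / 2) ^ n * sample g n * cnj (sample f n))) sums cnj (L2_inner \<phi> (diag_op g) f)"
    using sums_cnj[THEN iffD2, OF q_form_atoms(2)[OF g f]] by (simp only: inner_diag_op f g)
  moreover have "cnj ((1 / 2) ^ n * sample g n * cnj (sample f n)) = (1 / 2) ^ n * sample f n * cnj (sample g n)" for n
    by simp
  ultimately have "L2_inner \<phi> (diag_op f) g = cnj (L2_inner \<phi> (diag_op g) f)"
    unfolding inner_diag_op[OF f g] using sums_unique2[OF q_form_atoms(2)[OF f g]] by (simp only:)
  then show "L2_inner \<phi> (T f) g = L2_inner \<phi> f (T g)"
    using f g F.ip_cnj[of "diag_op g" f] by (simp add: toeplitz_eq_diag_op)
next
  fix f b assume f: "f \<in> F2"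
  then show "T f \<in> F2" by (simp add: toeplitz_eq_diag_op)
  show "T (cfun_scale b f) = cfun_scale b (T f)"
    using f by (simp add: toeplitz_eq_diag_op fock_space_scale diag_op_scale)
  show "0 \<le> Re (L2_inner \<phi> (T f) f)"
  proof -
    have "0 \<le> (\<Sum>n. (1 / 2) ^ n * (cmod (sample f n))\<^sup>2)"
      using quad_sums[OF f] by (intro suminf_nonneg) (auto simp: sums_iff)
    then show ?thesis using quad_sums[OF f] f by (simp add: toeplitz_eq_diag_op sums_iff)
  qed
next
  show "\<exists>C. \<forall>f\<in>F2. F.nm (T f) \<le> C * F.nm f"
    using diag_op_bounded by (simp add: toeplitz_eq_diag_op cong: ball_cong)
next
  fix x :: "nat \<Rightarrow> complex \<Rightarrow> complex" and C
  assume "\<And>n. x n \<in> F2" "\<And>n. F.nm (x n) \<le> C"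
  then show "\<exists>r g. strict_mono (r :: nat \<Rightarrow> nat) \<and> g \<in> F2 \<and>
      (\<lambda>n. F.nm (T (x (r n)) - g)) \<longlonglongrightarrow> 0"
    using diag_op_compact[of x C] by (simp add: toeplitz_eq_diag_op)
qed

lemma compact_toeplitz: "compact_operator_on \<phi> (F2) (T)"
  unfolding compact_operator_on_def bounded_operator_on_def
proof (intro conjI ballI allI impI)
  fix f g b c assume f: "f \<in> F2" and g: "g \<in> F2"
  have "T (cfun_scale b f + cfun_scale c g) = cfun_scale b (T f) + cfun_scale c (T g)"
    using f g by (simp add: P.T_add P.T_scale fock_space_scale)
  then show "T (\<lambda>z. b * f z + c * g z) = (\<lambda>z. b * T f z + c * T g z)"
    by (simp add: cfun_scale_def plus_fun_def)
next
  show "\<exists>C. \<forall>f\<in>F2. L2_norm \<phi> (T f) \<le> C * L2_norm \<phi> f"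
    using P.T_bounded by (simp only: nm_eq_L2_norm)
next
  fix x :: "nat \<Rightarrow> complex \<Rightarrow> complex"
  assume "(\<forall>n. x n \<in> F2) \<and> (\<exists>C. \<forall>n. L2_norm \<phi> (x n) \<le> C)"
  then obtain C where "\<And>n. x n \<in> F2" "\<And>n. F.nm (x n) \<le> C"
    by (auto simp: nm_eq_L2_norm)
  from P.T_compact[of x, OF this]
  show "\<exists>r g. strict_mono r \<and> g \<in> F2 \<and>
      (\<lambda>n. L2_norm \<phi> (\<lambda>z. T (x (r n)) z - g z)) \<longlonglongrightarrow> 0"
    by (simp add: nm_eq_L2_norm fun_diff_def)
qed auto

lemma adjoint_toeplitz:
  assumes g: "g \<in> F2"
  shows "adjoint_on \<phi> (F2) (T) g = T g"
  unfolding adjoint_on_def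
proof (rule the_equality)
  fix h assume "h \<in> F2 \<and>
    (\<forall>f\<in>F2. L2_inner \<phi> (T f) g = L2_inner \<phi> f h)"
  then show "h = T g"
    using g by (intro F.ip_ext) (auto simp: P.T_sym)
qed (use g in \<open>auto simp: P.T_sym\<close>)

lemma singular_values_toeplitz:
  "singular_values \<phi> (F2) (T) P.eigval"
proof -
  have "singular_space \<phi> (F2) (T) \<sigma> = {f \<in> F2.
      T (T f) = cfun_scale (complex_of_real (\<sigma>\<^sup>2)) f}" for \<sigma>
    unfolding singular_space_def using adjoint_toeplitz by auto
  then show ?thesis
    unfolding singular_values_def using P.eigval_antimono P.sing_eigenspace by simp
qed

text \<open>The constraints fed into \<open>P.eigval_le\<close> are evaluations at the first
  \<open>k\<close> atoms. The tail of the masses contributes \<open>2 * (1 / 2) ^ k\<close>, the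
  squared bound for point evaluations \<open>1 / gmass\<close>.\<close>

lemma eigval_le_geometric: "P.eigval k \<le> 2 / gmass * (1 / 2) ^ k"
proof (rule P.eigval_le[where l = "\<lambda>i f. f (a i)"])
  fix f assume f: "f \<in> F2" and 0: "\<And>i. i < k \<Longrightarrow> f (a i) = 0"
  let ?g = "\<lambda>n. (1 / 2) ^ n * (cmod (sample f n))\<^sup>2"
  have summ: "summable ?g" using quad_sums[OF f] by (simp add: sums_iff)
  have le: "(cmod (sample f n))\<^sup>2 \<le> (F.nm f)\<^sup>2 / gmass" for n
    using power_mono[OF sample_bound[OF f] norm_ge_zero, of n 2] gmass_pos
    by (simp add: power_divide)
  have "P.quad f = (\<Sum>n. ?g n)"
    using quad_sums[OF f] f by (simp add: P.quad_def toeplitz_eq_diag_op sums_iff)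
  also have "\<dots> = (\<Sum>n. ?g (n + k))"
    using suminf_split_initial_segment[OF summ, of k] 0 by (simp add: sample_def)
  also have "\<dots> \<le> (\<Sum>n. (1 / 2) ^ n * ((1 / 2) ^ k * ((F.nm f)\<^sup>2 / gmass)))"
  proof (intro suminf_le summable_mult2 summable_half)
    show "summable (\<lambda>n. ?g (n + k))" by (rule summable_ignore_initial_segment[OF summ])
    show "?g (n + k) \<le> (1 / 2) ^ n * ((1 / 2) ^ k * ((F.nm f)\<^sup>2 / gmass))" for n
      using le[of "n + k"] unfolding power_add mult.assoc by (intro mult_left_mono) auto
  qed
  also have "\<dots> = 2 / gmass * (1 / 2) ^ k * (F.nm f)\<^sup>2"
    by (subst suminf_mult2[OF summable_half, symmetric]) (simp add: suminf_half)
  finally show "P.quad f \<le> 2 / gmass * (1 / 2) ^ k * (F.nm f)\<^sup>2" .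
qed (use gmass_pos in \<open>auto simp: cfun_scale_def\<close>)

lemma toeplitz_schatten:
  assumes p: "0 < p"
  shows "T \<in> schatten_class p \<phi> (F2)"
proof -
  have half_p: "(1 / 2 :: real) powr p < 1" using p powr_less_mono2[of p "1/2" 1] by simp
  have "summable (\<lambda>k. P.eigval k powr p)"
  proof (rule summable_comparison_test'[of "\<lambda>k. (2 / gmass) powr p * ((1 / 2) powr p) ^ k" 0])
    show "summable (\<lambda>k. (2 / gmass) powr p * ((1 / 2) powr p) ^ k)"
      using half_p by (intro summable_mult summable_geometric) simp
    fix k
    have "P.eigval k powr p \<le> (2 / gmass * (1 / 2) ^ k) powr p"
      using p eigval_le_geometric by (intro powr_mono2) auto
    also have "\<dots> = (2 / gmass) powr p * ((1 / 2) powr p) ^ k"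
      using gmass_pos by (simp only: powr_mult)
        (simp add: powr_realpow[symmetric] powr_powr powr_power mult.commute)
    finally show "norm (P.eigval k powr p) \<le> (2 / gmass) powr p * ((1 / 2) powr p) ^ k" by simp
  qed
  then show ?thesis
    unfolding schatten_class_def using compact_toeplitz singular_values_toeplitz by auto
qed

lemma q_form_bounded_fock: "q_form_bounded (atoms a) \<phi> (F2)"
proof -
  obtain C where C: "\<And>f. f \<in> F2 \<Longrightarrow> F.nm (diag_op f) \<le> C * F.nm f"
    using diag_op_bounded by blast
  have "cmod (q_form (atoms a) \<phi> f u) \<le> C * L2_norm \<phi> f * L2_norm \<phi> u"
    if f: "f \<in> F2" and u: "u \<in> F2" for f u
  proof -
    have "cmod (q_form (atoms a) \<phi> f u) \<le> F.nm (diag_op f) * F.nm u"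
      using F.Cauchy_Schwarz[of "diag_op f" u] f u by (simp add: inner_diag_op)
    also have "\<dots> \<le> C * F.nm f * F.nm u"
      using C[OF f] u by (intro mult_right_mono) auto
    finally show ?thesis by (simp only: nm_eq_L2_norm)
  qed
  then show ?thesis
    unfolding q_form_bounded_def using q_form_atoms(1) by blast
qed

end

section \<open>The saddle point function\<close>

lemma sin_diff_bounds:
  fixes a b :: real
  assumes ab: "a \<le> b" and C: "\<And>t. a \<le> t \<Longrightarrow> t \<le> b \<Longrightarrow> m \<le> cos t \<and> cos t \<le> M"
  shows "m * (b - a) \<le> sin b - sin a" "sin b - sin a \<le> M * (b - a)"
proof -
  have "m * (b - a) \<le> sin b - sin a \<and> sin b - sin a \<le> M * (b - a)"
  proof (cases "a = b")
    case False
    with ab have "a < b" by simp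
    then obtain t where t: "a < t" "t < b" "sin b - sin a = (b - a) * cos t"
      using MVT2[of a b sin cos] by (auto intro: derivative_eq_intros)
    then show ?thesis using C[of t] ab by (simp add: mult.commute mult_right_mono)
  qed simp
  then show "m * (b - a) \<le> sin b - sin a" "sin b - sin a \<le> M * (b - a)" by auto
qed

lemma cmod_exp_minus_1_le:
  assumes "cmod u \<le> 1 / 2" shows "cmod (exp u - 1) \<le> 2 * cmod u"
proof -
  have "cmod (exp u - exp 0) \<le> 2 * cmod (u - 0)"
  proof (rule field_differentiable_bound[of "cball 0 (1/2)" exp exp])
    fix z :: complex assume "z \<in> cball 0 (1/2)"
    then have "Re z \<le> 1 / 2" using complex_Re_le_cmod[of z] by simp
    then have "exp (Re z) \<le> exp (1 / 2)" by simp
    also have "exp (1 / 2 :: real) \<le> 2" by (rule exp_half_le2)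
    finally show "cmod (exp z) \<le> 2" by simp
  qed (use assms in \<open>auto intro!: derivative_eq_intros\<close>)
  then show ?thesis by simp
qed

lemma cmod_exp_minus_1_minus_le:
  assumes "cmod u \<le> 1 / 2" shows "cmod (exp u - 1 - u) \<le> 2 * (cmod u)\<^sup>2"
proof -
  let ?S = "cball 0 (cmod u)"
  have "cmod ((exp u - u) - (exp 0 - 0)) \<le> (2 * cmod u) * cmod (u - 0)"
  proof (rule field_differentiable_bound[of ?S "\<lambda>z. exp z - z" "\<lambda>z. exp z - 1"])
    fix z :: complex assume z: "z \<in> ?S"
    then have "cmod (exp z - 1) \<le> 2 * cmod z" using assms by (intro cmod_exp_minus_1_le) auto
    then show "cmod (exp z - 1) \<le> 2 * cmod u" using z by auto
  qed (auto intro!: derivative_eq_intros)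
  then show ?thesis by (simp add: power2_eq_square algebra_simps)
qed

text \<open>Dominating \<open>|f'|\<close> along a segment by an explicit derivative \<open>B'\<close> replaces all estimates of
  integrals below.\<close>

lemma segment_bound:
  fixes f :: "real \<Rightarrow> complex"
  assumes "a \<le> b" "\<And>t. (f has_vector_derivative f' t) (at t)"
    and "\<And>t. (B has_real_derivative B' t) (at t)" "\<And>t. a < t \<Longrightarrow> t < b \<Longrightarrow> cmod (f' t) \<le> B' t"
  shows "cmod (f b - f a) \<le> B b - B a"
proof (cases "a = b")
  case False
  show ?thesis
  proof (rule differentiable_bound_general[where f' = f' and \<phi>' = B'])
    show "continuous_on {a..b} f" "continuous_on {a..b} B"
      using assms(2,3) by (auto intro!: continuous_at_imp_continuous_on
          dest: has_vector_derivative_continuous DERIV_isCont)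
  qed (use assms False in \<open>auto simp: has_real_derivative_iff_has_vector_derivative\<close>)
qed simp

lemma exists_period_shift: "\<exists>k::int. c \<le> y + 2 * pi * of_int k \<and> y + 2 * pi * of_int k < c + 2 * pi"
proof -
  define k where "k = \<lceil>(c - y) / (2 * pi)\<rceil>"
  have "(c - y) / (2 * pi) \<le> of_int k" "of_int k - 1 < (c - y) / (2 * pi)"
    using ceiling_correct[of "(c - y) / (2 * pi)"] by (auto simp: k_def)
  then have "c - y \<le> of_int k * (2 * pi)" "(of_int k - 1) * (2 * pi) < c - y"
    by (simp_all only: pos_divide_le_eq pos_less_divide_eq pi_gt_zero zero_less_mult_iff zero_less_numeral simp_thms)
  then show ?thesis by (intro exI[of _ k]) (auto simp: algebra_simps)
qed

lemma sin_period_int: "sin (y + 2 * pi * of_int k) = sin y"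
  and cos_period_int: "cos (y + 2 * pi * of_int k) = cos y"
  by (simp_all add: sin_add cos_add sin_int_2pin cos_int_2pin del: mult.commute)

lemma ln_2_pos: "0 < ln (2 :: real)" by simp

text \<open>For \<open>\<bar>x\<bar> \<le> ln 2\<close> both exponentials lie within a factor 2 of
  \<open>exp (- \<bar>x\<bar> / 2)\<close>: the price for a bound symmetric in
  \<open>x\<close>.\<close>

lemma exp_half_le:
  fixes x :: real
  assumes "x \<le> ln 2" "- ln 2 \<le> x"
  shows "exp (x / 2) \<le> 2 * exp (- \<bar>x\<bar> / 2) \<and> exp (- x / 2) \<le> 2 * exp (- \<bar>x\<bar> / 2)"
proof -
  have "\<bar>x\<bar> \<le> ln 2" using assms by (rule abs_leI[OF _ minus_le_iff[THEN iffD1]])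
  then have "exp (x / 2) \<le> exp (ln 2 + - \<bar>x\<bar> / 2)" "exp (- x / 2) \<le> exp (ln 2 + - \<bar>x\<bar> / 2)"
    unfolding exp_le_cancel_iff by (simp_all add: abs_if split: if_splits)
  moreover have "exp (ln 2 + - \<bar>x\<bar> / 2) = 2 * exp (- \<bar>x\<bar> / 2)"
    by (simp only: exp_add exp_ln zero_less_numeral)
  ultimately show ?thesis by (simp only:)
qed

lemma exp_le_twice: fixes x :: real assumes "- ln 2 \<le> x" shows "exp (- x / 2) \<le> 2 * exp (- \<bar>x\<bar> / 2)"
proof (cases "x \<le> ln 2")
  case True
  then show ?thesis using exp_half_le assms by blast
next
  case False
  then have "\<bar>x\<bar> = x" using ln_2_pos by linarith
  then show ?thesis by simp
qed

section \<open>The integrand at a saddle point and its primitive\<close>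

locale saddle =
  fixes N :: real
  assumes N_ge: "16 \<le> N"
begin

text \<open>This is \<open>exp (c z - exp z)\<close> at \<open>z = z0 + w\<close>, divided by its
  value at \<open>z0\<close>, for a saddle point with \<open>exp z0 = \<i> N\<close>. It equals 1 at
  0, and the part of the exponent multiplied by \<open>N\<close> vanishes there to second
  order.\<close>

definition integrand :: "complex \<Rightarrow> complex" where
  "integrand w = exp (w / 2 - \<i> * of_real N * (exp w - 1 - w))"

definition expo :: complex where "expo = 1 / 2 + \<i> * of_real N"

text \<open>Expand \<open>exp (- \<i> N s)\<close> with \<open>s = exp w\<close> and integrate
  \<open>exp ((expo + n) * w)\<close> term by term. The resulting series singles out the primitive
  that vanishes at the left end, and since it is a power series in \<open>exp w\<close>, its
  behaviour under \<open>w \<mapsto> w + 2 pi i\<close> can be read off.\<close>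

definition series_coeff :: "nat \<Rightarrow> complex" where
  "series_coeff n = (- \<i> * of_real N) ^ n / (fact n * (expo + of_nat n))"

definition primitive :: "complex \<Rightarrow> complex" where
  "primitive w = exp (\<i> * of_real N) * exp (expo * w) * (\<Sum>n. series_coeff n * exp w ^ n)"

text \<open>The same function governs both sides of the comparison: \<open>exp (- height)\<close> is
  the oscillatory part of the modulus of the integrand, and \<open>exp height\<close>, up to a
  Gaussian and a constant, is the square root of the translated weight
  (\<open>weight_centre\<close>).\<close>

definition height :: "real \<Rightarrow> real \<Rightarrow> real" where
  "height x y = N * (y - exp x * sin y)"

abbreviation prim :: "real \<Rightarrow> real \<Rightarrow> complex" where "prim x y \<equiv> primitive (Complex x y)"

lemma N_pos: "0 < N" using N_ge by simp

lemma expo_nonzero: "expo + of_nat n \<noteq> 0"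
proof
  assume "expo + of_nat n = 0"
  then have "Re (expo + of_nat n) = 0" by simp
  then show False by (simp add: expo_def)
qed

lemma summable_series_coeff: "summable (\<lambda>n. series_coeff n * s ^ n)"
proof (rule summable_comparison_test'[of "\<lambda>n. 2 * norm ((N * cmod s) ^ n /\<^sub>R fact n)" 0])
  show "summable (\<lambda>n. 2 * norm ((N * cmod s) ^ n /\<^sub>R fact n))"
    using summable_norm_exp[of "N * cmod s"] by (intro summable_mult)
  fix n
  have "1 / 2 \<le> Re (expo + of_nat n)" by (simp add: expo_def)
  also have "\<dots> \<le> cmod (expo + of_nat n)" by (rule complex_Re_le_cmod)
  finally have le: "1 / cmod (expo + of_nat n) \<le> 2" by (simp add: divide_simps)
  have "norm (series_coeff n * s ^ n) = (N * cmod s) ^ n / fact n * (1 / cmod (expo + of_nat n))"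
    using N_pos by (simp add: series_coeff_def norm_mult norm_divide norm_power power_mult_distrib)
  also have "\<dots> \<le> (N * cmod s) ^ n / fact n * 2"
    using N_pos by (intro mult_left_mono le) auto
  finally show "norm (series_coeff n * s ^ n) \<le> 2 * norm ((N * cmod s) ^ n /\<^sub>R fact n)"
    using N_pos by (simp add: divide_inverse mult_ac)
qed

text \<open>With \<open>s = exp w\<close> this says that \<open>exp (expo * w)\<close> times the
  series in \<open>exp w\<close> is a primitive of \<open>exp (expo * w - \<i> N exp w)\<close>; the
  factors \<open>expo + n\<close> cancel the denominators of the coefficients.\<close>

lemma series_coeff_ode: "s * (\<Sum>n. diffs series_coeff n * s ^ n) + expo * (\<Sum>n. series_coeff n * s ^ n) = exp (- \<i> * of_real N * s)"
proof -
  have "summable (\<lambda>n. diffs series_coeff n * s ^ n)"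
    by (rule termdiff_converges_all) (rule summable_series_coeff)
  then have "(\<lambda>n. of_nat n * series_coeff n * s ^ (n - Suc 0)) sums (\<Sum>n. diffs series_coeff n * s ^ n)"
    by (rule diffs_equiv)
  then have S: "(\<lambda>n. s * (of_nat n * series_coeff n * s ^ (n - Suc 0)) + expo * (series_coeff n * s ^ n)) sums
      (s * (\<Sum>n. diffs series_coeff n * s ^ n) + expo * (\<Sum>n. series_coeff n * s ^ n))"
    by (intro sums_add sums_mult summable_sums summable_series_coeff)
  have eq: "s * (of_nat n * series_coeff n * s ^ (n - Suc 0)) + expo * (series_coeff n * s ^ n)
      = (- \<i> * of_real N * s) ^ n /\<^sub>R fact n" for n
  proof -
    have "s * (of_nat n * series_coeff n * s ^ (n - Suc 0)) = of_nat n * series_coeff n * s ^ n"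
      by (cases n) (auto simp: mult_ac)
    then have "s * (of_nat n * series_coeff n * s ^ (n - Suc 0)) + expo * (series_coeff n * s ^ n)
        = (expo + of_nat n) * series_coeff n * s ^ n" by (simp add: algebra_simps)
    also have "(expo + of_nat n) * series_coeff n = (- \<i> * of_real N) ^ n / fact n"
      using expo_nonzero[of n] by (simp add: series_coeff_def)
    finally show ?thesis
      unfolding power_mult_distrib[of "- \<i> * of_real N" s]
      by (simp add: scaleR_conv_of_real divide_inverse mult_ac)
  qed
  show ?thesis by (rule sums_unique2[OF S[unfolded eq] exp_converges])
qed

lemma primitive_deriv: "(primitive has_field_derivative integrand w) (at w within S)"
proof -
  let ?H = "\<lambda>s. \<Sum>n. series_coeff n * s ^ n" and ?H' = "\<lambda>s. \<Sum>n. diffs series_coeff n * s ^ n"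
  have H: "(?H has_field_derivative ?H' s) (at s)" for s
    by (rule termdiffs_strong_converges_everywhere) (rule summable_series_coeff)
  have "(primitive has_field_derivative
      exp (\<i> * of_real N) * (exp (expo * w) * expo) * ?H (exp w)
      + ?H' (exp w) * exp w * (exp (\<i> * of_real N) * exp (expo * w))) (at w)"
    unfolding primitive_def[abs_def]
    by (rule DERIV_mult DERIV_chain2[OF H] derivative_eq_intros refl | simp)+
  also have "exp (\<i> * of_real N) * (exp (expo * w) * expo) * ?H (exp w)
      + ?H' (exp w) * exp w * (exp (\<i> * of_real N) * exp (expo * w))
      = exp (\<i> * of_real N) * exp (expo * w) * (exp w * ?H' (exp w) + expo * ?H (exp w))"
    by (simp add: algebra_simps)
  also have "\<dots> = exp (\<i> * of_real N + expo * w + - \<i> * of_real N * exp w)"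
    by (simp only: series_coeff_ode exp_add)
  also have "\<i> * of_real N + expo * w + - \<i> * of_real N * exp w = w / 2 - \<i> * of_real N * (exp w - 1 - w)"
    by (simp add: expo_def algebra_simps)
  finally show ?thesis unfolding integrand_def by (rule has_field_derivative_at_within)
qed

lemma primitive_holomorphic: "primitive holomorphic_on S"
  unfolding holomorphic_on_def field_differentiable_def using primitive_deriv by blast

lemma primitive_shift: "primitive (w + 2 * of_real pi * \<i>) = - of_real (exp (- 2 * pi * N)) * primitive w"
proof -
  have "expo * (2 * of_real pi * \<i>) = of_real pi * \<i> + of_real (- 2 * pi * N)"
    by (simp add: expo_def algebra_simps)
  then have "exp (expo * (w + 2 * of_real pi * \<i>)) = exp (expo * w) * (exp (of_real pi * \<i>) * of_real (exp (- 2 * pi * N)))"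
    by (simp only: distrib_left exp_add exp_of_real)
  then show ?thesis by (simp add: primitive_def exp_add del: of_real_exp)
qed

lemma cmod_integrand: "cmod (integrand (Complex x y)) = exp (x / 2 - height x y)"
  unfolding integrand_def norm_exp_eq_Re
  by (simp add: height_def Re_exp Im_exp algebra_simps)

lemma primitive_horizontal:
  "((\<lambda>x. prim x y) has_vector_derivative integrand (Complex x y)) (at x within S)"
proof -
  have "((\<lambda>x. Complex x y) has_vector_derivative 1) (at x within S)"
    unfolding Complex_eq by (auto intro!: derivative_eq_intros)
  from field_vector_diff_chain_within[OF this primitive_deriv]
  show ?thesis by (simp add: o_def)
qed

lemma primitive_vertical:
  "((\<lambda>t. prim x (y + \<sigma> * t)) has_vector_derivative (\<i> * of_real \<sigma> * integrand (Complex x (y + \<sigma> * t)))) (at t within S)"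
proof -
  have "((\<lambda>t. Complex x (y + \<sigma> * t)) has_vector_derivative (\<i> * of_real \<sigma>)) (at t within S)"
    unfolding Complex_eq by (auto intro!: derivative_eq_intros)
  from field_vector_diff_chain_within[OF this primitive_deriv]
  show ?thesis by (simp add: o_def)
qed

lemma primitive_tendsto_left: "((\<lambda>x. prim x y) \<longlongrightarrow> 0) at_bot"
proof -
  let ?H = "\<lambda>s. \<Sum>n. series_coeff n * s ^ n"
  have "(?H has_field_derivative (\<Sum>n. diffs series_coeff n * s ^ n)) (at s)" for s
    by (rule termdiffs_strong_converges_everywhere) (rule summable_series_coeff)
  then have cont: "isCont ?H 0" by (rule DERIV_isCont)
  have lim0: "((\<lambda>x. exp (Complex x y)) \<longlongrightarrow> 0) at_bot"
    by (rule tendsto_norm_zero_cancel) (simp add: exp_at_bot)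
  have "((\<lambda>x. exp (expo * Complex x y)) \<longlongrightarrow> 0) at_bot"
  proof (rule tendsto_norm_zero_cancel)
    have "((\<lambda>x::real. exp (x / 2)) \<longlongrightarrow> 0) at_bot"
      by (rule filterlim_compose[OF exp_at_bot]) (auto intro!: filterlim_at_bot_imp_at_infinity
          simp: filterlim_at_bot eventually_at_bot_linorder intro: exI[of _ "2 * _"])
    then have "((\<lambda>x::real. exp (x / 2) * exp (- N * y)) \<longlongrightarrow> 0 * exp (- N * y)) at_bot"
      by (intro tendsto_intros)
    then show "((\<lambda>x. cmod (exp (expo * Complex x y))) \<longlongrightarrow> 0) at_bot"
      by (simp add: expo_def exp_add[symmetric] algebra_simps exp_diff)
  qed
  then have "((\<lambda>x. exp (\<i> * of_real N) * exp (expo * Complex x y) * ?H (exp (Complex x y)))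
      \<longlongrightarrow> exp (\<i> * of_real N) * 0 * ?H 0) at_bot"
    by (intro tendsto_intros isCont_tendsto_compose[OF cont lim0])
  then show ?thesis by (simp add: primitive_def)
qed

lemma primitive_left_bound:
  assumes y: "0 \<le> sin y"
  shows "cmod (prim x y) * exp (height x y) \<le> 2 * exp (x / 2) / (1 / 2 + N * sin y * exp x)"
proof -
  define b where "b = N * sin y"
  have b: "0 \<le> b" using y N_pos by (simp add: b_def)
  \<comment> \<open>Leading term of the integral: the modulus of the integrand divided by its
    logarithmic derivative. The correction in \<open>B'\<close> is at most 1/2 because
    \<open>(1/2 + u)^2 \<ge> 2 u\<close>; the factor 2 absorbs it.\<close>
  define B where "B = (\<lambda>t. 2 * exp (- N * y) * exp (t / 2 + b * exp t) / (1 / 2 + b * exp t))"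
  let ?B' = "\<lambda>t. 2 * exp (- N * y) * exp (t / 2 + b * exp t) * (1 - b * exp t / (1 / 2 + b * exp t)\<^sup>2)"
  have pos: "0 < 1 / 2 + b * exp t" for t using b by (simp add: add_pos_nonneg)
  have quotient: "(K * (F * D) * D - K * F * u) / (D * D) = K * F * (1 - u / D\<^sup>2)" if "0 < D" for K F D u :: real
    using that by (simp add: field_simps power2_eq_square)
  have deriv: "(B has_real_derivative ?B' t) (at t)" for t
    unfolding B_def quotient[OF pos, symmetric] using pos[of t]
    by (auto intro!: derivative_eq_intros)
  have dom: "cmod (integrand (Complex t y)) \<le> ?B' t" for t
  proof -
    have "2 * (b * exp t) \<le> (1 / 2 + b * exp t)\<^sup>2"
      using zero_le_power2[of "1 / 2 - b * exp t"] by (simp add: power2_eq_square algebra_simps)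
    then have "b * exp t \<le> 1 / 2 * (1 / 2 + b * exp t)\<^sup>2" by linarith
    then have "b * exp t / (1 / 2 + b * exp t)\<^sup>2 \<le> 1 / 2"
      by (subst pos_divide_le_eq) (use pos[of t] in auto)
    moreover have "u \<le> 1 / 2 \<Longrightarrow> 1 \<le> 2 * (1 - u)" for u :: real by simp
    ultimately have h: "1 \<le> 2 * (1 - b * exp t / (1 / 2 + b * exp t)\<^sup>2)" by blast
    have "exp (- N * y) * exp (t / 2 + b * exp t) * 1
        \<le> exp (- N * y) * exp (t / 2 + b * exp t) * (2 * (1 - b * exp t / (1 / 2 + b * exp t)\<^sup>2))"
      by (intro mult_left_mono h) auto
    also have "\<dots> = ?B' t" by (simp only: mult_ac)
    finally have "exp (- N * y) * exp (t / 2 + b * exp t) \<le> ?B' t" by (simp only: mult_1_right)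
    moreover have "cmod (integrand (Complex t y)) = exp (- N * y) * exp (t / 2 + b * exp t)"
      by (simp add: cmod_integrand height_def b_def algebra_simps flip: exp_add)
    ultimately show ?thesis by (simp only:)
  qed
  have le: "cmod (prim x y - prim t y) \<le> B x" if "t \<le> x" for t
  proof -
    have "cmod (prim x y - prim t y) \<le> B x - B t"
      by (rule segment_bound[OF that primitive_horizontal deriv dom])
    moreover have "0 \<le> B t" using pos[of t] by (simp add: B_def)
    ultimately show ?thesis by simp
  qed
  have "((\<lambda>t. cmod (prim x y - prim t y)) \<longlongrightarrow> cmod (prim x y - 0)) at_bot"
    by (intro tendsto_intros primitive_tendsto_left)
  then have "cmod (prim x y - 0) \<le> B x"
    by (rule tendsto_upperbound) (auto simp: eventually_at_bot_linorder intro!: exI[of _ x] le)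
  then have "cmod (prim x y) * exp (height x y) \<le> B x * exp (height x y)"
    by (intro mult_right_mono) auto
  also have "exp (- N * y) * exp (x / 2 + b * exp x) * exp (height x y) = exp (x / 2)"
    by (simp add: height_def b_def algebra_simps flip: exp_add)
  then have "B x * exp (height x y) = 2 * exp (x / 2) / (1 / 2 + N * sin y * exp x)"
    by (simp add: B_def b_def mult_ac)
  finally show ?thesis .
qed

lemma primitive_right_diff:
  assumes y: "sin y < 0" and x: "x \<le> x'"
  shows "cmod (prim x' y - prim x y)
    \<le> exp (- x / 2 - height x y) / (N * \<bar>sin y\<bar>)"
proof -
  define b where "b = N * \<bar>sin y\<bar>"
  have b: "0 < b" unfolding b_def using y N_pos by (intro mult_pos_pos) auto
  \<comment> \<open>Write \<open>exp (t / 2) = exp (- t / 2) * exp t\<close>: the factor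
    \<open>b * exp t\<close> comes from differentiating the double exponential, and the term from
    \<open>exp (- t / 2)\<close> only helps.\<close>
  define B where "B = (\<lambda>t. - exp (- N * y) * exp (- t / 2 - b * exp t) / b)"
  let ?B' = "\<lambda>t. exp (- N * y) * exp (- t / 2 - b * exp t) * ((1 / 2 + b * exp t) / b)"
  have deriv: "(B has_real_derivative ?B' t) (at t)" for t
    unfolding B_def using b by (auto intro!: derivative_eq_intros simp: field_simps)
  have dom: "cmod (integrand (Complex t y)) \<le> ?B' t" for t
  proof -
    have "cmod (integrand (Complex t y)) = exp (- N * y) * exp (- t / 2 - b * exp t) * exp t"
      using y by (simp add: cmod_integrand height_def b_def algebra_simps flip: exp_add)
    also have "\<dots> \<le> ?B' t"
      using b by (intro mult_left_mono) (auto simp: field_simps)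
    finally show ?thesis .
  qed
  have "cmod (prim x' y - prim x y) \<le> B x' - B x"
    by (rule segment_bound[OF x primitive_horizontal deriv dom])
  also have "\<dots> \<le> - B x" using b by (simp add: B_def)
  also have "\<dots> = exp (- x / 2 - height x y) / (N * \<bar>sin y\<bar>)"
    using y by (simp add: B_def b_def height_def algebra_simps flip: exp_add)
  finally show ?thesis .
qed

section \<open>Limits in the right half strips and the choice of phase\<close>

lemma right_limit:
  assumes y: "sin y < 0"
  shows "\<exists>l. (\<lambda>n. prim (real n) y) \<longlonglongrightarrow> l"
proof -
  define \<delta> where "\<delta> = (\<lambda>n. exp (- real n / 2 - height (real n) y) / (N * \<bar>sin y\<bar>))"
  define k where "k = N * \<bar>sin y\<bar>"
  have k: "0 < k" using y N_pos unfolding k_def by (intro mult_pos_pos) auto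
  have "\<delta> = (\<lambda>n. exp (- real n / 2 - N * y - k * exp (real n)) / k)"
    using y by (simp add: \<delta>_def k_def height_def algebra_simps)
  moreover have "(\<lambda>n. exp (- real n / 2 - N * y - k * exp (real n)) / k) \<longlonglongrightarrow> 0"
    using k by real_asymp
  ultimately have \<delta>: "\<delta> \<longlonglongrightarrow> 0" by simp
  have "Cauchy (\<lambda>n. prim (real n) y)"
  proof (rule metric_CauchyI)
    fix e :: real assume "0 < e"
    then obtain M where M: "\<And>n. M \<le> n \<Longrightarrow> \<delta> n < e / 2"
      using order_tendstoD(2)[OF \<delta>, of "e / 2"] by (auto simp: eventually_sequentially)
    have *: "dist (prim (real n) y) (prim (real M) y) < e / 2" if "M \<le> n" for n
    proof -
      have "dist (prim (real n) y) (prim (real M) y) \<le> \<delta> M"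
        using primitive_right_diff[OF y, of "real M" "real n"] that by (simp add: \<delta>_def dist_norm)
      then show ?thesis using M[of M] by simp
    qed
    show "\<exists>M. \<forall>m\<ge>M. \<forall>n\<ge>M. dist (prim (real m) y) (prim (real n) y) < e"
    proof (intro exI[of _ M] allI impI)
      fix m n assume "M \<le> m" "M \<le> n"
      then show "dist (prim (real m) y) (prim (real n) y) < e"
        using *[of m] *[of n] dist_triangle2[of "prim (real m) y"
            "prim (real n) y" "prim (real M) y"] by linarith
    qed
  qed
  then show ?thesis by (simp add: Cauchy_convergent_iff convergent_def)
qed

definition right_value :: complex where
  "right_value = lim (\<lambda>n. prim (real n) (- pi / 2))"

text \<open>Between the lines at heights \<open>y\<close> and \<open>- pi / 2\<close> the sine stays
  below some \<open>- m < 0\<close>, so the integrand is doubly exponentially small on far vertical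
  segments. Hence all lines of the strip share one limit.\<close>

lemma right_limit_value:
  assumes y: "- pi < y" "y < 0"
  shows "(\<lambda>n. prim (real n) y) \<longlonglongrightarrow> right_value"
proof -
  define lo where "lo = min y (- pi / 2)"
  define hi where "hi = max y (- pi / 2)"
  have lohi: "lo \<le> hi" "- pi < lo" "hi < 0" using y pi_gt_zero by (auto simp: lo_def hi_def)
  have neg: "sin t < 0" if "lo \<le> t" "t \<le> hi" for t
    using sin_gt_zero[of "- t"] that lohi by simp
  have "\<exists>t0\<in>{lo..hi}. \<forall>t\<in>{lo..hi}. sin t \<le> sin t0"
    by (rule continuous_attains_sup) (use lohi in \<open>auto intro!: continuous_intros\<close>)
  then obtain t0 where t0': "t0 \<in> {lo..hi}" "\<forall>t\<in>{lo..hi}. sin t \<le> sin t0" by blast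
  then have t0: "lo \<le> t0" "t0 \<le> hi" "lo \<le> t \<Longrightarrow> t \<le> hi \<Longrightarrow> sin t \<le> sin t0" for t by simp_all
  define m where "m = - sin t0"
  have m: "0 < m" using neg t0 by (simp add: m_def)
  define K where "K = (\<lambda>n. exp (real n / 2 + N * pi - N * m * exp (real n)))"
  have bound: "cmod (prim (real n) hi - prim (real n) lo) \<le> K n * (hi - lo)" for n
  proof -
    have "cmod (prim (real n) (lo + 1 * (hi - lo)) - prim (real n) (lo + 1 * 0))
        \<le> K n * (hi - lo) - K n * 0"
    proof (rule segment_bound[OF _ primitive_vertical])
      show "((\<lambda>t. K n * t) has_real_derivative K n) (at t)" for t
        by (auto intro!: derivative_eq_intros)
      fix t assume t: "0 < t" "t < hi - lo"
      have "- height (real n) (lo + t) \<le> N * pi - N * m * exp (real n)"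
      proof -
        have "N * exp (real n) * sin (lo + t) \<le> N * exp (real n) * (- m)"
          using t t0(3)[of "lo + t"] N_pos by (intro mult_left_mono) (auto simp: m_def)
        moreover have "N * (- (lo + t)) \<le> N * pi"
          using t lohi N_pos by (intro mult_left_mono) auto
        ultimately show ?thesis by (simp add: height_def algebra_simps)
      qed
      then show "cmod (\<i> * of_real 1 * integrand (Complex (real n) (lo + 1 * t))) \<le> K n"
        by (simp add: norm_mult cmod_integrand K_def)
    qed (use lohi in auto)
    then show ?thesis by simp
  qed
  have "(\<lambda>n. exp (real n / 2 + c - k * exp (real n))) \<longlonglongrightarrow> 0" if "0 < k" for c k :: real
    using that by real_asymp
  from this[of "N * m" "N * pi"] have K0: "K \<longlonglongrightarrow> 0"
    unfolding K_def using mult_pos_pos[OF N_pos m] by blast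
  have "(\<lambda>n. K n * (hi - lo)) \<longlonglongrightarrow> 0 * (hi - lo)"
    by (rule tendsto_mult[OF K0 tendsto_const])
  then have lim0: "(\<lambda>n. K n * (hi - lo)) \<longlonglongrightarrow> 0" by (simp only: mult_zero_left)
  have diff: "(\<lambda>n. prim (real n) hi - prim (real n) lo) \<longlonglongrightarrow> 0"
    by (rule Lim_null_comparison[OF always_eventually lim0]) (rule allI, rule bound)
  obtain l where l: "(\<lambda>n. prim (real n) (- pi / 2)) \<longlonglongrightarrow> l"
    using right_limit[of "- pi / 2"] by auto
  then have base: "(\<lambda>n. prim (real n) (- pi / 2)) \<longlonglongrightarrow> right_value"
    by (simp add: right_value_def limI)
  show ?thesis
  proof (cases "y \<le> - pi / 2")
    case True
    then have "lo = y" "hi = - pi / 2" by (auto simp: lo_def hi_def)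
    then show ?thesis using tendsto_diff[OF base diff] by simp
  next
    case False
    then have "hi = y" "lo = - pi / 2" by (auto simp: lo_def hi_def)
    then show ?thesis using tendsto_add[OF base diff] by simp
  qed
qed

lemma primitive_right_bound:
  assumes y: "- pi < y" "y < 0"
  shows "cmod (prim x y - right_value) * exp (height x y) \<le> exp (- x / 2) / (N * \<bar>sin y\<bar>)"
proof -
  have neg: "sin y < 0" using sin_gt_zero[of "- y"] y by simp
  have "(\<lambda>n. cmod (prim (real n) y - prim x y)) \<longlonglongrightarrow> cmod (right_value - prim x y)"
    by (intro tendsto_intros right_limit_value y)
  moreover have "\<exists>M. \<forall>n\<ge>M. cmod (prim (real n) y - prim x y)
      \<le> exp (- x / 2 - height x y) / (N * \<bar>sin y\<bar>)"
    using primitive_right_diff[OF neg] by (intro exI[of _ "nat \<lceil>x\<rceil>"]) (auto simp: nat_le_iff ceiling_le_iff)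
  ultimately have "cmod (right_value - prim x y) \<le> exp (- x / 2 - height x y) / (N * \<bar>sin y\<bar>)"
    by (intro LIMSEQ_le_const2) auto
  then have "cmod (right_value - prim x y) * exp (height x y)
      \<le> exp (- x / 2 - height x y) / (N * \<bar>sin y\<bar>) * exp (height x y)"
    by (intro mult_right_mono) auto
  also have "\<dots> = exp (- x / 2) / (N * \<bar>sin y\<bar>)" by (simp flip: exp_add)
  finally show ?thesis by (simp add: norm_minus_commute)
qed

text \<open>When the limit is 0 any unit number serves; \<open>sgn\<close> alone would return 0 and
  annihilate \<open>osc\<close>.\<close>

definition phase :: complex where
  "phase = (if right_value = 0 then 1 else sgn right_value)"

lemma cmod_phase [simp]: "cmod phase = 1"
  by (simp add: phase_def norm_sgn)

lemma right_value_real: "Im (right_value * cnj phase) = 0"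
proof (cases "right_value = 0")
  case False
  then have "right_value * cnj phase = (right_value * cnj right_value) / of_real (cmod right_value)"
    by (simp add: phase_def sgn_eq)
  then show ?thesis by (simp add: complex_mult_cnj)
qed simp

definition osc :: "complex \<Rightarrow> real" where
  "osc w = Im (primitive w * cnj phase)"

text \<open>\<open>osc\<close> measured against the square root of the weight, stripped of its
  Gaussian factor and constant. Without the Gaussian it is periodic, so a single period in
  \<open>y\<close> has to be estimated.\<close>

definition profile :: "real \<Rightarrow> real \<Rightarrow> real" where
  "profile x y = \<bar>osc (Complex x y)\<bar> * exp (height x y)"

lemma profile_nonneg [simp]: "0 \<le> profile x y"
  by (simp add: profile_def)

lemma osc_diff_le: "\<bar>osc w - osc w'\<bar> \<le> cmod (primitive w - primitive w')"
proof -
  have "osc w - osc w' = Im ((primitive w - primitive w') * cnj phase)"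
    by (simp add: osc_def algebra_simps)
  then show ?thesis
    using abs_Im_le_cmod[of "(primitive w - primitive w') * cnj phase"] by (simp add: norm_mult)
qed

lemma osc_le: "\<bar>osc w\<bar> \<le> cmod (primitive w)"
  using abs_Im_le_cmod[of "primitive w * cnj phase"] by (simp add: osc_def norm_mult)

lemma osc_le_right: "\<bar>osc w\<bar> \<le> cmod (primitive w - right_value)"
proof -
  have "osc w = Im ((primitive w - right_value) * cnj phase)"
    using right_value_real by (simp add: osc_def left_diff_distrib)
  then show ?thesis
    using abs_Im_le_cmod[of "(primitive w - right_value) * cnj phase"] by (simp add: norm_mult)
qed

text \<open>The factor by which \<open>primitive\<close> changes under \<open>w \<mapsto> w + 2\<pi>i\<close> is real; therefore the
  single phase chosen above makes \<open>osc\<close> tend to \<open>0\<close> in all the right half strips at once.\<close>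

lemma profile_periodic: "profile x (y + 2 * pi) = profile x y"
proof -
  have "Complex x (y + 2 * pi) = Complex x y + 2 * of_real pi * \<i>" by (simp add: complex_eq_iff)
  then have "prim x (y + 2 * pi) * cnj phase
      = of_real (- exp (- 2 * pi * N)) * (prim x y * cnj phase)"
    by (simp only: primitive_shift of_real_minus) simp
  then have "osc (Complex x (y + 2 * pi)) = Im (of_real (- exp (- 2 * pi * N)) * (prim x y * cnj phase))"
    unfolding osc_def by (rule arg_cong)
  also have "\<dots> = - exp (- 2 * pi * N) * osc (Complex x y)"
    unfolding osc_def times_complex.sel by (simp only: Re_complex_of_real Im_complex_of_real mult_zero_left add_0_right)
  finally have o: "osc (Complex x (y + 2 * pi)) = - exp (- 2 * pi * N) * osc (Complex x y)" .
  have h: "height x (y + 2 * pi) = height x y + 2 * pi * N"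
    unfolding height_def sin_periodic by (simp add: algebra_simps)
  have "profile x (y + 2 * pi) = \<bar>osc (Complex x y)\<bar> * (exp (- 2 * pi * N) * exp (height x y + 2 * pi * N))"
    unfolding profile_def o h by (simp add: abs_mult)
  also have "exp (- 2 * pi * N) * exp (height x y + 2 * pi * N) = exp (height x y)"
    by (simp flip: exp_add)
  finally show ?thesis by (simp only: profile_def)
qed

lemma profile_periodic_int: "profile x (y + 2 * pi * of_int k) = profile x y"
proof (induction k rule: int_induct[of _ 0])
  case (step1 i)
  then show ?case using profile_periodic[of x "y + 2 * pi * of_int i"] by (simp add: algebra_simps)
next
  case (step2 i)
  then show ?case using profile_periodic[of x "y + 2 * pi * (of_int i - 1)"] by (simp add: algebra_simps)
qed simp

lemma profile_left:
  assumes "0 < sin y"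
  shows "profile x y \<le> 2 * exp (- x / 2) / (N * \<bar>sin y\<bar>)"
proof -
  have pos: "0 < N * sin y * exp x" using assms N_pos by simp
  have "profile x y \<le> cmod (prim x y) * exp (height x y)"
    unfolding profile_def by (intro mult_right_mono osc_le) auto
  also have "\<dots> \<le> 2 * exp (x / 2) / (1 / 2 + N * sin y * exp x)"
    using assms by (intro primitive_left_bound) auto
  also have "\<dots> \<le> 2 * exp (x / 2) / (N * sin y * exp x)"
    using pos by (intro divide_left_mono) (auto intro: mult_pos_pos)
  also have "exp x = exp (x / 2) * exp (x / 2)" by (simp flip: exp_add)
  finally show ?thesis using assms by (simp add: exp_minus field_simps)
qed

lemma profile_right:
  assumes "- pi < y" "y < 0"
  shows "profile x y \<le> 2 * exp (- x / 2) / (N * \<bar>sin y\<bar>)"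
proof -
  have "profile x y \<le> cmod (prim x y - right_value) * exp (height x y)"
    unfolding profile_def by (intro mult_right_mono osc_le_right) auto
  also have "\<dots> \<le> exp (- x / 2) / (N * \<bar>sin y\<bar>)" by (rule primitive_right_bound[OF assms])
  also have "\<dots> \<le> 2 * exp (- x / 2) / (N * \<bar>sin y\<bar>)"
    using N_pos by (intro divide_right_mono) auto
  finally show ?thesis .
qed

lemma profile_bound_away:
  assumes "sin y \<noteq> 0"
  shows "profile x y \<le> 2 * exp (- x / 2) / (N * \<bar>sin y\<bar>)"
proof -
  obtain k :: int where k: "- pi \<le> y + 2 * pi * of_int k" "y + 2 * pi * of_int k < - pi + 2 * pi"
    using exists_period_shift by blast
  let ?y = "y + 2 * pi * of_int k"
  have "?y \<noteq> - pi" "?y \<noteq> 0" using assms sin_period_int[of y k] by (metis sin_minus sin_pi minus_zero) (metis assms sin_period_int sin_zero)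
  then have "profile x ?y \<le> 2 * exp (- x / 2) / (N * \<bar>sin ?y\<bar>)"
    using k profile_right[of ?y x] profile_left[of ?y x] sin_gt_zero[of ?y] by (cases "?y < 0") auto
  then show ?thesis by (simp only: profile_periodic_int sin_period_int)
qed

text \<open>The descent estimate. If \<open>height\<close> grows at rate \<open>k\<close> along a
  vertical segment, up to a slack \<open>d\<close>, the integrand decays geometrically along it and
  its integral costs \<open>1 / k\<close>; the contribution of the far end shrinks by the gain in
  height. A bound at a good point is thus carried to a bad one.\<close>

lemma profile_move:
  assumes \<sigma>: "\<bar>\<sigma>\<bar> = 1" and L: "0 \<le> L" and k: "0 < k"
    and grow: "\<And>t. 0 \<le> t \<Longrightarrow> t \<le> L \<Longrightarrow> height x y + k * t - d \<le> height x (y + \<sigma> * t)"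
  shows "profile x y \<le> exp (d - k * L) * profile x (y + \<sigma> * L) + exp (x / 2 + d) / k"
proof -
  define K where "K = exp (x / 2 - height x y + d)"
  have "cmod (prim x (y + \<sigma> * L) - prim x (y + \<sigma> * 0))
      \<le> (- K * exp (- k * L) / k) - (- K * exp (- k * 0) / k)"
  proof (rule segment_bound[OF L primitive_vertical])
    show "((\<lambda>t. - K * exp (- k * t) / k) has_real_derivative K * exp (- k * t)) (at t)" for t
      using k by (auto intro!: derivative_eq_intros)
    fix t assume "0 < t" "t < L"
    then have "x / 2 - height x (y + \<sigma> * t) \<le> (x / 2 - height x y + d) + - k * t"
      using grow[of t] by simp
    then have "exp (x / 2 - height x (y + \<sigma> * t)) \<le> K * exp (- k * t)"
      unfolding K_def exp_add[symmetric] by simp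
    then show "cmod (\<i> * of_real \<sigma> * integrand (Complex x (y + \<sigma> * t))) \<le> K * exp (- k * t)"
      using \<sigma> by (simp add: norm_mult cmod_integrand)
  qed
  also have "\<dots> \<le> K / k" using k by (simp add: K_def)
  finally have diff: "\<bar>osc (Complex x (y + \<sigma> * L)) - osc (Complex x y)\<bar> \<le> K / k"
    using osc_diff_le[of "Complex x (y + \<sigma> * L)" "Complex x y"] by simp
  have "profile x y \<le> (\<bar>osc (Complex x (y + \<sigma> * L))\<bar> + K / k) * exp (height x y)"
    unfolding profile_def using diff by (intro mult_right_mono) auto
  also have "\<dots> = \<bar>osc (Complex x (y + \<sigma> * L))\<bar> * exp (height x y) + exp (x / 2 + d) / k"
    by (simp add: K_def distrib_right flip: exp_add)
  also have "\<bar>osc (Complex x (y + \<sigma> * L))\<bar> * exp (height x y)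
      \<le> \<bar>osc (Complex x (y + \<sigma> * L))\<bar> * (exp (d - k * L) * exp (height x (y + \<sigma> * L)))"
    using grow[of L] L unfolding exp_add[symmetric] by (intro mult_left_mono) auto
  finally show ?thesis by (simp add: profile_def mult_ac)
qed

end

section \<open>Uniform estimates of the profile\<close>

context saddle
begin

text \<open>The scale of the saddle: at distance \<open>width\<close> the quadratic phase
  \<open>N * w\<^sup>2\<close> has size 1.\<close>

definition width :: real where "width = 1 / sqrt N"

lemma width: "0 < width" "width \<le> 1 / 4" "N * width\<^sup>2 = 1" "1 / N = width * width" "1 / N \<le> width / 4"
proof -
  have s: "4 \<le> sqrt N" using real_sqrt_le_mono[OF N_ge] by simp
  show w: "0 < width" using N_pos by (simp add: width_def)
  have "1 / sqrt N \<le> 1 / 4" using s N_pos by (intro divide_left_mono) auto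
  then show w': "width \<le> 1 / 4" by (simp add: width_def)
  show "N * width\<^sup>2 = 1" using N_pos by (simp add: width_def power_divide)
  show e: "1 / N = width * width" using N_pos by (simp add: width_def)
  show "1 / N \<le> width / 4" unfolding e using w w' mult_left_mono[of width "1 / 4" width] by simp
qed

lemma cos_near_0:
  assumes "\<bar>t\<bar> \<le> width" shows "1 - width\<^sup>2 / 2 \<le> cos t" "31 / 32 \<le> cos t"
proof -
  have "1 - t\<^sup>2 / 2 \<le> cos t"
  proof -
    have "\<bar>sin (t / 2)\<bar> \<le> \<bar>t / 2\<bar>" by (rule abs_sin_x_le_abs_x)
    then have "(sin (t / 2))\<^sup>2 \<le> (t / 2)\<^sup>2" by (simp only: abs_le_square_iff)
    moreover have "cos t = 1 - 2 * (sin (t / 2))\<^sup>2" using cos_double_sin[of "t / 2"] by simp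
    ultimately show ?thesis by (simp add: power_divide)
  qed
  moreover have "t\<^sup>2 \<le> width\<^sup>2" using assms width(1) abs_le_square_iff[of t width] by simp
  moreover have "width\<^sup>2 \<le> 1 / 16"
    using power_mono[OF width(2), of 2] width(1) by (simp add: power2_eq_square)
  ultimately show "1 - width\<^sup>2 / 2 \<le> cos t" "31 / 32 \<le> cos t" by linarith+
qed

lemma sin_width: "width / 2 \<le> sin width"
proof -
  have "1 / 2 * (width - 0) \<le> sin width - sin 0"
  proof (rule sin_diff_bounds(1)[where M = 1])
    fix t assume "0 \<le> t" "t \<le> width"
    then have "31 / 32 \<le> cos t" by (intro cos_near_0(2)) simp
    then show "1 / 2 \<le> cos t \<and> cos t \<le> 1" by simp
  qed (use width in auto)
  then show ?thesis by simp
qed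

lemma profile_bound_case_away:
  assumes y: "width / 2 \<le> \<bar>sin y\<bar>"
  shows "profile x y \<le> 4 * width * exp (- x / 2)"
proof -
  have "profile x y \<le> 2 * exp (- x / 2) / (N * \<bar>sin y\<bar>)"
    using y width by (intro profile_bound_away) auto
  also have "\<dots> \<le> 2 * exp (- x / 2) / (N * (width / 2))"
    using y width N_pos by (intro divide_left_mono mult_left_mono mult_pos_pos) auto
  also have "\<dots> = 4 * exp (- x / 2) * (1 / N) / width" by simp
  also have "\<dots> = 4 * width * exp (- x / 2)"
    unfolding width(4) using width(1) by (simp add: field_simps)
  finally show ?thesis .
qed

text \<open>Here \<open>exp x \<le> 1 / 2\<close>, so \<open>height\<close> rises at rate at least
  \<open>N / 2\<close> all the way up. Moving by a full period returns to the same profile, with a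
  factor that is at most 1/2 and can be absorbed.\<close>

lemma profile_bound_far_left:
  assumes x: "x \<le> - ln 2"
  shows "profile x y \<le> width * exp (x / 2)"
proof -
  have ex: "exp x \<le> 1 / 2" using x by (metis exp_le_cancel_iff exp_ln exp_minus inverse_eq_divide zero_less_numeral)
  have k: "0 < N / 2" using N_pos by simp
  have "profile x y \<le> exp (0 - N / 2 * (2 * pi)) * profile x (y + 1 * (2 * pi)) + exp (x / 2 + 0) / (N / 2)"
  proof (rule profile_move[OF _ _ k])
    fix t :: real assume t: "0 \<le> t"
    have "sin (y + t) - sin y \<le> 1 * (y + t - y)"
      using t by (intro sin_diff_bounds(2)[where m = "-1"]) auto
    then have "exp x * (sin (y + t) - sin y) \<le> exp x * t" by (simp add: mult_left_mono)
    also have "\<dots> \<le> 1 / 2 * t" using ex t by (intro mult_right_mono) auto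
    finally have "N * (t / 2) \<le> N * (t - exp x * (sin (y + t) - sin y))"
      using N_pos by (intro mult_left_mono) auto
    then show "height x y + N / 2 * t - 0 \<le> height x (y + 1 * t)"
      by (simp add: height_def algebra_simps)
  qed auto
  note this[unfolded mult_1 profile_periodic]
  moreover have "exp (0 - N / 2 * (2 * pi)) = exp (- N * pi)" "exp (x / 2 + 0) / (N / 2) = 2 * (1 / N) * exp (x / 2)"
    by simp_all
  ultimately have le: "profile x y \<le> exp (- N * pi) * profile x y + 2 * (1 / N) * exp (x / 2)"
    by (simp only:)
  have "exp (- N * pi) \<le> 1 / 2"
  proof -
    have "1 + N * pi \<le> exp (N * pi)" by (rule exp_ge_add_one_self)
    moreover have "1 * 1 \<le> N * pi" using N_ge pi_ge_two by (intro mult_mono) auto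
    ultimately have "2 \<le> exp (N * pi)" by linarith
    then show ?thesis by (simp add: exp_minus field_simps)
  qed
  then have "exp (- N * pi) * profile x y \<le> 1 / 2 * profile x y" by (rule mult_right_mono) simp
  with le have "profile x y \<le> 4 * (1 / N) * exp (x / 2)" by simp
  also have "\<dots> \<le> 4 * (width / 4) * exp (x / 2)" using width(5) by (intro mult_right_mono mult_left_mono) auto
  finally show ?thesis by simp
qed

lemma profile_move_flat:
  assumes \<sigma>: "\<bar>\<sigma>\<bar> = 1" and L: "0 \<le> L" "L \<le> 2 * width"
    and grow: "\<And>t. 0 \<le> t \<Longrightarrow> t \<le> L \<Longrightarrow> height x y - 1 / 2 \<le> height x (y + \<sigma> * t)"
  shows "profile x y \<le> exp 1 * (profile x (y + \<sigma> * L) + 4 * width * exp (x / 2))"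
proof -
  \<comment> \<open>A rate this small gains at most 1/2 over a length of \<open>2 * width\<close>.
    Together with the permitted drop of 1/2 this is covered by the slack 1 in
    \<open>profile_move\<close>.\<close>
  define k where "k = 1 / (4 * width)"
  have k: "0 < k" using width(1) by (simp add: k_def)
  have "profile x y \<le> exp (1 - k * L) * profile x (y + \<sigma> * L) + exp (x / 2 + 1) / k"
  proof (rule profile_move[OF \<sigma> L(1) k])
    fix t assume t: "0 \<le> t" "t \<le> L"
    then have "k * t \<le> 1 / 2" using L(2) width(1) by (simp add: k_def pos_divide_le_eq)
    then show "height x y + k * t - 1 \<le> height x (y + \<sigma> * t)" using grow[OF t] by linarith
  qed
  also have "exp (1 - k * L) * profile x (y + \<sigma> * L) \<le> exp 1 * profile x (y + \<sigma> * L)"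
    using k L(1) by (intro mult_right_mono) auto
  also have "exp (x / 2 + 1) / k = exp 1 * (4 * width * exp (x / 2))"
    by (simp add: k_def exp_add)
  finally show ?thesis by (simp add: distrib_left)
qed

text \<open>Where the slope of \<open>height\<close> is comparable to \<open>N * exp x\<close>, the
  passage costs only \<open>(4 / N) * exp (- x / 2)\<close>, which is below
  \<open>width * exp (- x / 2)\<close>.\<close>

lemma profile_move_steep:
  assumes "\<bar>\<sigma>\<bar> = 1" "0 \<le> L"
    and grow: "\<And>t. 0 \<le> t \<Longrightarrow> t \<le> L \<Longrightarrow> height x y + N * (exp x / 4 * t) \<le> height x (y + \<sigma> * t)"
  shows "profile x y \<le> profile x (y + \<sigma> * L) + width * exp (- x / 2)"
proof -
  define k where "k = N * exp x / 4"
  have k: "0 < k" using N_pos by (simp add: k_def)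
  have "profile x y \<le> exp (0 - k * L) * profile x (y + \<sigma> * L) + exp (x / 2 + 0) / k"
    using grow by (intro profile_move assms k) (simp add: k_def mult.assoc)
  also have "exp (0 - k * L) * profile x (y + \<sigma> * L) \<le> profile x (y + \<sigma> * L)"
    using k assms(2) by (intro mult_left_le_one_le) auto
  also have "exp (x / 2 + 0) / k = 4 * (1 / N) * exp (- x / 2)"
  proof -
    have "exp x = exp (x / 2) * exp (x / 2)" by (simp flip: exp_add)
    then show ?thesis using N_pos by (simp add: k_def exp_minus field_simps)
  qed
  also have "\<dots> \<le> 4 * (width / 4) * exp (- x / 2)"
    using width(5) by (intro mult_right_mono mult_left_mono) auto
  finally show ?thesis by simp
qed

lemma profile_bound_from_decay:
  assumes "profile x y \<le> 5 * width * exp (- x / 2)" "- ln 2 \<le> x"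
  shows "profile x y \<le> 50 * width * exp (- \<bar>x\<bar> / 2)"
proof -
  have "5 * width * exp (- x / 2) \<le> 5 * width * (2 * exp (- \<bar>x\<bar> / 2))"
    using width(1) exp_le_twice[OF assms(2)] by (intro mult_left_mono) auto
  also have "\<dots> \<le> 50 * width * exp (- \<bar>x\<bar> / 2)" using width(1) by simp
  finally show ?thesis using assms(1) by linarith
qed

text \<open>The slope of \<open>height\<close> in \<open>y\<close> is
  \<open>N * (1 - exp x * cos y)\<close>, whose sign near the saddle depends on \<open>x\<close>:
  the path to the good lines \<open>\<bar>y\<bar> = width\<close> goes up for
  \<open>x \<le> 0\<close> and down for \<open>x \<ge> 0\<close>. For \<open>x\<close> between 0 and
  \<open>ln 2\<close> the height may drop, but at most by
  \<open>N * width\<^sup>2 * t / 2 = t / 2\<close>; beyond \<open>ln 2\<close> the descent is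
  steep.\<close>

lemma profile_bound_near_0:
  assumes y: "\<bar>y\<bar> \<le> width" and x: "- ln 2 \<le> x"
  shows "profile x y \<le> 50 * width * exp (- \<bar>x\<bar> / 2)"
proof -
  have exp_1: "exp (1::real) \<le> 3" using e_less_272 by simp
  \<comment> \<open>Symmetrising costs a factor 2, so the end point and the passage contribute 8
    each; times 3, a bound for \<open>exp 1\<close>, this is 48, the origin of the constant
    50.\<close>
  have combine: "profile x y \<le> 50 * width * exp (- \<bar>x\<bar> / 2)"
    if "profile x y \<le> exp 1 * (profile x y' + 4 * width * exp (x / 2))" "\<bar>y'\<bar> = width" "x \<le> ln 2" for y'
  proof -
    have "y' = width \<or> y' = - width" using that(2) by linarith
    then have "\<bar>sin y'\<bar> = \<bar>sin width\<bar>" by auto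
    then have "profile x y' \<le> 4 * width * exp (- x / 2)"
      using sin_width by (intro profile_bound_case_away) linarith
    then have "profile x y' + 4 * width * exp (x / 2)
        \<le> 4 * width * (2 * exp (- \<bar>x\<bar> / 2)) + 4 * width * (2 * exp (- \<bar>x\<bar> / 2))"
      using exp_half_le[OF that(3) x] width(1) order_trans
      by (intro add_mono) (auto intro: order_trans mult_left_mono)
    then have "exp 1 * (profile x y' + 4 * width * exp (x / 2)) \<le> 3 * (16 * width * exp (- \<bar>x\<bar> / 2))"
      using exp_1 width(1) by (intro mult_mono) auto
    also have "\<dots> \<le> 50 * width * exp (- \<bar>x\<bar> / 2)" using width(1) by simp
    finally show ?thesis using that(1) by linarith
  qed
  consider "x \<le> 0" | "0 \<le> x" "x \<le> ln 2" | "ln 2 \<le> x" by linarith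
  then show ?thesis
  proof cases
    case 1
    have "profile x y \<le> exp 1 * (profile x (y + 1 * (width - y)) + 4 * width * exp (x / 2))"
    proof (rule profile_move_flat)
      fix t assume t: "0 \<le> t" "t \<le> width - y"
      have "0 * (y + t - y) \<le> sin (y + t) - sin y"
        using y t cos_near_0(2)[of _] by (intro sin_diff_bounds(1)[where M = 1]) (auto intro: order_trans[of _ "31/32"])
      then have "exp x * (sin (y + t) - sin y) \<le> 1 * (sin (y + t) - sin y)"
        using 1 by (intro mult_right_mono) auto
      also have "\<dots> \<le> 1 * (y + t - y)"
        using t by (intro order_trans[OF _ sin_diff_bounds(2)[where m = "-1"]]) auto
      finally have "N * 0 \<le> N * (t - exp x * (sin (y + t) - sin y))"
        using N_pos by (intro mult_left_mono) auto
      moreover have "height x (y + 1 * t) = height x y + N * (t - exp x * (sin (y + t) - sin y))"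
        by (simp add: height_def algebra_simps)
      ultimately show "height x y - 1 / 2 \<le> height x (y + 1 * t)" by linarith
    qed (use y in auto)
    moreover have "x \<le> ln 2" using 1 ln_2_pos by linarith
    ultimately show ?thesis using width(1) by (intro combine) auto
  next
    case 2
    have "profile x y \<le> exp 1 * (profile x (y + (- 1) * (y + width)) + 4 * width * exp (x / 2))"
    proof (rule profile_move_flat)
      fix t assume t: "0 \<le> t" "t \<le> y + width"
      have "(1 - width\<^sup>2 / 2) * (y - (y - t)) \<le> sin y - sin (y - t)"
        using y t cos_near_0(1) by (intro sin_diff_bounds(1)[where M = 1]) auto
      then have low: "t - width\<^sup>2 / 2 * t \<le> sin y - sin (y - t)" by (simp add: algebra_simps)
      have "width\<^sup>2 \<le> 1" using width(1,2) by (simp add: power_le_one)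
      then have "0 \<le> (1 - width\<^sup>2 / 2) * t" using t by (intro mult_nonneg_nonneg) auto
      with low have "0 \<le> sin y - sin (y - t)" by (simp add: algebra_simps)
      then have "1 * (sin y - sin (y - t)) \<le> exp x * (sin y - sin (y - t))"
        using 2 by (intro mult_right_mono) auto
      with low have "- (width\<^sup>2 / 2 * t) \<le> - t + exp x * (sin y - sin (y - t))" by simp
      then have "N * (- (width\<^sup>2 / 2 * t)) \<le> N * (- t + exp x * (sin y - sin (y - t)))"
        using N_pos by (intro mult_left_mono) auto
      moreover have "N * (- (width\<^sup>2 / 2 * t)) = - (t / 2)" using width(3) by (simp add: algebra_simps)
      moreover have "height x (y + (- 1) * t) = height x y + N * (- t + exp x * (sin y - sin (y - t)))"
        by (simp add: height_def algebra_simps)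
      moreover have "t / 2 \<le> 1 / 2" using t y width(2) by linarith
      ultimately show "height x y - 1 / 2 \<le> height x (y + (- 1) * t)" by linarith
    qed (use y in auto)
    then show ?thesis using 2 width(1) by (intro combine) auto
  next
    case 3
    then have ex: "2 \<le> exp x" by (metis exp_le_cancel_iff exp_ln zero_less_numeral)
    have "profile x y \<le> profile x (y + (- 1) * (y + width)) + width * exp (- x / 2)"
    proof (rule profile_move_steep)
      fix t assume t: "0 \<le> t" "t \<le> y + width"
      have "31 / 32 * (y - (y - t)) \<le> sin y - sin (y - t)"
        using y t cos_near_0(2) by (intro sin_diff_bounds(1)[where M = 1]) auto
      then have "exp x * (31 / 32 * t) \<le> exp x * (sin y - sin (y - t))" by (intro mult_left_mono) auto
      moreover have "exp x * (31 / 32 * t) = 31 / 32 * (exp x * t)" by simp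
      moreover have "2 * t \<le> exp x * t" using ex t by (intro mult_right_mono) auto
      ultimately have "exp x / 4 * t \<le> - t + exp x * (sin y - sin (y - t))"
        using t(1) by linarith
      then have "N * (exp x / 4 * t) \<le> N * (- t + exp x * (sin y - sin (y - t)))"
        using N_pos by (intro mult_left_mono) auto
      then show "height x y + N * (exp x / 4 * t) \<le> height x (y + (- 1) * t)"
        by (simp add: height_def algebra_simps)
    qed (use y in auto)
    also have "profile x (y + (- 1) * (y + width)) \<le> 4 * width * exp (- x / 2)"
      using profile_bound_case_away[of "- width" x] sin_width by simp
    finally show ?thesis using x by (intro profile_bound_from_decay) auto
  qed
qed

text \<open>Around \<open>y = - pi\<close> the cosine is at most -1/2, so \<open>height\<close>
  increases steeply upwards for every \<open>x\<close>. The path ends at \<open>- 3 pi / 4\<close>,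
  well away from the zeros of the sine.\<close>

lemma profile_bound_near_pi:
  assumes y: "- (5 * pi / 4) \<le> y" "y \<le> - (3 * pi / 4)" and x: "- ln 2 \<le> x"
  shows "profile x y \<le> 50 * width * exp (- \<bar>x\<bar> / 2)"
proof -
  let ?L = "- (3 * pi / 4) - y"
  have cos_le: "cos t \<le> - (1 / 2)" if "- (5 * pi / 4) \<le> t" "t \<le> - (3 * pi / 4)" for t
  proof -
    have "cos (\<bar>t + pi\<bar>) \<ge> cos (pi / 4)"
    proof (rule cos_monotone_0_pi_le)
      show "\<bar>t + pi\<bar> \<le> pi / 4" using that by linarith
    qed (use pi_gt_zero in auto)
    moreover have "cos (pi / 4) \<ge> 1 / 2" by (simp add: cos_45 real_le_rsqrt)
    moreover have "cos (t + pi) = - cos t" by simp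
    ultimately show ?thesis by (simp add: abs_if split: if_splits)
  qed
  have "profile x y \<le> profile x (y + 1 * ?L) + width * exp (- x / 2)"
  proof (rule profile_move_steep)
    fix t assume t: "0 \<le> t" "t \<le> ?L"
    have "sin (y + t) - sin y \<le> - (1 / 2) * (y + t - y)"
      using t y cos_le by (intro sin_diff_bounds(2)[where m = "-1"]) auto
    then have "exp x * (sin (y + t) - sin y) \<le> exp x * (- (1 / 4) * t)"
      using t by (intro mult_left_mono) auto
    then have "exp x / 4 * t \<le> t - exp x * (sin (y + t) - sin y)" using t by simp
    then have "N * (exp x / 4 * t) \<le> N * (t - exp x * (sin (y + t) - sin y))"
      using N_pos by (intro mult_left_mono) auto
    then show "height x y + N * (exp x / 4 * t) \<le> height x (y + 1 * t)"
      by (simp add: height_def algebra_simps)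
  qed (use y in auto)
  also have "profile x (y + 1 * ?L) \<le> 4 * width * exp (- x / 2)"
  proof -
    have "sin (3 * pi / 4) = sin (pi - pi / 4)" by (simp add: algebra_simps)
    then have "sin (3 * pi / 4) = sqrt 2 / 2" by (simp only: sin_pi_minus sin_45)
    moreover have "1 \<le> sqrt 2" by simp
    ultimately have "width / 2 \<le> sin (3 * pi / 4)" using width(2) by linarith
    then show ?thesis using profile_bound_case_away[of "- (3 * pi / 4)" x] by simp
  qed
  finally show ?thesis using x by (intro profile_bound_from_decay) auto
qed

proposition profile_bound: "profile x y \<le> 50 * width * exp (- \<bar>x\<bar> / 2)"
proof (cases "x \<le> - ln 2")
  case True
  then have "\<bar>x\<bar> = - x" using ln_2_pos by linarith
  then show ?thesis
  proof -
    have "width * exp (x / 2) \<le> 50 * width * exp (x / 2)" using width(1) by (intro mult_right_mono) auto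
    with profile_bound_far_left[OF True, of y] \<open>\<bar>x\<bar> = - x\<close> show ?thesis by simp
  qed
next
  case False
  then have x: "- ln 2 \<le> x" by simp
  \<comment> \<open>This period contains both zeros of the sine, \<open>- pi\<close> and 0, in its
    interior, so each is treated on a full neighbourhood.\<close>
  obtain k :: int where k: "- (5 * pi / 4) \<le> y + 2 * pi * of_int k" "y + 2 * pi * of_int k < - (5 * pi / 4) + 2 * pi"
    using exists_period_shift by blast
  let ?y = "y + 2 * pi * of_int k"
  have "profile x ?y \<le> 50 * width * exp (- \<bar>x\<bar> / 2)"
  proof (cases "?y \<le> - (3 * pi / 4)")
    case True
    then show ?thesis using profile_bound_near_pi k x by blast
  next
    case nle: False
    show ?thesis
    proof (cases "\<bar>?y\<bar> \<le> width")
      case True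
      then show ?thesis using profile_bound_near_0 x by blast
    next
      case far: False
      have "sin width \<le> sin \<bar>?y\<bar>"
      proof (cases "\<bar>?y\<bar> \<le> pi / 2")
        case True
        then show ?thesis using far width pi_gt_zero by (intro sin_monotone_2pi_le) auto
      next
        case False
        have "sin width \<le> sin (pi - \<bar>?y\<bar>)"
        proof (rule sin_monotone_2pi_le)
          have "\<bar>?y\<bar> \<le> 3 * pi / 4" using nle k by linarith
          then show "width \<le> pi - \<bar>?y\<bar>" using width(2) pi_ge_two by linarith
          show "- (pi / 2) \<le> width" using width(1) pi_gt_zero by linarith
        qed (use False in simp)
        then show ?thesis by simp
      qed
      moreover have "sin \<bar>t\<bar> \<le> \<bar>sin t\<bar>" for t :: real by (cases "t < 0") auto
      ultimately have "width / 2 \<le> \<bar>sin ?y\<bar>" using sin_width by (meson order_trans)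
      then have "profile x ?y \<le> 4 * width * exp (- x / 2)" by (rule profile_bound_case_away)
      also have "\<dots> \<le> 5 * width * exp (- x / 2)" using width(1) by simp
      finally show ?thesis using x by (intro profile_bound_from_decay)
    qed
  qed
  then show ?thesis by (simp only: profile_periodic_int)
qed

text \<open>The radius \<open>width / 4\<close> is chosen so that the quadratic remainder satisfies
  \<open>N * 2 * (width / 4)\<^sup>2 = 1 / 8\<close>; the exponent of the integrand then stays below
  1/4.\<close>

lemma integrand_near_0:
  assumes w: "cmod w \<le> width / 4"
  shows "cmod (integrand w - 1) \<le> 1 / 2" "- (1 / 8) \<le> height (Re w) (Im w)"
proof -
  have w16: "cmod w \<le> 1 / 16" using w width(2) by simp
  have "cmod (exp w - 1 - w) \<le> 2 * (cmod w)\<^sup>2" using w16 by (intro cmod_exp_minus_1_minus_le) simp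
  also have "\<dots> \<le> 2 * (width / 4)\<^sup>2" using w by (intro mult_left_mono power_mono) auto
  finally have "N * cmod (exp w - 1 - w) \<le> N * (2 * (width / 4)\<^sup>2)" using N_pos by (intro mult_left_mono) auto
  also have "\<dots> = 1 / 8" using width(3) by (simp add: power_divide)
  finally have P: "N * cmod (exp w - 1 - w) \<le> 1 / 8" .
  define u where "u = w / 2 - \<i> * of_real N * (exp w - 1 - w)"
  have "cmod u \<le> cmod (w / 2) + cmod (\<i> * of_real N * (exp w - 1 - w))"
    unfolding u_def by (rule norm_triangle_ineq4)
  also have "\<dots> \<le> 1 / 32 + 1 / 8" using w16 P N_pos by (simp add: norm_mult norm_divide)
  finally have u: "cmod u \<le> 1 / 4" by simp
  have "cmod (exp u - 1) \<le> 2 * cmod u" using u by (intro cmod_exp_minus_1_le) simp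
  then show "cmod (integrand w - 1) \<le> 1 / 2" using u unfolding integrand_def u_def by linarith
  have "height (Re w) (Im w) = - Im (of_real N * (exp w - 1 - w))"
    by (simp add: height_def Im_exp algebra_simps)
  moreover have "\<bar>Im (of_real N * (exp w - 1 - w))\<bar> \<le> 1 / 8"
    using abs_Im_le_cmod[of "of_real N * (exp w - 1 - w)"] P N_pos by (simp add: norm_mult)
  ultimately show "- (1 / 8) \<le> height (Re w) (Im w)" by linarith
qed

text \<open>The value of \<open>osc\<close> at 0 is unknown, so two opposite points are compared.
  The derivative of \<open>primitive\<close> is within 1/2 of 1 there, which forces
  \<open>osc\<close> to differ by at least \<open>\<delta>\<close> between \<open>w\<close> and
  \<open>- w\<close>; one of the two values is then at least \<open>\<delta> / 2\<close>.\<close>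

proposition profile_large: "\<exists>w. cmod w \<le> 1 \<and> width / 16 \<le> profile (Re w) (Im w)"
proof -
  define \<delta> where "\<delta> = width / 4"
  \<comment> \<open>This direction makes \<open>2 * w * cnj phase\<close> purely imaginary, so the
    whole increment is seen by \<open>osc\<close>.\<close>
  define w where "w = \<i> * of_real \<delta> * phase"
  have \<delta>: "0 < \<delta>" "\<delta> \<le> 1" using width by (auto simp: \<delta>_def)
  have w: "cmod w = \<delta>" using \<delta> by (simp add: w_def norm_mult)
  have "cmod ((primitive w - w) - (primitive (- w) - - w)) \<le> 1 / 2 * cmod (w - - w)"
  proof (rule field_differentiable_bound[of "cball 0 \<delta>" _ "\<lambda>z. integrand z - 1"])
    show "((\<lambda>z. primitive z - z) has_field_derivative integrand z - 1) (at z within cball 0 \<delta>)" for z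
      by (intro derivative_intros primitive_deriv)
    show "cmod (integrand z - 1) \<le> 1 / 2" if "z \<in> cball 0 \<delta>" for z
      using that by (intro integrand_near_0) (simp add: \<delta>_def)
  qed (use w in auto)
  also have "cmod (w - - w) = 2 * \<delta>" using w by (simp flip: mult_2 add: norm_mult)
  finally have diff: "cmod (primitive w - primitive (- w) - 2 * w) \<le> \<delta>" by (simp add: algebra_simps)
  have "2 * w * cnj phase = of_real (2 * \<delta>) * \<i>"
    by (simp add: w_def mult_cnj_self mult.assoc)
  then have "Im (2 * w * cnj phase) = Im (of_real (2 * \<delta>) * \<i>)" by (rule arg_cong)
  also have "\<dots> = 2 * \<delta>" by simp
  finally have "Im (2 * w * cnj phase) = 2 * \<delta>" .
  then have "osc w - osc (- w) - 2 * \<delta> = Im ((primitive w - primitive (- w) - 2 * w) * cnj phase)"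
    by (simp only: osc_def left_diff_distrib minus_complex.sel)
  then have "\<bar>osc w - osc (- w) - 2 * \<delta>\<bar> \<le> \<delta>"
    using abs_Im_le_cmod[of "(primitive w - primitive (- w) - 2 * w) * cnj phase"] diff
    by (simp add: norm_mult)
  then have "\<delta> / 2 \<le> \<bar>osc w\<bar> \<or> \<delta> / 2 \<le> \<bar>osc (- w)\<bar>" by linarith
  then obtain v where v: "\<delta> / 2 \<le> \<bar>osc v\<bar>" "cmod v = \<delta>" using w by (metis norm_minus_cancel)
  have "1 / 2 \<le> exp (height (Re v) (Im v))"
  proof -
    have "- (1 / 8) \<le> height (Re v) (Im v)" using v(2) by (intro integrand_near_0(2)) (simp add: \<delta>_def)
    then show ?thesis using exp_ge_add_one_self[of "height (Re v) (Im v)"] by linarith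
  qed
  then have "\<delta> / 2 * (1 / 2) \<le> \<bar>osc v\<bar> * exp (height (Re v) (Im v))"
    using v \<delta> by (intro mult_mono) auto
  then have "width / 16 \<le> profile (Re v) (Im v)" by (simp add: profile_def \<delta>_def)
  then show ?thesis using v \<delta> by auto
qed

end

section \<open>Harmonic functions and the weight\<close>

lemma wirtinger_of_has_derivative:
  assumes "(f has_derivative (\<lambda>u. a * u + b * cnj u)) (at z)"
  shows "wirtinger_dz f z = a" "wirtinger_dzbar f z = b"
proof -
  have "frechet_derivative f (at z) = (\<lambda>u. a * u + b * cnj u)"
    using frechet_derivative_at[OF assms] by simp
  then show "wirtinger_dz f z = a" "wirtinger_dzbar f z = b"
    by (simp_all add: wirtinger_dz_def wirtinger_dzbar_def algebra_simps)
qed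

text \<open>The class of such sums is stable under both Wirtinger derivatives, so second order
  smoothness follows from \<open>C1_plane\<close> for the same class.\<close>

definition harmonic_pair :: "(complex \<Rightarrow> complex) \<Rightarrow> (complex \<Rightarrow> complex) \<Rightarrow> complex \<Rightarrow> complex" where
  "harmonic_pair G H z = G z + cnj (H z)"

context
  fixes G H :: "complex \<Rightarrow> complex"
  assumes G: "G holomorphic_on UNIV" and H: "H holomorphic_on UNIV"
begin

lemma harmonic_pair_has_derivative:
  "(harmonic_pair G H has_derivative (\<lambda>u. deriv G z * u + cnj (deriv H z) * cnj u)) (at z)"
proof -
  have "(G has_derivative (*) (deriv G z)) (at z)" "(H has_derivative (*) (deriv H z)) (at z)"
    using holomorphic_derivI[OF G open_UNIV, of z] holomorphic_derivI[OF H open_UNIV, of z]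
    by (simp_all add: has_field_derivative_def)
  then have "((\<lambda>z. G z + cnj (H z)) has_derivative (\<lambda>u. deriv G z * u + cnj (deriv H z * u))) (at z)"
    by (intro derivative_intros)
  then show ?thesis by (simp add: harmonic_pair_def[abs_def])
qed

lemma wirtinger_harmonic_pair:
  "wirtinger_dz (harmonic_pair G H) = harmonic_pair (deriv G) (\<lambda>_. 0)" "wirtinger_dzbar (harmonic_pair G H) = harmonic_pair (\<lambda>_. 0) (deriv H)"
  using wirtinger_of_has_derivative[OF harmonic_pair_has_derivative] by (auto simp: harmonic_pair_def)

lemma C1_plane_harmonic_pair: "C1_plane (harmonic_pair G H)"
proof -
  have "continuous_on UNIV (deriv G)" "continuous_on UNIV (deriv H)"
    using holomorphic_deriv[OF G] holomorphic_deriv[OF H] holomorphic_on_imp_continuous_on by auto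
  then show ?thesis
    unfolding C1_plane_def wirtinger_harmonic_pair using harmonic_pair_has_derivative
    by (auto simp: harmonic_pair_def[abs_def] differentiable_def intro!: continuous_intros)
qed

end

lemma pluriharmonic_harmonic_pair:
  assumes G: "G holomorphic_on UNIV" and H: "H holomorphic_on UNIV"
  shows "pluriharmonic (harmonic_pair G H)"
proof -
  note hol = holomorphic_deriv[OF G open_UNIV] holomorphic_deriv[OF H open_UNIV] holomorphic_on_const[of 0 UNIV]
  show ?thesis
    unfolding pluriharmonic_def C2_plane_def wirtinger_harmonic_pair[OF G H]
    by (simp add: C1_plane_harmonic_pair G H hol wirtinger_harmonic_pair) (simp add: harmonic_pair_def)
qed

lemma pluriharmonic_Im:
  assumes "G holomorphic_on UNIV"
  shows "pluriharmonic (\<lambda>z. of_real (Im (G z)))"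
proof -
  have "(\<lambda>z. of_real (Im (G z))) = harmonic_pair (\<lambda>z. G z / (2 * \<i>)) (\<lambda>z. G z / (2 * \<i>))"
    by (rule ext) (simp add: harmonic_pair_def complex_eq_iff)
  then show ?thesis using assms by (simp add: pluriharmonic_harmonic_pair holomorphic_intros)
qed

lemma ext_deriv_of_has_derivative:
  assumes "\<And>v. ((\<lambda>w. \<omega> w v) has_derivative D v) (at z)"
  shows "ext_deriv \<omega> z u v = D v u - D u v"
  using frechet_derivative_at[OF assms] by (simp add: ext_deriv_def)

text \<open>The parameters cover both sides of the required identity: \<open>s = 1 / 2\<close> with
  the actual \<open>q\<close>, and \<open>s = 1\<close> with \<open>q = 0\<close>. Second
  derivatives of \<open>q\<close> enter only through terms symmetric in \<open>u\<close> and
  \<open>v\<close>, which the exterior derivative cancels.\<close>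

lemma ddc_weight:
  assumes q: "q holomorphic_on UNIV"
  shows "ddc (\<lambda>w. of_real (s * (cmod w)\<^sup>2 + Re (q w))) z u v = \<i> / 2 * of_real s * (u * cnj v - cnj u * v)"
proof -
  let ?f = "\<lambda>w. complex_of_real (s * (cmod w)\<^sup>2 + Re (q w))"
  have f: "?f w = of_real s * (w * cnj w) + (q w + cnj (q w)) / 2" for w
    by (simp add: complex_add_cnj mult_cnj_self)
  have dq: "(h has_derivative (*) (deriv h w)) (at w)" if "h holomorphic_on UNIV" for h :: "complex \<Rightarrow> complex" and w
    using holomorphic_derivI[OF that open_UNIV, of w] by (simp add: has_field_derivative_def)
  have "(?f has_derivative (\<lambda>t. (of_real s * cnj w + deriv q w / 2) * t + (of_real s * w + cnj (deriv q w) / 2) * cnj t)) (at w)" for w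
    unfolding f
    by (rule has_derivative_eq_rhs) (rule derivative_intros dq[OF q] | simp add: algebra_simps add_divide_distrib)+
  note w = wirtinger_of_has_derivative[OF this]
  have dc: "dc_form ?f w t = \<i> / 4 * ((of_real s * w + cnj (deriv q w) / 2) * cnj t - (of_real s * cnj w + deriv q w / 2) * t)" for w t
    unfolding dc_form_def delbar_form_def del_form_def w ..
  have q': "deriv q holomorphic_on UNIV" using q by (rule holomorphic_deriv) simp
  have "((\<lambda>w. dc_form ?f w t) has_derivative
      (\<lambda>r. \<i> / 4 * ((of_real s * r + cnj (deriv (deriv q) z * r) / 2) * cnj t - (of_real s * cnj r + (deriv (deriv q) z * r) / 2) * t))) (at z)" for t
    unfolding dc by (rule has_derivative_eq_rhs) (rule derivative_intros dq[OF q'] | simp)+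
  then have "ext_deriv (dc_form ?f) z u v
    = \<i> / 4 * ((of_real s * u + cnj (deriv (deriv q) z * u) / 2) * cnj v - (of_real s * cnj u + (deriv (deriv q) z * u) / 2) * v)
    - \<i> / 4 * ((of_real s * v + cnj (deriv (deriv q) z * v) / 2) * cnj u - (of_real s * cnj v + (deriv (deriv q) z * v) / 2) * u)"
    by (rule ext_deriv_of_has_derivative)
  then show ?thesis unfolding ddc_def by (simp add: algebra_simps add_divide_distrib diff_divide_distrib)
qed

section \<open>Unbounded point evaluations\<close>

lemma integrable_exp_abs: "integrable lborel (\<lambda>x::real. exp (- \<bar>x\<bar>))"
proof -
  have "(\<integral>\<^sup>+x. ennreal (indicator {0..} x *\<^sub>R exp (- \<bar>x\<bar>)) \<partial>lborel) = (\<integral>\<^sup>+x. ennreal (x ^ 0 * exp (- x)) * indicator {0..} x \<partial>lborel)"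
    by (intro nn_integral_cong) (auto simp: indicator_def)
  also have "\<dots> = ennreal 1"
    using nn_intergal_power_times_exp_Ici[of 0] by simp
  finally have "has_bochner_integral lborel (\<lambda>x::real. indicator {0..} x *\<^sub>R exp (- \<bar>x\<bar>)) 1"
    by (intro has_bochner_integral_nn_integral) auto
  from has_bochner_integral_even_function[OF this] show ?thesis
    by (auto simp: has_bochner_integral_iff)
qed

text \<open>Off these countably many lines \<open>profile_bound_away\<close> gives decay of order
  \<open>1 / N\<close>, the pointwise half of the dominated convergence argument.\<close>

lemma AE_sin_Im_nonzero: "AE z in lborel. sin (Im z) \<noteq> 0"
proof -
  have line: "AE z in lborel. Im z \<noteq> c" for c
  proof -
    have "negligible {z::complex. z \<bullet> \<i> = c}"
      by (rule negligible_standard_hyperplane) (simp add: Basis_complex_def)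
    then have "{z. Im z = c} \<in> null_sets lebesgue" by (simp add: negligible_iff_null_sets)
    moreover have "{z. Im z = c} \<in> sets borel"
      by (intro borel_closed closed_Collect_eq continuous_intros)
    ultimately have "{z. Im z = c} \<in> null_sets lborel"
      by (simp add: null_sets_def)
    then show ?thesis by (rule AE_I') auto
  qed
  have "AE z in lborel. \<forall>k::int. Im z \<noteq> of_int k * pi"
    unfolding AE_all_countable using line by blast
  then show ?thesis
    by (rule AE_mp) (auto simp: sin_zero_iff_int2 intro!: AE_I2)
qed

context saddle
begin

lemma profile_measurable [measurable]: "(\<lambda>z. profile (Re z) (Im z)) \<in> borel_measurable borel"
proof (rule borel_measurable_continuous_onI)
  have "continuous_on UNIV primitive"
    by (rule holomorphic_on_imp_continuous_on[OF primitive_holomorphic])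
  then show "continuous_on UNIV (\<lambda>z. profile (Re z) (Im z))"
    unfolding profile_def osc_def height_def complex_surj by (intro continuous_intros)
qed

text \<open>The squared norm of the test function below, up to the constant
  \<open>exp (- N\<^sup>2 / 2)\<close> (\<open>test_fun_L2\<close>).\<close>

definition energy :: real where
  "energy = (LINT z|lborel. (profile (Re z) (Im z))\<^sup>2 * exp (- 2 * (Im z)\<^sup>2))"

text \<open>2500 is the square of the constant in \<open>profile_bound\<close>; the majorant is the
  same for all \<open>N\<close>.\<close>

lemma dominating_integrable:
  "integrable lborel (\<lambda>z. 2500 * (exp (- \<bar>Re z\<bar>) * exp (- 2 * (Im z)\<^sup>2)))"
  using integrable_Re_Im[OF integrable_exp_abs _ integrable_gaussian[of 2]]
  by (intro integrable_mult_right) auto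

lemma scaled_profile_le:
  "(profile x y / width)\<^sup>2 * exp (- 2 * y\<^sup>2) \<le> 2500 * (exp (- \<bar>x\<bar>) * exp (- 2 * y\<^sup>2))"
proof -
  have "profile x y / width \<le> 50 * exp (- \<bar>x\<bar> / 2)"
    using profile_bound[of x y] width(1) by (simp add: field_simps)
  then have "(profile x y / width)\<^sup>2 \<le> (50 * exp (- \<bar>x\<bar> / 2))\<^sup>2"
    using width(1) by (intro power_mono) auto
  also have "\<dots> = 2500 * exp (- \<bar>x\<bar>)"
    by (simp add: power_mult_distrib exp_double[symmetric])
  finally show ?thesis by (simp add: mult_right_mono mult.assoc[symmetric])
qed

lemma integrable_energy: "integrable lborel (\<lambda>z. (profile (Re z) (Im z))\<^sup>2 * exp (- 2 * (Im z)\<^sup>2))"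
proof -
  have "integrable lborel (\<lambda>z. (profile (Re z) (Im z) / width)\<^sup>2 * exp (- 2 * (Im z)\<^sup>2))"
    by (rule Bochner_Integration.integrable_bound[OF dominating_integrable])
      (auto simp: scaled_profile_le[simplified])
  then have "integrable lborel (\<lambda>z. width\<^sup>2 * ((profile (Re z) (Im z) / width)\<^sup>2 * exp (- 2 * (Im z)\<^sup>2)))"
    by (rule integrable_mult_right)
  then show ?thesis using width(1) by (simp add: power_divide)
qed

end

text \<open>Special values of \<open>N\<close>, for which the saddle point lies over the centre of the Gaussian factor.\<close>

definition N_seq :: "nat \<Rightarrow> real" where
  "N_seq j = (4 * real j + 7) * pi"

lemma N_seq_ge: "16 \<le> N_seq j" "7 * real j \<le> N_seq j"
proof -
  have "3 \<le> pi" using pi_approx by simp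
  then have "(4 * real j + 7) * 3 \<le> N_seq j" unfolding N_seq_def by (intro mult_left_mono) auto
  then show "16 \<le> N_seq j" "7 * real j \<le> N_seq j" by auto
qed

interpretation S: saddle "N_seq j" for j
  by unfold_locales (rule N_seq_ge)

lemma width_seq_tendsto: "(\<lambda>j. S.width j) \<longlonglongrightarrow> 0"
proof -
  have "filterlim N_seq at_top sequentially"
    unfolding N_seq_def by real_asymp
  then have "((\<lambda>j. 1 / sqrt (N_seq j)) \<longlongrightarrow> 0) sequentially"
    by (intro tendsto_divide_0[OF tendsto_const] filterlim_at_top_imp_at_infinity
        filterlim_compose[OF sqrt_at_top])
  then show ?thesis by (simp add: S.width_def)
qed

text \<open>\<open>profile_bound\<close> dominates \<open>profile / width\<close> uniformly, while
  for fixed \<open>z\<close> with \<open>sin (Im z) \<noteq> 0\<close> the quotient is at most a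
  constant times \<open>width\<close>. So the energy is of smaller order than
  \<open>width\<^sup>2\<close>, the order of the largest squared value.\<close>

lemma scaled_energy_tendsto: "(\<lambda>j. S.energy j / (S.width j)\<^sup>2) \<longlonglongrightarrow> 0"
proof -
  let ?w = "\<lambda>j. S.width j"
  let ?s = "\<lambda>j z. (S.profile j (Re z) (Im z) / ?w j)\<^sup>2 * exp (- 2 * (Im z)\<^sup>2)"
  have "(\<lambda>j. LINT z|lborel. ?s j z) \<longlonglongrightarrow> integral\<^sup>L (lborel :: complex measure) (\<lambda>_. 0 :: real)"
  proof (rule integral_dominated_convergence[where f = "\<lambda>_::complex. 0::real" and s = ?s])
    show "integrable lborel (\<lambda>z. 2500 * (exp (- \<bar>Re z\<bar>) * exp (- 2 * (Im z)\<^sup>2)))"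
      by (rule S.dominating_integrable)
    show "AE z in lborel. norm (?s j z) \<le> 2500 * (exp (- \<bar>Re z\<bar>) * exp (- 2 * (Im z)\<^sup>2))" for j
      using S.scaled_profile_le[of j] by (intro AE_I2) simp
    show "AE z in lborel. (\<lambda>j. ?s j z) \<longlonglongrightarrow> 0"
      using AE_sin_Im_nonzero
    proof (rule AE_mp, intro AE_I2 impI)
      fix z assume z: "sin (Im z) \<noteq> 0"
      let ?c = "2 * exp (- Re z / 2) / \<bar>sin (Im z)\<bar>"
      have le: "S.profile j (Re z) (Im z) / ?w j \<le> ?c * ?w j" for j
      proof -
        have "S.profile j (Re z) (Im z) \<le> ?c * (1 / N_seq j)"
          using S.profile_bound_away[OF z, of j "Re z"] by (simp add: mult.commute)
        also have "\<dots> = ?c * ?w j * ?w j" by (simp only: S.width(4) mult.assoc)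
        finally show ?thesis using S.width(1)[of j] by (simp add: pos_divide_le_eq)
      qed
      have "(\<lambda>j. ?c * ?w j) \<longlonglongrightarrow> ?c * 0" by (intro tendsto_mult tendsto_const width_seq_tendsto)
      then have "(\<lambda>j. S.profile j (Re z) (Im z) / ?w j) \<longlonglongrightarrow> 0"
        by (intro squeeze_0[OF _ le]) (use S.width(1) less_imp_le in \<open>auto simp: less_imp_le\<close>)
      then have "(\<lambda>j. ?s j z) \<longlonglongrightarrow> 0\<^sup>2 * exp (- 2 * (Im z)\<^sup>2)"
        by (intro tendsto_mult tendsto_power tendsto_const)
      then show "(\<lambda>j. ?s j z) \<longlonglongrightarrow> 0" by simp
    qed
  qed auto
  moreover have "(LINT z|lborel. ?s j z) = S.energy j / (?w j)\<^sup>2" for j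
    unfolding S.energy_def by (simp add: power_divide)
  ultimately show ?thesis by simp
qed

section \<open>The concrete weight and the harmonic test functions\<close>

definition exponent :: "complex \<Rightarrow> complex" where
  "exponent z = - exp z - z\<^sup>2 / 2"

definition weight :: "complex \<Rightarrow> real" where
  "weight = (\<lambda>z. (cmod z)\<^sup>2 / 2 + Re (exponent z))"

lemma exponent_holomorphic: "exponent holomorphic_on UNIV"
  unfolding exponent_def[abs_def] by (intro holomorphic_intros) auto

interpretation model: fock exponent weight
  by unfold_locales (rule exponent_holomorphic, rule weight_def)

lemma weight_eq: "weight z = (Im z)\<^sup>2 - exp (Re z) * cos (Im z)"
  unfolding weight_def cmod_power2 by (simp add: exponent_def power2_eq_square Re_exp field_simps)

definition centre :: "nat \<Rightarrow> complex" where
  "centre j = Complex (ln (N_seq j)) (- N_seq j / 2)"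

text \<open>The centre is a saddle point, \<open>exp (centre j) = \<i> N\<close>, and its imaginary
  part is \<open>- N / 2\<close>: expanding \<open>- 2 * (Im w - N / 2)\<^sup>2\<close> produces the
  linear term \<open>2 * N * Im w\<close> of the doubled \<open>height\<close> and leaves a Gaussian
  centred at 0.\<close>

lemma weight_centre:
  "exp (- 2 * weight (centre j + w))
    = exp (- (N_seq j)\<^sup>2 / 2) * ((exp (S.height j (Re w) (Im w)))\<^sup>2 * exp (- 2 * (Im w)\<^sup>2))"
proof -
  let ?N = "N_seq j"
  \<comment> \<open>Here the form of \<open>N_seq\<close> enters: odd multiples of pi congruent to 3
    pi modulo 4 pi make \<open>- N / 2\<close> equal to \<open>pi / 2\<close> modulo
    \<open>2 * pi\<close>. Among these, \<open>7 * pi\<close> is the first value above 16.\<close>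
  have "- ?N / 2 + Im w = (Im w + pi / 2) + 2 * pi * of_int (- int j - 2)"
    by (simp add: N_seq_def field_simps)
  then have "cos (- ?N / 2 + Im w) = cos (Im w + pi / 2)"
    by (simp only: cos_period_int)
  then have "cos (- ?N / 2 + Im w) = - sin (Im w)" by (simp add: cos_add)
  moreover have "exp (ln ?N + Re w) = ?N * exp (Re w)"
    using S.N_pos[of j] by (simp add: exp_add)
  ultimately have "- 2 * weight (centre j + w) = - ?N\<^sup>2 / 2 + (2 * S.height j (Re w) (Im w) + - 2 * (Im w)\<^sup>2)"
    by (simp add: weight_eq centre_def S.height_def power2_eq_square algebra_simps)
  then show ?thesis by (simp only: exp_add exp_double)
qed

definition test_fun :: "nat \<Rightarrow> complex \<Rightarrow> complex" where
  "test_fun j z = of_real (S.osc j (z - centre j))"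

lemma test_fun_weighted:
  "(cmod (test_fun j (centre j + w)))\<^sup>2 * exp (- 2 * weight (centre j + w))
    = exp (- (N_seq j)\<^sup>2 / 2) * ((S.profile j (Re w) (Im w))\<^sup>2 * exp (- 2 * (Im w)\<^sup>2))"
  unfolding weight_centre by (simp add: test_fun_def S.profile_def power_mult_distrib)

lemma test_fun_pluriharmonic: "pluriharmonic (test_fun j)"
proof -
  have "(\<lambda>z. S.primitive j (z - centre j) * cnj (S.phase j)) holomorphic_on UNIV"
    by (intro holomorphic_intros holomorphic_on_compose_gen[of "\<lambda>z. z - centre j" UNIV _ UNIV, unfolded o_def]
        S.primitive_holomorphic) auto
  from pluriharmonic_Im[OF this] show ?thesis
    by (simp add: test_fun_def[abs_def] S.osc_def)
qed

lemma test_fun_measurable [measurable]: "test_fun j \<in> borel_measurable borel"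
proof -
  have "continuous_on UNIV (\<lambda>z. S.primitive j (z - centre j))"
    by (rule continuous_on_compose2[OF holomorphic_on_imp_continuous_on[OF S.primitive_holomorphic]])
      (auto intro: continuous_intros)
  then show ?thesis
    unfolding test_fun_def[abs_def] S.osc_def
    by (intro borel_measurable_continuous_onI continuous_on_of_real continuous_on_Im continuous_on_mult
        continuous_on_const)
qed

lemma test_fun_L2:
  "integrable lborel (\<lambda>z. (cmod (test_fun j z))\<^sup>2 * exp (- 2 * weight z))" (is "integrable _ ?h")
  "(LINT z|lborel. (cmod (test_fun j z))\<^sup>2 * exp (- 2 * weight z)) = exp (- (N_seq j)\<^sup>2 / 2) * S.energy j"
proof -
  have shifted: "integrable lborel (\<lambda>w. ?h (centre j + w))"
    unfolding test_fun_weighted by (intro integrable_mult_right S.integrable_energy)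
  from integrable_translation[OF this, of "- centre j"] show "integrable lborel ?h" by simp
  have "(LINT z|lborel. ?h z) = (LINT w|lborel. ?h (centre j + w))"
    by (rule integral_translation[symmetric]) measurable
  also have "\<dots> = exp (- (N_seq j)\<^sup>2 / 2) * S.energy j"
    unfolding test_fun_weighted S.energy_def by (rule integral_mult_right_zero)
  finally show "(LINT z|lborel. ?h z) = exp (- (N_seq j)\<^sup>2 / 2) * S.energy j" .
qed

lemma test_fun_in_PH: "test_fun j \<in> PH_space weight"
  unfolding PH_space_def weighted_L2_def using test_fun_pluriharmonic test_fun_L2(1) by auto

proposition evaluations_unbounded:
  "\<exists>f\<in>PH_space weight. \<exists>a. M * (L2_norm weight f)\<^sup>2 < (cmod (f a))\<^sup>2 * exp (- 2 * weight a)"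
proof -
  define M' where "M' = max M 1"
  have M': "0 < M'" "M \<le> M'" by (auto simp: M'_def)
  \<comment> \<open>256 is the square of the 16 in \<open>S.profile_large\<close>, and
    \<open>exp (- 2)\<close> bounds the Gaussian factor from below at a point with
    \<open>\<bar>Im v\<bar> \<le> 1\<close>.\<close>
  have "0 < exp (- 2) / 256 / M'" using M' by simp
  then obtain j where j: "S.energy j / (S.width j)\<^sup>2 < exp (- 2) / 256 / M'"
    using order_tendstoD(2)[OF scaled_energy_tendsto] by (auto simp: eventually_sequentially)
  let ?N = "N_seq j" and ?w = "S.width j" and ?K = "exp (- (N_seq j)\<^sup>2 / 2)"
  have w: "0 < ?w\<^sup>2" using S.width(1)[of j] by simp
  obtain v where v: "cmod v \<le> 1" "?w / 16 \<le> S.profile j (Re v) (Im v)"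
    using S.profile_large by blast
  have norm: "(L2_norm weight (test_fun j))\<^sup>2 = ?K * S.energy j"
    unfolding L2_norm_def test_fun_L2(2)[symmetric] by simp
  have "S.energy j < exp (- 2) / 256 / M' * ?w\<^sup>2"
    using j w by (simp only: pos_divide_less_eq)
  then have lt: "M' * S.energy j < ?w\<^sup>2 / 256 * exp (- 2)"
    using M' by (simp add: field_simps)
  have "\<bar>Im v\<bar> \<le> 1" using abs_Im_le_cmod[of v] v(1) by simp
  then have "(Im v)\<^sup>2 \<le> 1" by (simp add: abs_square_le_1)
  then have "exp (- 2) \<le> exp (- 2 * (Im v)\<^sup>2)" by simp
  moreover have "?w\<^sup>2 / 256 \<le> (S.profile j (Re v) (Im v))\<^sup>2"
    using power_mono[OF v(2), of 2] S.width(1)[of j] by (simp add: power_divide)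
  ultimately have "?w\<^sup>2 / 256 * exp (- 2) \<le> (S.profile j (Re v) (Im v))\<^sup>2 * exp (- 2 * (Im v)\<^sup>2)"
    by (intro mult_mono) auto
  with lt have "?K * (M' * S.energy j) < ?K * ((S.profile j (Re v) (Im v))\<^sup>2 * exp (- 2 * (Im v)\<^sup>2))"
    by simp
  then have "M' * (L2_norm weight (test_fun j))\<^sup>2
      < (cmod (test_fun j (centre j + v)))\<^sup>2 * exp (- 2 * weight (centre j + v))"
    unfolding test_fun_weighted norm by (simp add: mult.left_commute)
  moreover have "M * (L2_norm weight (test_fun j))\<^sup>2 \<le> M' * (L2_norm weight (test_fun j))\<^sup>2"
    using M' by (intro mult_right_mono) auto
  ultimately show ?thesis using test_fun_in_PH by (meson order_le_less_trans)
qed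

text \<open>A mass \<open>2\<^sup>-\<^sup>n\<close> at the \<open>n\<close>-th point is defeated by a function whose squared value there exceeds
  \<open>4\<^sup>n\<close> times its squared norm.\<close>

lemma PH_form_unbounded: "\<exists>a. \<not> q_form_bounded (atoms a) weight (PH_space weight)"
proof -
  have "\<forall>n::nat. \<exists>a. \<exists>f\<in>PH_space weight. 4 ^ n * (L2_norm weight f)\<^sup>2 < (cmod (f a))\<^sup>2 * exp (- 2 * weight a)"
    using evaluations_unbounded by blast
  then obtain a f where f: "\<And>n. f n \<in> PH_space weight"
    and big: "\<And>n::nat. 4 ^ n * (L2_norm weight (f n))\<^sup>2 < (cmod (f n (a n)))\<^sup>2 * exp (- 2 * weight (a n))"
    by metis
  have "\<not> q_form_bounded (atoms a) weight (PH_space weight)"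
  proof
    assume bdd: "q_form_bounded (atoms a) weight (PH_space weight)"
    then obtain C where C: "\<And>f. f \<in> PH_space weight \<Longrightarrow>
        cmod (q_form (atoms a) weight f f) \<le> C * L2_norm weight f * L2_norm weight f"
      unfolding q_form_bounded_def by blast
    obtain n where n: "C < 2 ^ n" using real_arch_pow[of 2 C] by auto
    let ?f = "f n" and ?g = "\<lambda>z. (cmod (f n z))\<^sup>2 * exp (- 2 * weight z)"
    let ?G = "\<lambda>z. f n z * cnj (f n z) * of_real (exp (- 2 * weight z))"
    have G: "?G = (\<lambda>z. of_real (?g z))" by (simp add: mult_cnj_self)
    have [measurable]: "?f \<in> borel_measurable borel"
      using f[of n] by (auto simp: PH_space_def weighted_L2_def)
    have meas: "?g \<in> borel_measurable borel" by measurable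
    have "integrable (atoms a) ?G"
      using bdd f unfolding q_form_bounded_def by blast
    then have int: "integrable (atoms a) ?g" unfolding G by (simp only: complex_of_real_integrable_eq)
    have sums: "(\<lambda>k. (1 / 2) ^ k *\<^sub>R ?g (a k)) sums (LINT z|atoms a. ?g z)"
      by (rule integral_atoms[OF meas int])
    have le: "(1 / 2) ^ n *\<^sub>R ?g (a n) \<le> (LINT z|atoms a. ?g z)"
      using sum_le_suminf[OF sums_summable[OF sums], of "{n}"] sums_unique[OF sums] by simp
    have "q_form (atoms a) weight ?f ?f = of_real (LINT z|atoms a. ?g z)"
      unfolding q_form_def G by (rule integral_complex_of_real)
    then have "(LINT z|atoms a. ?g z) \<le> C * (L2_norm weight ?f)\<^sup>2"
      using C[OF f[of n]] by (simp add: power2_eq_square mult.assoc)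
    also have "\<dots> \<le> 2 ^ n * (L2_norm weight ?f)\<^sup>2" using n by (intro mult_right_mono) auto
    also have "\<dots> = (1 / 2) ^ n * (4 ^ n * (L2_norm weight ?f)\<^sup>2)"
      by (simp flip: mult.assoc power_mult_distrib)
    also have "\<dots> < (1 / 2) ^ n *\<^sub>R ?g (a n)"
      using big[of n] by (simp only: real_scaleR_def) (intro mult_strict_left_mono, auto)
    finally show False using le by simp
  qed
  then show ?thesis by blast
qed

theorem proposition1p4:
  shows "\<exists>(q :: complex \<Rightarrow> complex) (\<mu> :: complex measure) (\<phi> :: complex \<Rightarrow> real).
    q holomorphic_on UNIV \<and>
    finite_measure \<mu> \<and> discrete_measure \<mu> \<and>
    \<phi> = (\<lambda>z. (cmod z)\<^sup>2 / 2 + Re (q z)) \<and>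
    (\<forall>z u v. ddc (\<lambda>w. complex_of_real (\<phi> w)) z u v
              = 1 / 2 * ddc (\<lambda>w. complex_of_real ((cmod w)\<^sup>2)) z u v) \<and>
    (\<forall>p r :: real. 0 < p \<longrightarrow> 0 < r \<longrightarrow> in_Lp p (\<lambda>z. measure \<mu> (ball z r))) \<and>
    q_form_bounded \<mu> \<phi> (fock_space \<phi>) \<and>
    (\<forall>p :: real. 0 < p \<longrightarrow> toeplitz \<mu> \<phi> \<in> schatten_class p \<phi> (fock_space \<phi>)) \<and>
    \<not> q_form_bounded \<mu> \<phi> (PH_space \<phi>)"
proof -
  obtain a where unbounded: "\<not> q_form_bounded (atoms a) weight (PH_space weight)"
    using PH_form_unbounded by blast
  interpret fock_atoms exponent weight a ..
  have eq: "ddc (\<lambda>w. complex_of_real (weight w)) z u v = \<i> / 2 * of_real (1 / 2) * (u * cnj v - cnj u * v)" for z u v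
    using ddc_weight[OF exponent_holomorphic, of "1 / 2" z u v] by (simp add: weight_def)
  have eq': "ddc (\<lambda>w. complex_of_real ((cmod w)\<^sup>2)) z u v = \<i> / 2 * (u * cnj v - cnj u * v)" for z u v
    using ddc_weight[of "\<lambda>_. 0" 1 z u v] by simp
  have "ddc (\<lambda>w. complex_of_real (weight w)) z u v
      = 1 / 2 * ddc (\<lambda>w. complex_of_real ((cmod w)\<^sup>2)) z u v" for z u v
    unfolding eq eq' by simp
  then show ?thesis
    using exponent_holomorphic finite_measure_atoms discrete_measure_atoms weight_def in_Lp_atoms
      q_form_bounded_fock toeplitz_schatten unbounded
    by (intro exI[of _ exponent] exI[of _ "atoms a"] exI[of _ weight]) blast
qed

end
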